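(* Let $H$ be a dual-quasitriangular Hopf algebra with differential calculus defined by a finite-dimensional right comodule $W$, i.e. $\Omega_0=\ker\epsilon/\ker(\rho_W\circ\mathcal Q)$ with $\rho_W\circ\mathcal Q:\Omega_0\cong V=\mathrm{End}(W)$. There is a braided-symmetric and $\mathrm{Ad}$-invariant "braided-Killing form" $$\eta_{\Omega_0}=(\tilde\pi_{\Omega_0}\otimes\tilde\pi_{\Omega_0})\Delta T\in\Omega_0\otimes\Omega_0;\qquad T=\mathcal R(\tau_{(1)}\otimes S\tau_{(2)})\,\tau_{(3)},\qquad \tau=\rho^\alpha{}_\alpha S\rho^\beta{}_\beta\in H,$$ (sums over $\alpha,\beta$), or equivalently, under $\Omega_0\cong V$, $$\eta=(\rho_W\circ\mathcal Q\otimes\rho_W\circ\mathcal Q)(\Delta T)-\mathrm{id}\otimes\rho_W\circ\mathcal Q(T)-\rho_W\circ\mathcal Q(T)\otimes\mathrm{id}+\epsilon(T)\,\mathrm{id}\otimes\mathrm{id}\in V\otimes V .$$ If $\eta$ is nondegenerate, there is a braided-symmetric Riemannian metric $g=(e\otimes_He)\eta$ with $\wedge(g)=0$.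
   Context: Everything is over a field $k$; $H$ is a Hopf algebra with invertible antipode $S$. A dual-quasitriangular structure is a convolution-invertible $\mathcal R:H\otimes H\to k$ with $\mathcal R(ab\otimes c)=\mathcal R(a\otimes c_{(1)})\mathcal R(b\otimes c_{(2)})$, $\mathcal R(a\otimes bc)=\mathcal R(a_{(1)}\otimes c)\mathcal R(a_{(2)}\otimes b)$ and $b_{(1)}a_{(1)}\mathcal R(a_{(2)}\otimes b_{(2)})=\mathcal R(a_{(1)}\otimes b_{(1)})a_{(2)}b_{(2)}$. $\mathcal Q:H\to H^*$ is $\langle\mathcal Q(h),g\rangle=\mathcal R(g_{(1)}\otimes h_{(1)})\mathcal R(h_{(2)}\otimes g_{(2)})$. $W$ has basis $\{e_\alpha\}$ and coaction $e_\alpha\mapsto e_\beta\otimes\rho^\beta{}_\alpha$; $\rho_W(x)^\alpha{}_\beta=\langle x,\rho^\alpha{}_\beta\rangle$ for $x\in H^*$. It is assumed that $\rho_W\circ\mathcal Q:\ker\epsilon\to\mathrm{End}(W)$ is surjective. $Q_H=\ker\epsilon\cap\ker(\rho_W\circ\mathcal Q)$ is a right ideal stable under $\mathrm{Ad}(h)=h_{(2)}\otimes(Sh_{(1)})h_{(3)}$, $\Omega_0=\ker\epsilon/Q_H$ (with the projected coaction $\mathrm{Ad}$), $\pi_{\Omega_0}:\ker\epsilon\to\Omega_0$ is the quotient and $\tilde\pi_{\Omega_0}(h)=\pi_{\Omega_0}(h-\epsilon(h)1)$. $\Omega^1(H)$ is the quotient of $\ker(H\otimes H\to H)$, $\mathrm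 dh=1\otimes h-h\otimes1$, by the subspace corresponding to $H\otimes Q_H$ under $h\otimes g\mapsto hg_{(1)}\otimes g_{(2)}$. $e_{MC}:\Omega_0\to\Omega^1(H)$ sends $v$ to the class of $S\tilde v_{(1)}\otimes\tilde v_{(2)}$ ($\tilde v\in\ker\epsilon$ lifting $v$), and $e=e_{MC}\circ(\rho_W\circ\mathcal Q)^{-1}:V\to\Omega^1(H)$. The braiding on $\Omega_0\otimes\Omega_0$ is $\Psi(v\otimes w)=\pi_{\Omega_0}(\tilde w_{(2)})\otimes v\cdot((S\tilde w_{(1)})\tilde w_{(3)})$ (using the right $H$-module structure of $\Omega_0$), and correspondingly on $\Omega^1(H)\otimes_H\Omega^1(H)$ via $e_{MC}\otimes_He_{MC}$ as a bimodule map; $\Omega^2(H)=\Omega^1(H)\otimes_H\Omega^1(H)/\ker(\mathrm{id}-\Psi)$ with quotient map $\wedge$. Braided-symmetric means $\Psi(\eta_{\Omega_0})=\eta_{\Omega_0}$ (and likewise for $g$); $\mathrm{Ad}$-invariant means invariant under the tensor product right adjoint coaction on $\Omega_0\otimes\Omega_0$. Nondegenerate means $V^*\to V$, $w\mapsto\eta^{(1)}\langle w,\eta^{(2)}\rangle$, is invertible. A (Riemannian) metric here means an element $g=\sum_ae^*(f^a)\otimes_He(e_a)\in\Omega^1(H)\otimes_H\Omega^1(H)$ for dual bases of $V,V^*$, where $e^*:V^*\to\Omega^1(H)$ is a linear map such that $V^*\otimes H\to\Omega^1(H)$, $w\otimes h\mapsto e^*(w)h$, is an isomorphism. *)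

theory Defs
  imports Complex_Main "HOL-Library.Poly_Mapping" "HOL-Library.FuncSet"
begin

section \<open>Vector spaces with carriers: quotients, Hom spaces, tensor products\<close>

text \<open>Quotients and tensor products are formed from spaces that are themselves quotients, so
  vector spaces are records with an explicit carrier over a field given by a type.\<close>

record ('k, 'v) vspace =
  carr :: "'v set"
  vplus :: "'v \<Rightarrow> 'v \<Rightarrow> 'v"
  vzero :: "'v"
  vscale :: "'k \<Rightarrow> 'v \<Rightarrow> 'v"

definition space_of :: "('k \<Rightarrow> 'v \<Rightarrow> 'v) \<Rightarrow> ('k, 'v::ab_group_add) vspace"
  where "space_of s = \<lparr>carr = UNIV, vplus = (+), vzero = 0, vscale = s\<rparr>"

definition ground :: "('k::field, 'k) vspace"
  where "ground = space_of (*)"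

definition vminus :: "('k::field, 'v) vspace \<Rightarrow> 'v \<Rightarrow> 'v \<Rightarrow> 'v"
  where "vminus V x y = vplus V x (vscale V (- 1) y)"

definition vsum :: "('k, 'v) vspace \<Rightarrow> ('i \<Rightarrow> 'v) \<Rightarrow> 'i set \<Rightarrow> 'v"
  where "vsum V f I = Finite_Set.fold (\<lambda>i. vplus V (f i)) (vzero V) I"

definition vlinear :: "('k, 'v) vspace \<Rightarrow> ('k, 'x) vspace \<Rightarrow> ('v \<Rightarrow> 'x) \<Rightarrow> bool"
  where "vlinear V X f \<longleftrightarrow>
    f \<in> carr V \<rightarrow> carr X \<and>
    (\<forall>v\<in>carr V. \<forall>w\<in>carr V. f (vplus V v w) = vplus X (f v) (f w)) \<and>
    (\<forall>c. \<forall>v\<in>carr V. f (vscale V c v) = vscale X c (f v))"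

definition viso :: "('k, 'v) vspace \<Rightarrow> ('k, 'x) vspace \<Rightarrow> ('v \<Rightarrow> 'x) \<Rightarrow> bool"
  where "viso V X f \<longleftrightarrow> vlinear V X f \<and> bij_betw f (carr V) (carr X)"

definition vsubspace :: "('k, 'v) vspace \<Rightarrow> 'v set \<Rightarrow> bool"
  where "vsubspace V U \<longleftrightarrow>
    U \<subseteq> carr V \<and> vzero V \<in> U \<and>
    (\<forall>x\<in>U. \<forall>y\<in>U. vplus V x y \<in> U) \<and> (\<forall>c. \<forall>x\<in>U. vscale V c x \<in> U)"

definition vspan :: "('k, 'v) vspace \<Rightarrow> 'v set \<Rightarrow> 'v set"
  where "vspan V A = \<Inter>{U. vsubspace V U \<and> A \<subseteq> U}"

definition vsub :: "('k, 'v) vspace \<Rightarrow> 'v set \<Rightarrow> ('k, 'v) vspace"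
  where "vsub V U = V\<lparr>carr := U\<rparr>"

definition coset :: "('k, 'v) vspace \<Rightarrow> 'v set \<Rightarrow> 'v \<Rightarrow> 'v set"
  where "coset V N x = {vplus V x n | n. n \<in> N}"

text \<open>Scalar multiples of a coset are again thickened by \<open>N\<close>, since \<open>0 \<cdot> (x + N)\<close> must be
  \<open>N\<close> and not \<open>{0}\<close>.  A map on a quotient that is given on representatives by \<open>f\<close> is written
  below as \<open>\<lambda>A. the_elem (f ` A)\<close>.\<close>

definition quot :: "('k, 'v) vspace \<Rightarrow> 'v set \<Rightarrow> ('k, 'v set) vspace"
  where "quot V N =
    \<lparr>carr = coset V N ` carr V,
     vplus = (\<lambda>A B. {vplus V a b | a b. a \<in> A \<and> b \<in> B}),
     vzero = N,
     vscale = (\<lambda>c A. {vplus V (vscale V c a) n | a n. a \<in> A \<and> n \<in> N})\<rparr>"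

definition vhom :: "('k, 'v) vspace \<Rightarrow> ('k, 'x) vspace \<Rightarrow> ('k, 'v \<Rightarrow> 'x) vspace"
  where "vhom V X =
    \<lparr>carr = {f. f \<in> extensional (carr V) \<and> vlinear V X f},
     vplus = (\<lambda>f g. restrict (\<lambda>v. vplus X (f v) (g v)) (carr V)),
     vzero = restrict (\<lambda>v. vzero X) (carr V),
     vscale = (\<lambda>c f. restrict (\<lambda>v. vscale X c (f v)) (carr V))\<rparr>"

definition vdual :: "('k::field, 'v) vspace \<Rightarrow> ('k, 'v \<Rightarrow> 'k) vspace"
  where "vdual V = vhom V ground"

text \<open>A finite basis \<open>A\<close> of \<open>V\<close>, with dual basis \<open>f a\<close> (\<open>a \<in> A\<close>).\<close>

definition dual_bases :: "('k::field, 'v) vspace \<Rightarrow> 'v set \<Rightarrow> ('v \<Rightarrow> 'v \<Rightarrow> 'k) \<Rightarrow> bool"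
  where "dual_bases V A f \<longleftrightarrow>
    finite A \<and> A \<subseteq> carr V \<and> f \<in> A \<rightarrow> carr (vdual V) \<and>
    (\<forall>a\<in>A. \<forall>b\<in>A. f a b = (if a = b then 1 else 0)) \<and>
    (\<forall>v\<in>carr V. v = vsum V (\<lambda>a. vscale V (f a v) a) A)"

definition free_space :: "'a set \<Rightarrow> ('k::field, 'a \<Rightarrow>\<^sub>0 'k) vspace"
  where "free_space A =
    \<lparr>carr = {t. Poly_Mapping.keys t \<subseteq> A}, vplus = (+), vzero = 0,
     vscale = (\<lambda>c. Poly_Mapping.map ((*) c))\<rparr>"

definition bilinear_rels ::
    "('k::field, 'v) vspace \<Rightarrow> ('k, 'w) vspace \<Rightarrow> ('v \<times> 'w \<Rightarrow>\<^sub>0 'k) set"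
  where "bilinear_rels V W =
    {Poly_Mapping.single (vplus V v v', w) 1 - Poly_Mapping.single (v, w) 1
       - Poly_Mapping.single (v', w) 1 | v v' w. v \<in> carr V \<and> v' \<in> carr V \<and> w \<in> carr W} \<union>
    {Poly_Mapping.single (v, vplus W w w') 1 - Poly_Mapping.single (v, w) 1
       - Poly_Mapping.single (v, w') 1 | v w w'. v \<in> carr V \<and> w \<in> carr W \<and> w' \<in> carr W} \<union>
    {Poly_Mapping.single (vscale V c v, w) 1 - Poly_Mapping.single (v, w) c
       | c v w. v \<in> carr V \<and> w \<in> carr W} \<union>
    {Poly_Mapping.single (v, vscale W c w) 1 - Poly_Mapping.single (v, w) c
       | c v w. v \<in> carr V \<and> w \<in> carr W}"

type_synonym ('k, 'v, 'w) tens = "('v \<times> 'w \<Rightarrow>\<^sub>0 'k) set"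

definition tensor ::
    "('k::field, 'v) vspace \<Rightarrow> ('k, 'w) vspace \<Rightarrow> ('k, ('k, 'v, 'w) tens) vspace"
  where "tensor V W =
    quot (free_space (carr V \<times> carr W))
      (vspan (free_space (carr V \<times> carr W)) (bilinear_rels V W))"

definition pure ::
    "('k::field, 'v) vspace \<Rightarrow> ('k, 'w) vspace \<Rightarrow> 'v \<Rightarrow> 'w \<Rightarrow> ('k, 'v, 'w) tens"
  where "pure V W v w =
    coset (free_space (carr V \<times> carr W))
      (vspan (free_space (carr V \<times> carr W)) (bilinear_rels V W))
      (Poly_Mapping.single (v, w) 1)"

text \<open>The linear map on the tensor product induced by a bilinear map \<open>F\<close>.\<close>

definition tlift ::
    "('k::field, 'v) vspace \<Rightarrow> ('k, 'w) vspace \<Rightarrow> ('k, 'x) vspace \<Rightarrow>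
     ('v \<Rightarrow> 'w \<Rightarrow> 'x) \<Rightarrow> ('k, 'v, 'w) tens \<Rightarrow> 'x"
  where "tlift V W X F =
    (THE f. f \<in> extensional (carr (tensor V W)) \<and> vlinear (tensor V W) X f \<and>
       (\<forall>v\<in>carr V. \<forall>w\<in>carr W. f (pure V W v w) = F v w))"

definition tmap ::
    "('k::field, 'v) vspace \<Rightarrow> ('k, 'w) vspace \<Rightarrow> ('k, 'x) vspace \<Rightarrow> ('k, 'y) vspace \<Rightarrow>
     ('v \<Rightarrow> 'x) \<Rightarrow> ('w \<Rightarrow> 'y) \<Rightarrow> ('k, 'v, 'w) tens \<Rightarrow> ('k, 'x, 'y) tens"
  where "tmap V W X Y f g = tlift V W (tensor X Y) (\<lambda>v w. pure X Y (f v) (g w))"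


section \<open>Dual-quasitriangular Hopf algebras\<close>

record (overloaded) ('k, 'h) hopf_data =
  hscale :: "'k \<Rightarrow> 'h \<Rightarrow> 'h"
  comult :: "'h \<Rightarrow> ('k, 'h, 'h) tens"
  counit :: "'h \<Rightarrow> 'k"
  antip :: "'h \<Rightarrow> 'h"

definition Hsp :: "('k, 'h::ab_group_add, 'z) hopf_data_scheme \<Rightarrow> ('k, 'h) vspace"
  where "Hsp C = space_of (hscale C)"

abbreviation HH :: "('k::field, 'h::ab_group_add, 'z) hopf_data_scheme \<Rightarrow> ('k, ('k, 'h, 'h) tens) vspace"
  where "HH C \<equiv> tensor (Hsp C) (Hsp C)"

abbreviation hpure :: "('k::field, 'h::ab_group_add, 'z) hopf_data_scheme \<Rightarrow> 'h \<Rightarrow> 'h \<Rightarrow> ('k, 'h, 'h) tens"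
  where "hpure C \<equiv> pure (Hsp C) (Hsp C)"

text \<open>Sweedler notation: for multilinear \<open>F\<close> with values in \<open>X\<close>, \<open>sweedler2 C X F h\<close> is
  \<open>F h\<^sub>(\<^sub>1\<^sub>) h\<^sub>(\<^sub>2\<^sub>)\<close> and \<open>sweedler3 C X F h\<close> is \<open>F h\<^sub>(\<^sub>1\<^sub>) h\<^sub>(\<^sub>2\<^sub>) h\<^sub>(\<^sub>3\<^sub>)\<close>.\<close>

definition sweedler2 ::
    "('k::field, 'h::ab_group_add, 'z) hopf_data_scheme \<Rightarrow> ('k, 'x) vspace \<Rightarrow>
     ('h \<Rightarrow> 'h \<Rightarrow> 'x) \<Rightarrow> 'h \<Rightarrow> 'x"
  where "sweedler2 C X F h = tlift (Hsp C) (Hsp C) X F (comult C h)"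

definition sweedler3 ::
    "('k::field, 'h::ab_group_add, 'z) hopf_data_scheme \<Rightarrow> ('k, 'x) vspace \<Rightarrow>
     ('h \<Rightarrow> 'h \<Rightarrow> 'h \<Rightarrow> 'x) \<Rightarrow> 'h \<Rightarrow> 'x"
  where "sweedler3 C X F h = sweedler2 C X (\<lambda>x c. sweedler2 C X (\<lambda>a b. F a b c) x) h"

definition hopf_algebra :: "('k::field, 'h::ring_1, 'z) hopf_data_scheme \<Rightarrow> bool"
  where "hopf_algebra C \<longleftrightarrow>
    vector_space (hscale C) \<and>
    (\<forall>c a b. hscale C c a * b = hscale C c (a * b) \<and> a * hscale C c b = hscale C c (a * b)) \<and>
    vlinear (Hsp C) (HH C) (comult C) \<and>
    vlinear (Hsp C) ground (counit C) \<and>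
    vlinear (Hsp C) (Hsp C) (antip C) \<and>
    \<comment> \<open>coassociativity, as an equation in \<open>H \<otimes> (H \<otimes> H)\<close>\<close>
    (\<forall>h. sweedler3 C (tensor (Hsp C) (HH C)) (\<lambda>a b c. pure (Hsp C) (HH C) a (hpure C b c)) h =
         sweedler2 C (tensor (Hsp C) (HH C)) (\<lambda>a b. pure (Hsp C) (HH C) a (comult C b)) h) \<and>
    (\<forall>h. sweedler2 C (Hsp C) (\<lambda>a b. hscale C (counit C a) b) h = h) \<and>
    (\<forall>h. sweedler2 C (Hsp C) (\<lambda>a b. hscale C (counit C b) a) h = h) \<and>
    comult C 1 = hpure C 1 1 \<and>
    (\<forall>g h. comult C (g * h) =
       sweedler2 C (HH C) (\<lambda>g1 g2. sweedler2 C (HH C) (\<lambda>h1 h2. hpure C (g1 * h1) (g2 * h2)) h) g) \<and>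
    counit C 1 = 1 \<and>
    (\<forall>g h. counit C (g * h) = counit C g * counit C h) \<and>
    (\<forall>h. sweedler2 C (Hsp C) (\<lambda>a b. antip C a * b) h = hscale C (counit C h) 1) \<and>
    (\<forall>h. sweedler2 C (Hsp C) (\<lambda>a b. a * antip C b) h = hscale C (counit C h) 1)"

text \<open>A Hopf algebra with a form \<open>Rform : H \<otimes> H \<rightarrow> k\<close> and a right comodule \<open>W\<close> with basis
  \<open>wbasis\<close>; the basis vectors serve as their own indices, \<open>rho C \<beta> \<alpha>\<close> being the matrix
  coefficient with upper index \<open>\<beta>\<close> and lower index \<open>\<alpha>\<close>.\<close>

record (overloaded) ('k, 'h, 'w) calc_data = "('k, 'h) hopf_data" +
  Rform :: "('k, 'h, 'h) tens \<Rightarrow> 'k"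
  wscale :: "'k \<Rightarrow> 'w \<Rightarrow> 'w"
  wbasis :: "'w set"
  coact :: "'w \<Rightarrow> ('k, 'w, 'h) tens"
  rho :: "'w \<Rightarrow> 'w \<Rightarrow> 'h"

definition conv_inverse ::
    "('k::field, 'h::ab_group_add, 'z) hopf_data_scheme \<Rightarrow>
     (('k, 'h, 'h) tens \<Rightarrow> 'k) \<Rightarrow> (('k, 'h, 'h) tens \<Rightarrow> 'k) \<Rightarrow> bool"
  where "conv_inverse C R R' \<longleftrightarrow>
    (\<forall>a b. sweedler2 C ground (\<lambda>a1 a2. sweedler2 C ground
        (\<lambda>b1 b2. R (hpure C a1 b1) * R' (hpure C a2 b2)) b) a = counit C a * counit C b) \<and>
    (\<forall>a b. sweedler2 C ground (\<lambda>a1 a2. sweedler2 C ground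
        (\<lambda>b1 b2. R' (hpure C a1 b1) * R (hpure C a2 b2)) b) a = counit C a * counit C b)"

definition dual_quasitriangular :: "('k::field, 'h::ring_1, 'w) calc_data \<Rightarrow> bool"
  where "dual_quasitriangular C \<longleftrightarrow>
    vlinear (HH C) ground (Rform C) \<and>
    (\<exists>R'. vlinear (HH C) ground R' \<and> conv_inverse C (Rform C) R') \<and>
    (\<forall>a b c. Rform C (hpure C (a * b) c) =
       sweedler2 C ground (\<lambda>c1 c2. Rform C (hpure C a c1) * Rform C (hpure C b c2)) c) \<and>
    (\<forall>a b c. Rform C (hpure C a (b * c)) =
       sweedler2 C ground (\<lambda>a1 a2. Rform C (hpure C a1 c) * Rform C (hpure C a2 b)) a) \<and>
    (\<forall>a b. sweedler2 C (Hsp C) (\<lambda>a1 a2. sweedler2 C (Hsp C)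
         (\<lambda>b1 b2. hscale C (Rform C (hpure C a2 b2)) (b1 * a1)) b) a =
       sweedler2 C (Hsp C) (\<lambda>a1 a2. sweedler2 C (Hsp C)
         (\<lambda>b1 b2. hscale C (Rform C (hpure C a1 b1)) (a2 * b2)) b) a)"

definition Wsp :: "('k, 'h, 'w::ab_group_add) calc_data \<Rightarrow> ('k, 'w) vspace"
  where "Wsp C = space_of (wscale C)"

definition fd_right_comodule :: "('k::field, 'h::ring_1, 'w::ab_group_add) calc_data \<Rightarrow> bool"
  where "fd_right_comodule C \<longleftrightarrow>
    finite_dimensional_vector_space (wscale C) (wbasis C) \<and>
    vlinear (Wsp C) (tensor (Wsp C) (Hsp C)) (coact C) \<and>
    (\<forall>w. tlift (Wsp C) (Hsp C) (tensor (Wsp C) (HH C))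
           (\<lambda>w0 h. tlift (Wsp C) (Hsp C) (tensor (Wsp C) (HH C))
              (\<lambda>w0' h'. pure (Wsp C) (HH C) w0' (hpure C h' h)) (coact C w0)) (coact C w) =
         tlift (Wsp C) (Hsp C) (tensor (Wsp C) (HH C))
           (\<lambda>w0 h. pure (Wsp C) (HH C) w0 (comult C h)) (coact C w)) \<and>
    (\<forall>w. tlift (Wsp C) (Hsp C) (Wsp C) (\<lambda>w0 h. wscale C (counit C h) w0) (coact C w) = w) \<and>
    (\<forall>\<alpha>\<in>wbasis C. coact C \<alpha> =
       vsum (tensor (Wsp C) (Hsp C)) (\<lambda>\<beta>. pure (Wsp C) (Hsp C) \<beta> (rho C \<beta> \<alpha>)) (wbasis C))"


section \<open>The differential calculus defined by \<open>W\<close>\<close>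

definition Qmap :: "('k::field, 'h::ring_1, 'w) calc_data \<Rightarrow> 'h \<Rightarrow> 'h \<Rightarrow> 'k"
  where "Qmap C h g =
    sweedler2 C ground (\<lambda>g1 g2. sweedler2 C ground
      (\<lambda>h1 h2. Rform C (hpure C g1 h1) * Rform C (hpure C h2 g2)) h) g"

text \<open>\<open>V = End(W)\<close>, and the endomorphism \<open>\<rho>\<^sub>W(x)\<close> with matrix \<open>\<langle>x, \<rho>\<^sup>\<alpha>\<^sub>\<beta>\<rangle>\<close>, i.e.
  \<open>e\<^sub>\<beta> \<mapsto> \<Sum>\<^sub>\<alpha> \<langle>x, \<rho>\<^sup>\<alpha>\<^sub>\<beta>\<rangle> e\<^sub>\<alpha>\<close>.\<close>

definition EndW :: "('k::field, 'h, 'w::ab_group_add) calc_data \<Rightarrow> ('k, 'w \<Rightarrow> 'w) vspace"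
  where "EndW C = vhom (Wsp C) (Wsp C)"

definition rhoW :: "('k::field, 'h, 'w::ab_group_add) calc_data \<Rightarrow> ('h \<Rightarrow> 'k) \<Rightarrow> 'w \<Rightarrow> 'w"
  where "rhoW C x w =
    (\<Sum>\<alpha>\<in>wbasis C. \<Sum>\<beta>\<in>wbasis C.
       wscale C (x (rho C \<alpha> \<beta>) * module.representation (wscale C) (wbasis C) w \<beta>) \<alpha>)"

definition rhoQ :: "('k::field, 'h::ring_1, 'w::ab_group_add) calc_data \<Rightarrow> 'h \<Rightarrow> 'w \<Rightarrow> 'w"
  where "rhoQ C h = rhoW C (Qmap C h)"

definition ker_counit :: "('k::field, 'h::ab_group_add, 'z) hopf_data_scheme \<Rightarrow> 'h set"
  where "ker_counit C = {h. counit C h = 0}"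

definition QH :: "('k::field, 'h::ring_1, 'w::ab_group_add) calc_data \<Rightarrow> 'h set"
  where "QH C = {h \<in> ker_counit C. rhoQ C h = vzero (EndW C)}"

definition Omega0 :: "('k::field, 'h::ring_1, 'w::ab_group_add) calc_data \<Rightarrow> ('k, 'h set) vspace"
  where "Omega0 C = quot (vsub (Hsp C) (ker_counit C)) (QH C)"

definition proj0 :: "('k::field, 'h::ring_1, 'w::ab_group_add) calc_data \<Rightarrow> 'h \<Rightarrow> 'h set"
  where "proj0 C h = coset (vsub (Hsp C) (ker_counit C)) (QH C) h"

definition tproj0 :: "('k::field, 'h::ring_1, 'w::ab_group_add) calc_data \<Rightarrow> 'h \<Rightarrow> 'h set"
  where "tproj0 C h = proj0 C (h - hscale C (counit C h) 1)"

text \<open>\<open>\<Omega>\<^sub>0 \<rightarrow> V\<close> induced by \<open>\<rho>\<^sub>W \<circ> Q\<close>.\<close>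

definition rhoQ0 :: "('k::field, 'h::ring_1, 'w::ab_group_add) calc_data \<Rightarrow> 'h set \<Rightarrow> 'w \<Rightarrow> 'w"
  where "rhoQ0 C v = the_elem (rhoQ C ` v)"

definition ract0 ::
    "('k::field, 'h::ring_1, 'w::ab_group_add) calc_data \<Rightarrow> 'h set \<Rightarrow> 'h \<Rightarrow> 'h set"
  where "ract0 C v h = the_elem ((\<lambda>x. proj0 C (x * h)) ` v)"

text \<open>\<open>Ad(h) = h\<^sub>(\<^sub>2\<^sub>) \<otimes> (S h\<^sub>(\<^sub>1\<^sub>)) h\<^sub>(\<^sub>3\<^sub>)\<close> maps \<open>ker \<epsilon>\<close> to \<open>ker \<epsilon> \<otimes> H\<close>, but the individual legs
  \<open>h\<^sub>(\<^sub>2\<^sub>)\<close> need not lie in \<open>ker \<epsilon>\<close>.  As \<open>\<epsilon>(h\<^sub>(\<^sub>2\<^sub>)) (S h\<^sub>(\<^sub>1\<^sub>)) h\<^sub>(\<^sub>3\<^sub>) = 0\<close> for \<open>h \<in> ker \<epsilon>\<close>, the projection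
  to \<open>\<Omega>\<^sub>0 \<otimes> H\<close> of the total is obtained by applying \<open>tproj0\<close> to that leg.\<close>

definition Ad0 ::
    "('k::field, 'h::ring_1, 'w::ab_group_add) calc_data \<Rightarrow> 'h set \<Rightarrow> ('k, 'h set, 'h) tens"
  where "Ad0 C v = the_elem
    (sweedler3 C (tensor (Omega0 C) (Hsp C))
       (\<lambda>h1 h2 h3. pure (Omega0 C) (Hsp C) (tproj0 C h2) (antip C h1 * h3)) ` v)"

text \<open>The tensor product coaction on \<open>\<Omega>\<^sub>0 \<otimes> \<Omega>\<^sub>0\<close>.\<close>

definition Ad00 ::
    "('k::field, 'h::ring_1, 'w::ab_group_add) calc_data \<Rightarrow> ('k, 'h set, 'h set) tens \<Rightarrow>
     ('k, ('k, 'h set, 'h set) tens, 'h) tens"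
  where "Ad00 C =
    (let O0 = Omega0 C; O00 = tensor O0 O0; X = tensor O00 (Hsp C) in
     tlift O0 O0 X (\<lambda>v w.
       tlift O0 (Hsp C) X (\<lambda>v0 a.
         tlift O0 (Hsp C) X (\<lambda>w0 b. pure O00 (Hsp C) (pure O0 O0 v0 w0) (a * b)) (Ad0 C w))
       (Ad0 C v)))"

definition Ad_invariant ::
    "('k::field, 'h::ring_1, 'w::ab_group_add) calc_data \<Rightarrow> ('k, 'h set, 'h set) tens \<Rightarrow> bool"
  where "Ad_invariant C t \<longleftrightarrow> Ad00 C t = pure (tensor (Omega0 C) (Omega0 C)) (Hsp C) t 1"

definition Psi0 ::
    "('k::field, 'h::ring_1, 'w::ab_group_add) calc_data \<Rightarrow>
     ('k, 'h set, 'h set) tens \<Rightarrow> ('k, 'h set, 'h set) tens"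
  where "Psi0 C =
    (let O0 = Omega0 C; O00 = tensor O0 O0 in
     tlift O0 O0 O00 (\<lambda>v w. the_elem
       (sweedler3 C O00 (\<lambda>h1 h2 h3. pure O0 O0 (tproj0 C h2) (ract0 C v (antip C h1 * h3))) ` w)))"

text \<open>\<open>\<Omega>\<^sup>1(H)\<close>: the kernel of the product modulo those elements that
  \<open>h \<otimes> g \<mapsto> h g\<^sub>(\<^sub>1\<^sub>) \<otimes> g\<^sub>(\<^sub>2\<^sub>)\<close> sends into \<open>H \<otimes> Q\<^sub>H\<close>.\<close>

definition ker_mult :: "('k::field, 'h::ring_1, 'z) hopf_data_scheme \<Rightarrow> ('k, 'h, 'h) tens set"
  where "ker_mult C = {t \<in> carr (HH C). tlift (Hsp C) (Hsp C) (Hsp C) (*) t = 0}"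

definition N1 :: "('k::field, 'h::ring_1, 'w::ab_group_add) calc_data \<Rightarrow> ('k, 'h, 'h) tens set"
  where "N1 C = {t \<in> ker_mult C.
    tlift (Hsp C) (Hsp C) (HH C) (\<lambda>h g. sweedler2 C (HH C) (\<lambda>g1 g2. hpure C (h * g1) g2) g) t
      \<in> vspan (HH C) {hpure C h q | h q. q \<in> QH C}}"

definition Omega1 ::
    "('k::field, 'h::ring_1, 'w::ab_group_add) calc_data \<Rightarrow> ('k, ('k, 'h, 'h) tens set) vspace"
  where "Omega1 C = quot (vsub (HH C) (ker_mult C)) (N1 C)"

definition proj1 ::
    "('k::field, 'h::ring_1, 'w::ab_group_add) calc_data \<Rightarrow> ('k, 'h, 'h) tens \<Rightarrow> ('k, 'h, 'h) tens set"
  where "proj1 C t = coset (vsub (HH C) (ker_mult C)) (N1 C) t"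

definition lact1 ::
    "('k::field, 'h::ring_1, 'w::ab_group_add) calc_data \<Rightarrow> 'h \<Rightarrow>
     ('k, 'h, 'h) tens set \<Rightarrow> ('k, 'h, 'h) tens set"
  where "lact1 C a \<omega> = the_elem
    ((\<lambda>t. proj1 C (tlift (Hsp C) (Hsp C) (HH C) (\<lambda>h g. hpure C (a * h) g) t)) ` \<omega>)"

definition ract1 ::
    "('k::field, 'h::ring_1, 'w::ab_group_add) calc_data \<Rightarrow> ('k, 'h, 'h) tens set \<Rightarrow>
     'h \<Rightarrow> ('k, 'h, 'h) tens set"
  where "ract1 C \<omega> a = the_elem
    ((\<lambda>t. proj1 C (tlift (Hsp C) (Hsp C) (HH C) (\<lambda>h g. hpure C h (g * a)) t)) ` \<omega>)"

definition eMC ::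
    "('k::field, 'h::ring_1, 'w::ab_group_add) calc_data \<Rightarrow> 'h set \<Rightarrow> ('k, 'h, 'h) tens set"
  where "eMC C v = the_elem
    ((\<lambda>x. proj1 C (sweedler2 C (HH C) (\<lambda>x1 x2. hpure C (antip C x1) x2) x)) ` v)"

definition eV ::
    "('k::field, 'h::ring_1, 'w::ab_group_add) calc_data \<Rightarrow> ('w \<Rightarrow> 'w) \<Rightarrow> ('k, 'h, 'h) tens set"
  where "eV C m = eMC C (inv_into (carr (Omega0 C)) (rhoQ0 C) m)"

text \<open>\<open>\<Omega>\<^sup>1 \<otimes>\<^sub>H \<Omega>\<^sup>1\<close> as the quotient of \<open>\<Omega>\<^sup>1 \<otimes> \<Omega>\<^sup>1\<close> that makes the two inner actions agree.\<close>

type_synonym ('k, 'h) tens11 =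
  "('k, ('k, 'h, 'h) tens set, ('k, 'h, 'h) tens set) tens set"

definition balanced_rels ::
    "('k::field, 'h::ring_1, 'w::ab_group_add) calc_data \<Rightarrow> ('k, 'h) tens11"
  where "balanced_rels C = vspan (tensor (Omega1 C) (Omega1 C))
    {vminus (tensor (Omega1 C) (Omega1 C))
       (pure (Omega1 C) (Omega1 C) (ract1 C \<omega> a) \<zeta>)
       (pure (Omega1 C) (Omega1 C) \<omega> (lact1 C a \<zeta>))
     | \<omega> a \<zeta>. \<omega> \<in> carr (Omega1 C) \<and> \<zeta> \<in> carr (Omega1 C)}"

definition Omega11 ::
    "('k::field, 'h::ring_1, 'w::ab_group_add) calc_data \<Rightarrow> ('k, ('k, 'h) tens11) vspace"
  where "Omega11 C = quot (tensor (Omega1 C) (Omega1 C)) (balanced_rels C)"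

definition proj11 ::
    "('k::field, 'h::ring_1, 'w::ab_group_add) calc_data \<Rightarrow>
     ('k, ('k, 'h, 'h) tens set, ('k, 'h, 'h) tens set) tens \<Rightarrow> ('k, 'h) tens11"
  where "proj11 C t = coset (tensor (Omega1 C) (Omega1 C)) (balanced_rels C) t"

definition pureH ::
    "('k::field, 'h::ring_1, 'w::ab_group_add) calc_data \<Rightarrow>
     ('k, 'h, 'h) tens set \<Rightarrow> ('k, 'h, 'h) tens set \<Rightarrow> ('k, 'h) tens11"
  where "pureH C \<omega> \<zeta> = proj11 C (pure (Omega1 C) (Omega1 C) \<omega> \<zeta>)"

definition lact11 ::
    "('k::field, 'h::ring_1, 'w::ab_group_add) calc_data \<Rightarrow> 'h \<Rightarrow> ('k, 'h) tens11 \<Rightarrow> ('k, 'h) tens11"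
  where "lact11 C a s = the_elem
    ((\<lambda>t. tlift (Omega1 C) (Omega1 C) (Omega11 C) (\<lambda>\<omega> \<zeta>. pureH C (lact1 C a \<omega>) \<zeta>) t) ` s)"

definition ract11 ::
    "('k::field, 'h::ring_1, 'w::ab_group_add) calc_data \<Rightarrow> ('k, 'h) tens11 \<Rightarrow> 'h \<Rightarrow> ('k, 'h) tens11"
  where "ract11 C s a = the_elem
    ((\<lambda>t. tlift (Omega1 C) (Omega1 C) (Omega11 C) (\<lambda>\<omega> \<zeta>. pureH C \<omega> (ract1 C \<zeta> a)) t) ` s)"

text \<open>\<open>e\<^sub>M\<^sub>C \<otimes>\<^sub>H e\<^sub>M\<^sub>C\<close>, and the bimodule map on \<open>\<Omega>\<^sup>1 \<otimes>\<^sub>H \<Omega>\<^sup>1\<close> that restricts to \<open>Psi0\<close> along it.\<close>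

definition eMC2 ::
    "('k::field, 'h::ring_1, 'w::ab_group_add) calc_data \<Rightarrow>
     ('k, 'h set, 'h set) tens \<Rightarrow> ('k, 'h) tens11"
  where "eMC2 C = tlift (Omega0 C) (Omega0 C) (Omega11 C) (\<lambda>v w. pureH C (eMC C v) (eMC C w))"

definition Psi1 ::
    "('k::field, 'h::ring_1, 'w::ab_group_add) calc_data \<Rightarrow> ('k, 'h) tens11 \<Rightarrow> ('k, 'h) tens11"
  where "Psi1 C =
    (THE f. f \<in> extensional (carr (Omega11 C)) \<and> vlinear (Omega11 C) (Omega11 C) f \<and>
       (\<forall>a. \<forall>s\<in>carr (Omega11 C). f (lact11 C a s) = lact11 C a (f s)) \<and>
       (\<forall>a. \<forall>s\<in>carr (Omega11 C). f (ract11 C s a) = ract11 C (f s) a) \<and>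
       (\<forall>t\<in>carr (tensor (Omega0 C) (Omega0 C)). f (eMC2 C t) = eMC2 C (Psi0 C t)))"

definition ker_id_minus_Psi ::
    "('k::field, 'h::ring_1, 'w::ab_group_add) calc_data \<Rightarrow> ('k, 'h) tens11 set"
  where "ker_id_minus_Psi C =
    {s \<in> carr (Omega11 C). vminus (Omega11 C) s (Psi1 C s) = vzero (Omega11 C)}"

definition Omega2 ::
    "('k::field, 'h::ring_1, 'w::ab_group_add) calc_data \<Rightarrow> ('k, ('k, 'h) tens11 set) vspace"
  where "Omega2 C = quot (Omega11 C) (ker_id_minus_Psi C)"

definition wedge ::
    "('k::field, 'h::ring_1, 'w::ab_group_add) calc_data \<Rightarrow> ('k, 'h) tens11 \<Rightarrow> ('k, 'h) tens11 set"
  where "wedge C s = coset (Omega11 C) (ker_id_minus_Psi C) s"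

definition is_metric ::
    "('k::field, 'h::ring_1, 'w::ab_group_add) calc_data \<Rightarrow> ('k, 'h) tens11 \<Rightarrow> bool"
  where "is_metric C g \<longleftrightarrow>
    (\<exists>estar A f.
       vlinear (vdual (EndW C)) (Omega1 C) estar \<and>
       viso (tensor (vdual (EndW C)) (Hsp C)) (Omega1 C)
         (tlift (vdual (EndW C)) (Hsp C) (Omega1 C) (\<lambda>x h. ract1 C (estar x) h)) \<and>
       dual_bases (EndW C) A f \<and>
       g = vsum (Omega11 C) (\<lambda>a. pureH C (estar (f a)) (eV C a)) A)"


section \<open>The braided-Killing form\<close>

definition tau :: "('k::field, 'h::ring_1, 'w) calc_data \<Rightarrow> 'h"
  where "tau C = (\<Sum>\<alpha>\<in>wbasis C. \<Sum>\<beta>\<in>wbasis C. rho C \<alpha> \<alpha> * antip C (rho C \<beta> \<beta>))"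

definition Tel :: "('k::field, 'h::ring_1, 'w) calc_data \<Rightarrow> 'h"
  where "Tel C =
    sweedler3 C (Hsp C) (\<lambda>a b c. hscale C (Rform C (hpure C a (antip C b))) c) (tau C)"

definition eta0 ::
    "('k::field, 'h::ring_1, 'w::ab_group_add) calc_data \<Rightarrow> ('k, 'h set, 'h set) tens"
  where "eta0 C =
    tmap (Hsp C) (Hsp C) (Omega0 C) (Omega0 C) (tproj0 C) (tproj0 C) (comult C (Tel C))"

definition eta ::
    "('k::field, 'h::ring_1, 'w::ab_group_add) calc_data \<Rightarrow> ('k, 'w \<Rightarrow> 'w, 'w \<Rightarrow> 'w) tens"
  where "eta C =
    (let V = EndW C; VV = tensor V V; T = Tel C in
     vplus VV
       (vminus VV
         (vminus VV
           (tmap (Hsp C) (Hsp C) V V (rhoQ C) (rhoQ C) (comult C T))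
           (pure V V id (rhoQ C T)))
         (pure V V (rhoQ C T) id))
       (vscale VV (counit C T) (pure V V id id)))"

definition nondegenerate ::
    "('k::field, 'v) vspace \<Rightarrow> ('k, 'v, 'v) tens \<Rightarrow> bool"
  where "nondegenerate V t \<longleftrightarrow>
    viso (vdual V) V (\<lambda>x. tlift V V V (\<lambda>v w. vscale V (x w) v) t)"

definition gmetric ::
    "('k::field, 'h::ring_1, 'w::ab_group_add) calc_data \<Rightarrow> ('k, 'h) tens11"
  where "gmetric C =
    tlift (EndW C) (EndW C) (Omega11 C) (\<lambda>x y. pureH C (eV C x) (eV C y)) (eta C)"

end

theory Submission
  imports Defs
begin

text \<open>The element \<open>\<tau>\<close> is a product of a character and the antipode of a character, hence
  cocommutative, and \<open>T = v(\<tau>\<^sub>(\<^sub>1\<^sub>)) \<tau>\<^sub>(\<^sub>2\<^sub>)\<close> for the functional \<open>v(h) = R(h\<^sub>(\<^sub>1\<^sub>) \<otimes> S h\<^sub>(\<^sub>2\<^sub>))\<close>,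
  which implements the square of the antipode.  Rotating the legs of \<open>\<tau>\<close> therefore gives
  \<open>Ad(T) = T \<otimes> 1\<close>.  As the coproduct intertwines \<open>Ad\<close> with the tensor product coaction, \<open>\<Delta>T\<close> is
  invariant as well, and its braiding \<open>T\<^sub>(\<^sub>3\<^sub>) \<otimes> T\<^sub>(\<^sub>1\<^sub>) S(T\<^sub>(\<^sub>2\<^sub>)) T\<^sub>(\<^sub>4\<^sub>)\<close> collapses to
  \<open>T\<^sub>(\<^sub>1\<^sub>) \<otimes> T\<^sub>(\<^sub>2\<^sub>)\<close>, up to a term that invariance kills.  Quasi-commutativity makes \<open>Q\<close> intertwine
  \<open>Ad\<close> with the coadjoint coaction, which is why \<open>Q\<^sub>H\<close> is stable under \<open>Ad\<close>.

  The calculus is free over \<open>\<Omega>\<^sub>0\<close> from the left, by \<open>h dg = h g\<^sub>(\<^sub>1\<^sub>) e(\<pi> g\<^sub>(\<^sub>2\<^sub>))\<close>, and, the antipode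
  being invertible, also from the right, by \<open>h e(v) = e(v S\<^sup>-\<^sup>1(h\<^sub>(\<^sub>2\<^sub>))) h\<^sub>(\<^sub>1\<^sub>)\<close>.  Composed with a
  nondegenerate \<open>\<eta>\<close>, the latter is the isomorphism that a metric requires.\<close>


text \<open>Well-definedness is the recurrent obstacle. Single legs of a coproduct lie neither in
  \<open>ker_counit C\<close> nor in \<open>QH C\<close>, so stability of \<open>QH C\<close> under
  \<open>Ad\<close> is stated through test maps: a bilinear map that kills \<open>1\<close> and
  \<open>QH C\<close> in its first argument vanishes on \<open>Ad(q)\<close>. Surjectivity of
  \<open>rhoQ C\<close> serves this by giving finitely many elements \<open>hunit i\<close> that
  span \<open>ker \<epsilon>\<close> modulo \<open>QH C\<close>, in which a test map can be
  expanded.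

  The calculus is reached through \<open>h \<otimes> g \<mapsto> h g1 \<otimes> g2\<close>, whose
  inverse is \<open>h \<otimes> g \<mapsto> h S(g1) \<otimes> g2\<close>. In these terms its
  relations read \<open>h S(q1) dq2 = 0\<close> for \<open>q\<close> in \<open>QH C\<close>, and
  every map out of it is checked on that expression. For the braiding of \<open>e(v)\<close> with it
  the legs of \<open>Ad(q)\<close> appear, so stability under \<open>Ad\<close> is what makes the
  braiding exist. As \<open>Psi1\<close> is a definite description, uniqueness is proved too; it
  rests on the left multiples of \<open>e(v) \<otimes> e(w)\<close> spanning
  \<open>\<Omega>^1 \<otimes>_H \<Omega>^1\<close>.\<close>

definition is_vspace :: "('k::field, 'v) vspace \<Rightarrow> bool"
  where "is_vspace V \<longleftrightarrow>
    vzero V \<in> carr V \<and>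
    (\<forall>x\<in>carr V. \<forall>y\<in>carr V. vplus V x y \<in> carr V) \<and>
    (\<forall>c. \<forall>x\<in>carr V. vscale V c x \<in> carr V) \<and>
    (\<forall>x\<in>carr V. \<forall>y\<in>carr V. vplus V x y = vplus V y x) \<and>
    (\<forall>x\<in>carr V. \<forall>y\<in>carr V. \<forall>z\<in>carr V.
       vplus V (vplus V x y) z = vplus V x (vplus V y z)) \<and>
    (\<forall>x\<in>carr V. vplus V (vzero V) x = x) \<and>
    (\<forall>x\<in>carr V. vscale V 0 x = vzero V) \<and>
    (\<forall>x\<in>carr V. vscale V 1 x = x) \<and>
    (\<forall>c d. \<forall>x\<in>carr V. vscale V c (vscale V d x) = vscale V (c * d) x) \<and>
    (\<forall>c. \<forall>x\<in>carr V. \<forall>y\<in>carr V.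
       vscale V c (vplus V x y) = vplus V (vscale V c x) (vscale V c y)) \<and>
    (\<forall>c d. \<forall>x\<in>carr V. vscale V (c + d) x = vplus V (vscale V c x) (vscale V d x))"

lemma is_vspaceI:
  assumes "vzero V \<in> carr V" "\<And>x y. x \<in> carr V \<Longrightarrow> y \<in> carr V \<Longrightarrow> vplus V x y \<in> carr V"
    "\<And>c x. x \<in> carr V \<Longrightarrow> vscale V c x \<in> carr V"
    "\<And>x y. x \<in> carr V \<Longrightarrow> y \<in> carr V \<Longrightarrow> vplus V x y = vplus V y x"
    "\<And>x y z. x \<in> carr V \<Longrightarrow> y \<in> carr V \<Longrightarrow> z \<in> carr V \<Longrightarrow>
       vplus V (vplus V x y) z = vplus V x (vplus V y z)"
    "\<And>x. x \<in> carr V \<Longrightarrow> vplus V (vzero V) x = x" "\<And>x. x \<in> carr V \<Longrightarrow> vscale V 0 x = vzero V"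
    "\<And>x. x \<in> carr V \<Longrightarrow> vscale V 1 x = x"
    "\<And>c d x. x \<in> carr V \<Longrightarrow> vscale V c (vscale V d x) = vscale V (c * d) x"
    "\<And>c x y. x \<in> carr V \<Longrightarrow> y \<in> carr V \<Longrightarrow>
       vscale V c (vplus V x y) = vplus V (vscale V c x) (vscale V c y)"
    "\<And>c d x. x \<in> carr V \<Longrightarrow> vscale V (c + d) x = vplus V (vscale V c x) (vscale V d x)"
  shows "is_vspace V"
  unfolding is_vspace_def using assms by simp

lemma vzero_carr [simp]: "is_vspace V \<Longrightarrow> vzero V \<in> carr V"
  and vplus_carr [simp]: "is_vspace V \<Longrightarrow> x \<in> carr V \<Longrightarrow> y \<in> carr V \<Longrightarrow> vplus V x y \<in> carr V"
  and vscale_carr [simp]: "is_vspace V \<Longrightarrow> x \<in> carr V \<Longrightarrow> vscale V c x \<in> carr V"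
  by (simp_all add: is_vspace_def)

lemma vplus_comm: "is_vspace V \<Longrightarrow> x \<in> carr V \<Longrightarrow> y \<in> carr V \<Longrightarrow> vplus V x y = vplus V y x"
  and vplus_assoc: "is_vspace V \<Longrightarrow> x \<in> carr V \<Longrightarrow> y \<in> carr V \<Longrightarrow> z \<in> carr V \<Longrightarrow>
    vplus V (vplus V x y) z = vplus V x (vplus V y z)"
  and vplus_zero_left [simp]: "is_vspace V \<Longrightarrow> x \<in> carr V \<Longrightarrow> vplus V (vzero V) x = x"
  and vscale_0 [simp]: "is_vspace V \<Longrightarrow> x \<in> carr V \<Longrightarrow> vscale V 0 x = vzero V"
  and vscale_1 [simp]: "is_vspace V \<Longrightarrow> x \<in> carr V \<Longrightarrow> vscale V 1 x = x"
  and vscale_vscale [simp]: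
    "is_vspace V \<Longrightarrow> x \<in> carr V \<Longrightarrow> vscale V c (vscale V d x) = vscale V (c * d) x"
  and vscale_vplus: "is_vspace V \<Longrightarrow> x \<in> carr V \<Longrightarrow> y \<in> carr V \<Longrightarrow>
    vscale V c (vplus V x y) = vplus V (vscale V c x) (vscale V c y)"
  and vscale_add: "is_vspace V \<Longrightarrow> x \<in> carr V \<Longrightarrow>
    vscale V (c + d) x = vplus V (vscale V c x) (vscale V d x)"
  unfolding is_vspace_def by blast+

lemma vplus_left_comm: "is_vspace V \<Longrightarrow> x \<in> carr V \<Longrightarrow> y \<in> carr V \<Longrightarrow> z \<in> carr V \<Longrightarrow>
    vplus V x (vplus V y z) = vplus V y (vplus V x z)"
  by (metis vplus_assoc vplus_comm)

lemma vplus_zero_right [simp]: "is_vspace V \<Longrightarrow> x \<in> carr V \<Longrightarrow> vplus V x (vzero V) = x"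
  by (metis vplus_comm vplus_zero_left vzero_carr)

lemma vscale_vzero [simp]: "is_vspace V \<Longrightarrow> vscale V c (vzero V) = vzero V"
  by (metis mult_zero_right vscale_0 vscale_vscale vzero_carr)

text \<open>The clause \<open>vscale V 0 x = vzero V\<close> of \<open>is_vspace\<close> supplies
  additive inverses: by distributivity \<open>x\<close> and its \<open>- 1\<close> multiple add up
  to its \<open>0\<close> multiple.\<close>

lemma vplus_neg [simp]: "is_vspace V \<Longrightarrow> x \<in> carr V \<Longrightarrow> vplus V x (vscale V (- 1) x) = vzero V"
  using vscale_add[of V x 1 "-1"] by simp

lemmas vplus_ac = vplus_assoc vplus_comm vplus_left_comm

lemma vminus_carr [simp]: "is_vspace V \<Longrightarrow> x \<in> carr V \<Longrightarrow> y \<in> carr V \<Longrightarrow> vminus V x y \<in> carr V"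
  by (simp add: vminus_def)

lemma vminus_self [simp]: "is_vspace V \<Longrightarrow> x \<in> carr V \<Longrightarrow> vminus V x x = vzero V"
  by (simp add: vminus_def)

lemma vplus_vminus_cancel: "is_vspace V \<Longrightarrow> x \<in> carr V \<Longrightarrow> y \<in> carr V \<Longrightarrow>
    vplus V y (vminus V x y) = x"
  by (simp add: vminus_def vplus_left_comm[of V y x])

lemma vplus_vminus: "is_vspace V \<Longrightarrow> x \<in> carr V \<Longrightarrow> y \<in> carr V \<Longrightarrow>
    vminus V (vplus V x y) x = y"
  by (simp add: vminus_def vplus_comm[of V x y] vplus_assoc)

lemma vminus_eq_vzero [simp]: "is_vspace V \<Longrightarrow> x \<in> carr V \<Longrightarrow> y \<in> carr V \<Longrightarrow>
    vminus V x y = vzero V \<longleftrightarrow> x = y"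
  by (metis vminus_self vplus_vminus_cancel vplus_zero_right)

lemma vminus_vzero [simp]: "is_vspace V \<Longrightarrow> x \<in> carr V \<Longrightarrow> vminus V x (vzero V) = x"
  by (simp add: vminus_def)

lemma is_vspace_space_of:
  fixes s :: "'k::field \<Rightarrow> 'v::ab_group_add \<Rightarrow> 'v"
  assumes "vector_space s"
  shows "is_vspace (space_of s)"
proof -
  interpret vector_space s by fact
  show ?thesis
    by (simp add: is_vspace_def space_of_def scale_right_distrib scale_left_distrib)
qed

lemma is_vspace_ground [simp]: "is_vspace ground"
  by (simp add: is_vspace_def ground_def space_of_def algebra_simps)

lemma ground_simps [simp]: "carr ground = UNIV" "vplus ground = (+)" "vzero ground = 0"
    "vscale ground = (*)"
  by (simp_all add: ground_def space_of_def)

lemma vminus_ground [simp]: "vminus ground x y = x - y"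
  by (simp add: vminus_def)

section \<open>Linear and bilinear maps\<close>

lemma vlinear_carr: "vlinear V X f \<Longrightarrow> x \<in> carr V \<Longrightarrow> f x \<in> carr X"
  by (auto simp: vlinear_def)

lemma vlinear_vplus: "vlinear V X f \<Longrightarrow> x \<in> carr V \<Longrightarrow> y \<in> carr V \<Longrightarrow>
    f (vplus V x y) = vplus X (f x) (f y)"
  by (auto simp: vlinear_def)

lemma vlinear_vscale: "vlinear V X f \<Longrightarrow> x \<in> carr V \<Longrightarrow> f (vscale V c x) = vscale X c (f x)"
  by (auto simp: vlinear_def)

lemma vlinear_vzero: "is_vspace V \<Longrightarrow> is_vspace X \<Longrightarrow> vlinear V X f \<Longrightarrow> f (vzero V) = vzero X"
  using vlinear_vscale[of V X f "vzero V" 0] by (simp add: vlinear_carr)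

lemma vlinear_vminus: "is_vspace V \<Longrightarrow> vlinear V X f \<Longrightarrow> x \<in> carr V \<Longrightarrow> y \<in> carr V \<Longrightarrow>
    f (vminus V x y) = vminus X (f x) (f y)"
  by (simp add: vminus_def vlinear_vplus vlinear_vscale)

lemma vlinearI:
  assumes "\<And>x. x \<in> carr V \<Longrightarrow> f x \<in> carr X"
    and "\<And>x y. x \<in> carr V \<Longrightarrow> y \<in> carr V \<Longrightarrow> f (vplus V x y) = vplus X (f x) (f y)"
    and "\<And>c x. x \<in> carr V \<Longrightarrow> f (vscale V c x) = vscale X c (f x)"
  shows "vlinear V X f"
  using assms by (auto simp: vlinear_def)

lemma vlinear_ident: "vlinear V V (\<lambda>x. x)"
  by (simp add: vlinear_def)

lemma vlinear_compose: "vlinear V X f \<Longrightarrow> vlinear U V g \<Longrightarrow> vlinear U X (\<lambda>u. f (g u))"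
  by (auto simp: vlinear_def Pi_iff)

text \<open>Agreement on the carrier is enough because the carrier is closed under the operations.
  The rule exchanges maps given through \<open>the_elem\<close> for explicit ones that agree with
  them only there.\<close>

lemma vlinear_cong:
  assumes V: "is_vspace V" and fg: "\<And>x. x \<in> carr V \<Longrightarrow> f x = g x"
  shows "vlinear V X f = vlinear V X g"
proof -
  have "vlinear V X g" if "vlinear V X f" "\<And>x. x \<in> carr V \<Longrightarrow> g x = f x" for f g
    using that(1) V by (intro vlinearI) (simp_all add: that(2) vlinear_carr vlinear_vplus vlinear_vscale)
  then show ?thesis using fg by metis
qed

lemma vlinear_restrict: "is_vspace V \<Longrightarrow> vlinear V X (restrict f (carr V)) = vlinear V X f"
  by (rule vlinear_cong) auto

lemma vlinear_zero: "is_vspace X \<Longrightarrow> vlinear V X (\<lambda>x. vzero X)"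
  by (auto simp: vlinear_def)

lemma vlinear_add:
  assumes "is_vspace X" "vlinear V X f" "vlinear V X g"
  shows "vlinear V X (\<lambda>x. vplus X (f x) (g x))"
  using assms
  by (auto intro!: vlinearI simp: vlinear_carr vlinear_vplus vlinear_vscale vscale_vplus vplus_ac)

lemma vlinear_scale:
  assumes "is_vspace X" "vlinear V X f"
  shows "vlinear V X (\<lambda>x. vscale X c (f x))"
  using assms
  by (auto intro!: vlinearI simp: vlinear_carr vlinear_vplus vlinear_vscale vscale_vplus mult.commute)

lemma vlinear_minus:
  assumes "is_vspace X" "vlinear V X f" "vlinear V X g"
  shows "vlinear V X (\<lambda>x. vminus X (f x) (g x))"
  unfolding vminus_def using assms by (intro vlinear_add vlinear_scale)

lemma vlinear_scale_left:
  assumes "is_vspace X" "x \<in> carr X" "vlinear V ground f"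
  shows "vlinear V X (\<lambda>v. vscale X (f v) x)"
  using assms by (auto intro!: vlinearI simp: vlinear_vplus vlinear_vscale vscale_add)

definition vbilinear :: "('k, 'v) vspace \<Rightarrow> ('k, 'w) vspace \<Rightarrow> ('k, 'x) vspace \<Rightarrow>
    ('v \<Rightarrow> 'w \<Rightarrow> 'x) \<Rightarrow> bool"
  where "vbilinear V W X F \<longleftrightarrow>
    (\<forall>v\<in>carr V. vlinear W X (\<lambda>w. F v w)) \<and> (\<forall>w\<in>carr W. vlinear V X (\<lambda>v. F v w))"

lemma vbilinearI:
  assumes "\<And>v. v \<in> carr V \<Longrightarrow> vlinear W X (\<lambda>w. F v w)"
    and "\<And>w. w \<in> carr W \<Longrightarrow> vlinear V X (\<lambda>v. F v w)"
  shows "vbilinear V W X F"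
  using assms by (simp add: vbilinear_def)

lemma vbilinear_right: "vbilinear V W X F \<Longrightarrow> v \<in> carr V \<Longrightarrow> vlinear W X (\<lambda>w. F v w)"
  and vbilinear_left: "vbilinear V W X F \<Longrightarrow> w \<in> carr W \<Longrightarrow> vlinear V X (\<lambda>v. F v w)"
  by (simp_all add: vbilinear_def)

lemma vbilinear_carr: "vbilinear V W X F \<Longrightarrow> v \<in> carr V \<Longrightarrow> w \<in> carr W \<Longrightarrow> F v w \<in> carr X"
  by (meson vbilinear_right vlinear_carr)

lemma vbilinear_compose:
  assumes "vlinear X Y f" "vbilinear V W X F"
  shows "vbilinear V W Y (\<lambda>v w. f (F v w))"
  using assms by (auto intro!: vbilinearI vlinear_compose[of X Y f] simp: vbilinear_def)

section \<open>Finite sums\<close>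

text \<open>The graph of a fold over \<open>I\<close> evaluates the step function at elements of
  \<open>I\<close> only, so the two graphs coincide, whatever the space is.\<close>

lemma vsum_cong:
  assumes "\<And>i. i \<in> I \<Longrightarrow> f i = g i"
  shows "vsum V f I = vsum V g I"
proof -
  have *: "fold_graph (\<lambda>i. vplus V (g i)) z A y"
    if "fold_graph (\<lambda>i. vplus V (f i)) z A y" "A \<subseteq> I" "\<And>i. i \<in> I \<Longrightarrow> g i = f i" for z A y f g
    using that(1,2)
  proof (induction rule: fold_graph.induct)
    case (insertI x A y)
    then have "fold_graph (\<lambda>i. vplus V (g i)) z (insert x A) (vplus V (g x) y)"
      by (auto intro: fold_graph.intros)
    then show ?case using insertI by (simp add: that(3))
  qed (rule fold_graph.intros)
  have "fold_graph (\<lambda>i. vplus V (g i)) z I y = fold_graph (\<lambda>i. vplus V (f i)) z I y" for z y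
    using *[of f z I y g] *[of g z I y f] assms by auto
  then show ?thesis by (simp add: vsum_def Finite_Set.fold_def)
qed

lemma vsum_empty [simp]: "vsum V f {} = vzero V"
  by (simp add: vsum_def)

text \<open>Addition of \<open>f i\<close> and addition of \<open>f j\<close> commute on the carrier
  only, whereas the fold lemmas ask for an equation of functions. The fold is therefore compared
  with that of \<open>g\<close>, which is the identity off the carrier; both start at
  \<open>vzero V\<close> and never leave the carrier.\<close>

lemma vsum_insert:
  assumes V: "is_vspace V" and I: "finite I" "i \<notin> I" and fi: "f i \<in> carr V"
    and fI: "\<And>j. j \<in> I \<Longrightarrow> f j \<in> carr V"
  shows "vsum V f (insert i I) = vplus V (f i) (vsum V f I)" "vsum V f I \<in> carr V"
proof -
  have f: "\<And>j. j \<in> insert i I \<Longrightarrow> f j \<in> carr V" using fi fI by auto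
  define g where "g = (\<lambda>j x. if x \<in> carr V then vplus V (f j) x else x)"
  interpret comp_fun_commute_on "insert i I" g
    by unfold_locales (auto simp: g_def fun_eq_iff V f vplus_left_comm)
  have 1: "y \<in> carr V \<and> fold_graph g z A y"
    if "fold_graph (\<lambda>i. vplus V (f i)) z A y" "A \<subseteq> insert i I" "z \<in> carr V" for z A y
    using that
  proof (induction rule: fold_graph.induct)
    case (insertI x A y)
    then have "fold_graph g z (insert x A) (g x y)" by (auto intro: fold_graph.intros)
    with insertI show ?case using f V by (auto simp: g_def)
  qed (auto intro: fold_graph.intros)
  have 2: "y \<in> carr V \<and> fold_graph (\<lambda>i. vplus V (f i)) z A y"
    if "fold_graph g z A y" "A \<subseteq> insert i I" "z \<in> carr V" for z A y
    using that
  proof (induction rule: fold_graph.induct)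
    case (insertI x A y)
    then have "fold_graph (\<lambda>i. vplus V (f i)) z (insert x A) (vplus V (f x) y)"
      by (auto intro: fold_graph.intros)
    with insertI show ?case using f V by (auto simp: g_def)
  qed (auto intro: fold_graph.intros)
  have eq: "vsum V f A = Finite_Set.fold g (vzero V) A" if "A \<subseteq> insert i I" for A
  proof -
    have "fold_graph g (vzero V) A = fold_graph (\<lambda>i. vplus V (f i)) (vzero V) A"
      using 1 2 that V by (intro ext iffI) (meson vzero_carr)+
    then show ?thesis by (simp add: vsum_def Finite_Set.fold_def)
  qed
  have "fold_graph g (vzero V) I (Finite_Set.fold g (vzero V) I)"
    using I by (intro fold_graph_fold) auto
  with 2 V eq show c: "vsum V f I \<in> carr V" by (metis subset_insertI vzero_carr)
  have "Finite_Set.fold g (vzero V) (insert i I) = g i (Finite_Set.fold g (vzero V) I)"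
    using I by (intro fold_insert) auto
  then have "vsum V f (insert i I) = g i (vsum V f I)"
    by (simp only: eq[OF order_refl] eq[OF subset_insertI])
  with c show "vsum V f (insert i I) = vplus V (f i) (vsum V f I)" by (simp add: g_def)
qed

lemma vsum_carr [simp]:
  assumes V: "is_vspace V" and f: "\<And>j. j \<in> I \<Longrightarrow> f j \<in> carr V"
  shows "vsum V f I \<in> carr V"
proof (cases "finite I")
  case True
  then show ?thesis using f
    by (induction I rule: finite_induct) (auto simp: V vsum_insert)
qed (simp add: vsum_def V)

lemma vlinear_vsum_apply:
  assumes "is_vspace V" "is_vspace X" "vlinear V X \<phi>" and f: "\<And>j. j \<in> I \<Longrightarrow> f j \<in> carr V"
  shows "\<phi> (vsum V f I) = vsum X (\<lambda>i. \<phi> (f i)) I"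
proof (cases "finite I")
  case True
  then show ?thesis using f
    by (induction I rule: finite_induct)
       (auto simp: assms(1-3) vsum_insert vlinear_vzero vlinear_vplus[OF assms(3)] vlinear_carr[OF assms(3)])
qed (use assms in \<open>simp add: vsum_def vlinear_vzero\<close>)

lemma vlinear_sum:
  assumes V: "is_vspace V" and X: "is_vspace X" and F: "\<And>i. i \<in> I \<Longrightarrow> vlinear V X (\<lambda>v. F v i)"
  shows "vlinear V X (\<lambda>v. vsum X (F v) I)"
proof (cases "finite I")
  case True
  then show ?thesis using F
  proof (induction I rule: finite_induct)
    case (insert i I)
    have "vlinear V X (\<lambda>v. vplus X (F v i) (vsum X (F v) I))"
      using insert X by (intro vlinear_add) auto
    moreover have "vsum X (F v) (insert i I) = vplus X (F v i) (vsum X (F v) I)" if "v \<in> carr V" for v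
      by (intro vsum_insert(1)[where f = "F v"] X insert.hyps vlinear_carr[OF insert.prems that] insertI1 insertI2)
    ultimately show ?case
      using vlinear_cong[OF V, of "\<lambda>v. vsum X (F v) (insert i I)"
        "\<lambda>v. vplus X (F v i) (vsum X (F v) I)" X] by simp
  qed (simp add: X vlinear_zero)
qed (simp add: vsum_def X vlinear_zero)

lemma vsum_mono_neutral:
  assumes V: "is_vspace V" and B: "finite B" "A \<subseteq> B" and f: "\<And>i. i \<in> B \<Longrightarrow> f i \<in> carr V"
    and z: "\<And>i. i \<in> B - A \<Longrightarrow> f i = vzero V"
  shows "vsum V f A = vsum V f B"
proof -
  have "vsum V f A = vsum V f (A \<union> D)" if "D \<subseteq> B - A" "finite D" for D
    using that(2,1)
  proof (induction D rule: finite_induct)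
    case (insert d D)
    then have "vsum V f (insert d (A \<union> D)) = vplus V (f d) (vsum V f (A \<union> D))"
      using B f by (intro vsum_insert V) (auto intro: finite_subset)
    moreover have "vsum V f (A \<union> D) \<in> carr V"
      using insert B f by (intro vsum_carr V) auto
    ultimately show ?case using insert z V by simp
  qed simp
  from this[of "B - A"] B show ?thesis by (simp add: Un_absorb1)
qed

lemma vsum_add:
  assumes V: "is_vspace V" and f: "\<And>i. i \<in> I \<Longrightarrow> f i \<in> carr V" and g: "\<And>i. i \<in> I \<Longrightarrow> g i \<in> carr V"
  shows "vsum V (\<lambda>i. vplus V (f i) (g i)) I = vplus V (vsum V f I) (vsum V g I)"
proof (cases "finite I")
  case True
  then show ?thesis using f g
  proof (induction I rule: finite_induct)
    case (insert i I)
    then show ?case by (simp add: V vsum_insert vplus_ac)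
  qed (simp add: V)
qed (simp add: vsum_def V)

lemma vsum_swap:
  assumes V: "is_vspace V" and I: "finite I" "finite J"
    and f: "\<And>i j. i \<in> I \<Longrightarrow> j \<in> J \<Longrightarrow> f i j \<in> carr V"
  shows "vsum V (\<lambda>i. vsum V (f i) J) I = vsum V (\<lambda>j. vsum V (\<lambda>i. f i j) I) J"
  using I(1) f
proof (induction I rule: finite_induct)
  case empty
  show ?case using I(2) by (induction J rule: finite_induct) (auto simp: V vsum_insert)
next
  case (insert i I)
  have "vsum V (\<lambda>j. vsum V (\<lambda>i. f i j) (insert i I)) J
      = vsum V (\<lambda>j. vplus V (f i j) (vsum V (\<lambda>i. f i j) I)) J"
    using insert by (intro vsum_cong vsum_insert V) auto
  with insert show ?case by (simp add: V vsum_insert vsum_add)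
qed

lemma vsum_delta:
  assumes V: "is_vspace V" and I: "finite I" "i \<in> I" and x: "\<And>j. j \<in> I \<Longrightarrow> x j \<in> carr V"
  shows "vsum V (\<lambda>j. vscale V (if j = i then 1 else 0) (x j)) I = x i"
proof -
  have "vsum V (\<lambda>j. vscale V (if j = i then 1 else 0) (x j)) {i}
      = vsum V (\<lambda>j. vscale V (if j = i then 1 else 0) (x j)) I"
    using assms by (intro vsum_mono_neutral) auto
  then show ?thesis using vsum_insert(1)[OF V, of "{}" i "\<lambda>j. vscale V (if j = i then 1 else 0) (x j)"]
    by (simp add: V I x)
qed

lemma space_of_simps [simp]: "carr (space_of s) = UNIV" "vplus (space_of s) = (+)"
    "vzero (space_of s) = 0" "vscale (space_of s) = s"
  by (simp_all add: space_of_def)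

lemma vsum_space_of:
  assumes "vector_space s" "finite I"
  shows "vsum (space_of s) f I = sum f I"
  using assms(2) by (induction I rule: finite_induct) (simp_all add: vsum_insert is_vspace_space_of assms)

lemma vsum_ground: "finite I \<Longrightarrow> vsum ground f I = sum f I"
  by (induction I rule: finite_induct) (simp_all add: vsum_insert)

section \<open>Subspaces and quotients\<close>

lemma vsubspace_carr: "vsubspace V U \<Longrightarrow> x \<in> U \<Longrightarrow> x \<in> carr V"
  by (auto simp: vsubspace_def)

lemma vsubspace_vspan: "is_vspace V \<Longrightarrow> A \<subseteq> carr V \<Longrightarrow> vsubspace V (vspan V A)"
  unfolding vspan_def
  by (auto simp: vsubspace_def) 

lemma vspan_superset: "x \<in> A \<Longrightarrow> x \<in> vspan V A"
  by (auto simp: vspan_def)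

lemma vspan_minimal: "vsubspace V U \<Longrightarrow> A \<subseteq> U \<Longrightarrow> vspan V A \<subseteq> U"
  by (auto simp: vspan_def)

lemma vsubspace_kernel:
  "is_vspace V \<Longrightarrow> is_vspace X \<Longrightarrow> vlinear V X f \<Longrightarrow> vsubspace V {x\<in>carr V. f x = vzero X}"
  by (auto simp: vsubspace_def vlinear_vplus vlinear_vscale vlinear_vzero)

lemma vsubspace_equalizer:
  "is_vspace V \<Longrightarrow> is_vspace X \<Longrightarrow> vlinear V X f \<Longrightarrow> vlinear V X g \<Longrightarrow> vsubspace V {x\<in>carr V. f x = g x}"
  by (auto simp: vsubspace_def vlinear_vplus vlinear_vscale vlinear_vzero)

lemma vlinear_zero_on_vspan:
  assumes "is_vspace V" "is_vspace X" "vlinear V X f" "A \<subseteq> carr V" "\<And>a. a \<in> A \<Longrightarrow> f a = vzero X"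
    and "x \<in> vspan V A"
  shows "f x = vzero X"
  using vspan_minimal[OF vsubspace_kernel[OF assms(1-3)], of A] assms(4-) by auto

lemma vsub_simps [simp]: "carr (vsub V U) = U" "vplus (vsub V U) = vplus V"
    "vzero (vsub V U) = vzero V" "vscale (vsub V U) = vscale V"
  by (simp_all add: vsub_def)

lemma vminus_vsub [simp]: "vminus (vsub V U) = vminus V"
  by (simp add: vminus_def fun_eq_iff)

lemma is_vspace_vsub: "is_vspace V \<Longrightarrow> vsubspace V U \<Longrightarrow> is_vspace (vsub V U)"
  by (rule is_vspaceI)
     (auto simp: vsubspace_def vscale_vplus vscale_add vplus_assoc subset_eq intro: vplus_comm)

lemma vlinear_vsub: "vsubspace V U \<Longrightarrow> vlinear V X f \<Longrightarrow> vlinear (vsub V U) X f"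
  by (rule vlinearI) (simp_all add: vsubspace_carr vlinear_carr vlinear_vplus vlinear_vscale)

lemma vsubspace_vsub: "vsubspace V N \<Longrightarrow> N \<subseteq> U \<Longrightarrow> vsubspace (vsub V U) N"
  by (auto simp: vsubspace_def)

lemma mem_coset: "is_vspace V \<Longrightarrow> vsubspace V N \<Longrightarrow> x \<in> carr V \<Longrightarrow> x \<in> coset V N x"
  by (force simp: coset_def vsubspace_def intro: exI[of _ "vzero V"])

lemma coset_eq_iff:
  assumes V: "is_vspace V" and N: "vsubspace V N" and xy: "x \<in> carr V" "y \<in> carr V"
  shows "coset V N x = coset V N y \<longleftrightarrow> vminus V x y \<in> N"
proof
  assume "coset V N x = coset V N y"
  then obtain n where n: "n \<in> N" "x = vplus V y n"
    using mem_coset[OF V N xy(1)] by (auto simp: coset_def)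
  moreover have nc: "n \<in> carr V" using n vsubspace_carr[OF N] by auto
  ultimately show "vminus V x y \<in> N"
    using V xy by (simp add: vminus_def vplus_ac vplus_left_comm[of V y n])
next
  have *: "coset V N x \<subseteq> coset V N y" if "vminus V x y \<in> N" "x \<in> carr V" "y \<in> carr V" for x y
  proof
    fix z assume "z \<in> coset V N x"
    then obtain n where n: "n \<in> N" "z = vplus V x n" by (auto simp: coset_def)
    then have "z = vplus V y (vplus V (vminus V x y) n)"
      using V that vplus_vminus_cancel[of V x y] vsubspace_carr[OF N]
      by (metis vminus_carr vplus_assoc)
    moreover have "vplus V (vminus V x y) n \<in> N" using N that n by (auto simp: vsubspace_def)
    ultimately show "z \<in> coset V N y" by (auto simp: coset_def)
  qed
  assume "vminus V x y \<in> N"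
  moreover have "vminus V y x = vscale V (-1) (vminus V x y)"
    using V xy by (simp add: vminus_def vscale_vplus vplus_comm)
  ultimately have "vminus V y x \<in> N" using N by (auto simp: vsubspace_def)
  with * \<open>vminus V x y \<in> N\<close> xy show "coset V N x = coset V N y" by blast
qed

lemma vplus_quot_coset:
  assumes V: "is_vspace V" and N: "vsubspace V N" and xy: "x \<in> carr V" "y \<in> carr V"
  shows "vplus (quot V N) (coset V N x) (coset V N y) = coset V N (vplus V x y)"
proof -
  have "{vplus V a b |a b. a \<in> coset V N x \<and> b \<in> coset V N y} = coset V N (vplus V x y)"
  proof (intro equalityI subsetI)
    fix z assume "z \<in> {vplus V a b |a b. a \<in> coset V N x \<and> b \<in> coset V N y}"
    then obtain m n where mn: "m \<in> N" "n \<in> N" "z = vplus V (vplus V x m) (vplus V y n)"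
      by (auto simp: coset_def)
    then have "z = vplus V (vplus V x y) (vplus V m n)" "vplus V m n \<in> N"
      using V xy N vsubspace_carr[OF N] by (auto simp: vplus_ac vsubspace_def)
    then show "z \<in> coset V N (vplus V x y)" by (auto simp: coset_def)
  next
    fix z assume "z \<in> coset V N (vplus V x y)"
    then obtain n where n: "n \<in> N" "z = vplus V (vplus V x y) n" by (auto simp: coset_def)
    then have "z = vplus V x (vplus V y n)" "vplus V y n \<in> coset V N y"
      using V xy vsubspace_carr[OF N] by (auto simp: vplus_assoc coset_def)
    then show "z \<in> {vplus V a b |a b. a \<in> coset V N x \<and> b \<in> coset V N y}"
      using mem_coset[OF V N xy(1)] by blast
  qed
  then show ?thesis by (simp add: quot_def)
qed

lemma vscale_quot_coset:
  assumes V: "is_vspace V" and N: "vsubspace V N" and x: "x \<in> carr V"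
  shows "vscale (quot V N) c (coset V N x) = coset V N (vscale V c x)"
proof -
  have "{vplus V (vscale V c a) n |a n. a \<in> coset V N x \<and> n \<in> N} = coset V N (vscale V c x)"
  proof (intro equalityI subsetI)
    fix z assume "z \<in> {vplus V (vscale V c a) n |a n. a \<in> coset V N x \<and> n \<in> N}"
    then obtain m n where mn: "m \<in> N" "n \<in> N" "z = vplus V (vscale V c (vplus V x m)) n"
      by (auto simp: coset_def)
    then have "z = vplus V (vscale V c x) (vplus V (vscale V c m) n)" "vplus V (vscale V c m) n \<in> N"
      using V x N vsubspace_carr[OF N] by (auto simp: vscale_vplus vplus_assoc vsubspace_def)
    then show "z \<in> coset V N (vscale V c x)" by (auto simp: coset_def)
  next
    fix z assume "z \<in> coset V N (vscale V c x)"
    then show "z \<in> {vplus V (vscale V c a) n |a n. a \<in> coset V N x \<and> n \<in> N}"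
      using mem_coset[OF V N x] by (auto simp: coset_def)
  qed
  then show ?thesis by (simp add: quot_def)
qed

lemma vzero_quot: "is_vspace V \<Longrightarrow> vsubspace V N \<Longrightarrow> vzero (quot V N) = coset V N (vzero V)"
  using vsubspace_carr[of V N] by (force simp: quot_def coset_def)

lemma carr_quot: "carr (quot V N) = coset V N ` carr V"
  by (simp add: quot_def)

lemma is_vspace_quot:
  assumes V: "is_vspace V" and N: "vsubspace V N"
  shows "is_vspace (quot V N)"
  by (rule is_vspaceI; unfold carr_quot; (elim imageE)?;
      simp add: V vzero_quot[OF V N] vplus_quot_coset[OF V N] vscale_quot_coset[OF V N]
        vscale_vplus vscale_add vplus_ac[OF V])

lemma vlinear_coset: "is_vspace V \<Longrightarrow> vsubspace V N \<Longrightarrow> vlinear V (quot V N) (coset V N)"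
  by (intro vlinearI) (simp_all add: vplus_quot_coset vscale_quot_coset carr_quot)

lemma coset_eq_vzero:
  assumes "is_vspace V" "vsubspace V N" "x \<in> carr V"
  shows "coset V N x = vzero (quot V N) \<longleftrightarrow> x \<in> N"
  using assms by (simp add: vzero_quot coset_eq_iff)

text \<open>\<open>f\<close> is constant on the coset, so the image is a singleton. Every map that
  is given on representatives through \<open>the_elem\<close> gets its values from here.\<close>

lemma the_elem_coset:
  assumes V: "is_vspace V" and N: "vsubspace V N" and X: "is_vspace X"
    and f: "vlinear V X f" "\<And>n. n \<in> N \<Longrightarrow> f n = vzero X" and x: "x \<in> carr V"
  shows "the_elem (f ` coset V N x) = f x"
proof -
  have "f y = f x" if y: "y \<in> coset V N x" for y
  proof -
    obtain n where "n \<in> N" "y = vplus V x n" using y unfolding coset_def by blast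
    then show ?thesis
      using x X by (simp add: vlinear_vplus[OF f(1)] vlinear_carr[OF f(1)] f(2) vsubspace_carr[OF N])
  qed
  then have "f ` coset V N x = {f x}" using mem_coset[OF V N x] by blast
  then show ?thesis by simp
qed

lemma vlinear_quot_map:
  assumes V: "is_vspace V" and N: "vsubspace V N" and X: "is_vspace X"
    and f: "vlinear V X f" "\<And>n. n \<in> N \<Longrightarrow> f n = vzero X"
  shows "vlinear (quot V N) X (\<lambda>A. the_elem (f ` A))"
proof (intro vlinearI)
  show "the_elem (f ` A) \<in> carr X" if "A \<in> carr (quot V N)" for A
    using that by (auto simp: carr_quot the_elem_coset[OF V N X f] vlinear_carr[OF f(1)])
  show "the_elem (f ` vplus (quot V N) A B) = vplus X (the_elem (f ` A)) (the_elem (f ` B))"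
    if "A \<in> carr (quot V N)" "B \<in> carr (quot V N)" for A B
    using that V
    by (auto simp: carr_quot the_elem_coset[OF V N X f] vplus_quot_coset[OF V N] vlinear_vplus[OF f(1)])
  show "the_elem (f ` vscale (quot V N) c A) = vscale X c (the_elem (f ` A))"
    if "A \<in> carr (quot V N)" for A c
    using that V
    by (auto simp: carr_quot the_elem_coset[OF V N X f] vscale_quot_coset[OF V N] vlinear_vscale[OF f(1)])
qed

section \<open>Spaces of linear maps\<close>

lemma vhom_simps: "carr (vhom V X) = {f. f \<in> extensional (carr V) \<and> vlinear V X f}"
    "vplus (vhom V X) f g = restrict (\<lambda>v. vplus X (f v) (g v)) (carr V)"
    "vzero (vhom V X) = restrict (\<lambda>v. vzero X) (carr V)"
    "vscale (vhom V X) c f = restrict (\<lambda>v. vscale X c (f v)) (carr V)"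
  by (simp_all add: vhom_def)

lemma is_vspace_vhom:
  assumes V: "is_vspace V" and X: "is_vspace X"
  shows "is_vspace (vhom V X)"
proof (rule is_vspaceI)
  note lin = vlinear_restrict[OF V]
  fix f g h c d assume f: "f \<in> carr (vhom V X)"
  then have f': "f \<in> extensional (carr V)" "vlinear V X f" by (simp_all add: vhom_simps)
  note fc = vlinear_carr[OF f'(2)]
  show "vscale (vhom V X) c f \<in> carr (vhom V X)"
    using f' X by (simp add: vhom_simps lin vlinear_scale)
  show "vplus (vhom V X) (vzero (vhom V X)) f = f" "vscale (vhom V X) 1 f = f"
    using f' X fc by (auto simp: vhom_simps intro!: extensionalityI[where A = "carr V"])
  show "vscale (vhom V X) 0 f = vzero (vhom V X)"
    "vscale (vhom V X) c (vscale (vhom V X) d f) = vscale (vhom V X) (c * d) f"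
    "vscale (vhom V X) (c + d) f = vplus (vhom V X) (vscale (vhom V X) c f) (vscale (vhom V X) d f)"
    using X fc by (auto simp: vhom_simps vscale_add intro!: restrict_ext)
  assume g: "g \<in> carr (vhom V X)"
  then have g': "vlinear V X g" by (simp add: vhom_simps)
  note gc = vlinear_carr[OF g']
  show "vplus (vhom V X) f g \<in> carr (vhom V X)"
    using f' g' X by (simp add: vhom_simps lin vlinear_add)
  show "vplus (vhom V X) f g = vplus (vhom V X) g f"
    unfolding vhom_simps by (intro restrict_ext vplus_comm X fc gc)
  show "vscale (vhom V X) c (vplus (vhom V X) f g)
      = vplus (vhom V X) (vscale (vhom V X) c f) (vscale (vhom V X) c g)"
    unfolding vhom_simps by (rule restrict_ext) (simp add: X fc gc vscale_vplus)
  assume h: "h \<in> carr (vhom V X)"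
  then have "vlinear V X h" by (simp add: vhom_simps)
  note hc = vlinear_carr[OF this]
  show "vplus (vhom V X) (vplus (vhom V X) f g) h = vplus (vhom V X) f (vplus (vhom V X) g h)"
    unfolding vhom_simps by (rule restrict_ext) (simp add: X fc gc hc vplus_assoc)
qed (simp add: vhom_simps vlinear_restrict[OF V] vlinear_zero[OF X])

lemma vlinear_eval:
  assumes "v \<in> carr V"
  shows "vlinear (vhom V X) X (\<lambda>f. f v)"
  by (rule vlinearI) (auto simp: vhom_simps assms intro: vlinear_carr[OF _ assms])

section \<open>Tensor products\<close>

lemma carr_free_space: "carr (free_space A) = {t. Poly_Mapping.keys t \<subseteq> A}"
  and vplus_free_space [simp]: "vplus (free_space A) = (+)"
  and vzero_free_space [simp]: "vzero (free_space A) = 0"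
  and lookup_vscale_free_space [simp]:
    "Poly_Mapping.lookup (vscale (free_space A) c t) k = c * Poly_Mapping.lookup t k"
  by (auto simp: free_space_def Poly_Mapping.map.rep_eq when_def)

lemma keys_vscale_free_space: "Poly_Mapping.keys (vscale (free_space A) c t) \<subseteq> Poly_Mapping.keys t"
  by (auto simp: in_keys_iff)

lemma vminus_free_space [simp]: "vminus (free_space A) s t = s - t"
  by (rule poly_mapping_eqI) (simp add: vminus_def lookup_add lookup_minus)

lemma is_vspace_free_space: "is_vspace (free_space A)"
  unfolding is_vspace_def
  by (intro conjI ballI allI; (rule poly_mapping_eqI)?)
     (auto simp: carr_free_space lookup_add algebra_simps in_keys_iff
       dest!: subsetD[OF keys_add] subsetD[OF keys_vscale_free_space])

lemma single_carr: "a \<in> A \<Longrightarrow> Poly_Mapping.single a c \<in> carr (free_space A)"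
  by (auto simp: carr_free_space)

lemma vscale_single: "vscale (free_space A) c (Poly_Mapping.single a d) = Poly_Mapping.single a (c * d)"
  by (rule poly_mapping_eqI) (simp add: lookup_single when_def)

lemma poly_mapping_sum_single:
  "(\<Sum>k\<in>Poly_Mapping.keys t. Poly_Mapping.single k (Poly_Mapping.lookup t k)) = t"
  by (rule poly_mapping_eqI)
     (simp add: lookup_sum lookup_single when_def sum.delta in_keys_iff)

lemma free_space_induct:
  assumes U: "vsubspace (free_space A) U" and s: "\<And>a. a \<in> A \<Longrightarrow> Poly_Mapping.single a 1 \<in> U"
    and t: "t \<in> carr (free_space A)"
  shows "t \<in> U"
proof -
  have "(\<Sum>k\<in>B. Poly_Mapping.single k (Poly_Mapping.lookup t k)) \<in> U" if "finite B" "B \<subseteq> A" for B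
    using that
  proof (induction B rule: finite_induct)
    case empty
    then show ?case using U by (simp add: vsubspace_def)
  next
    case (insert b B)
    have "vscale (free_space A) (Poly_Mapping.lookup t b) (Poly_Mapping.single b 1) \<in> U"
      using insert U s by (auto simp: vsubspace_def)
    then show ?case using insert U by (auto simp: vsubspace_def vscale_single)
  qed
  from this[of "Poly_Mapping.keys t"] t show ?thesis
    by (simp add: carr_free_space poly_mapping_sum_single)
qed

definition free_lift :: "('k::field, 'x) vspace \<Rightarrow> ('a \<Rightarrow> 'x) \<Rightarrow> ('a \<Rightarrow>\<^sub>0 'k) \<Rightarrow> 'x"
  where "free_lift X F t = vsum X (\<lambda>k. vscale X (Poly_Mapping.lookup t k) (F k)) (Poly_Mapping.keys t)"

text \<open>The supports of \<open>s\<close>, \<open>t\<close>, \<open>s + t\<close> and of a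
  multiple differ; adding terms with coefficient zero lets all these sums run over one finite
  set.\<close>

lemma free_lift_superset:
  assumes "is_vspace X" "finite B" "Poly_Mapping.keys t \<subseteq> B" "\<And>k. k \<in> B \<Longrightarrow> F k \<in> carr X"
  shows "free_lift X F t = vsum X (\<lambda>k. vscale X (Poly_Mapping.lookup t k) (F k)) B"
  unfolding free_lift_def using assms
  by (intro vsum_mono_neutral) (auto simp: in_keys_iff)

lemma vlinear_free_lift:
  fixes X :: "('k::field, 'x) vspace" and F :: "'a \<Rightarrow> 'x"
  assumes X: "is_vspace X" and F: "\<And>a. a \<in> A \<Longrightarrow> F a \<in> carr X"
  shows "vlinear (free_space A) X (free_lift X F)"
proof (intro vlinearI)
  fix s t :: "'a \<Rightarrow>\<^sub>0 'k" and c
  assume s: "s \<in> carr (free_space A)"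
  then show "free_lift X F s \<in> carr X"
    using F X by (auto simp: free_lift_def carr_free_space intro!: vsum_carr)
  have "free_lift X F (vscale (free_space A) c s)
      = vsum X (\<lambda>k. vscale X c (vscale X (Poly_Mapping.lookup s k) (F k))) (Poly_Mapping.keys s)"
    using s F X keys_vscale_free_space[of A c s]
    by (subst free_lift_superset[of _ "Poly_Mapping.keys s"])
       (auto simp: carr_free_space subset_iff intro!: vsum_cong)
  also have "\<dots> = vscale X c (free_lift X F s)"
    unfolding free_lift_def using s F X
    by (intro vlinear_vsum_apply[symmetric] vlinear_scale vlinear_ident) (auto simp: carr_free_space)
  finally show "free_lift X F (vscale (free_space A) c s) = vscale X c (free_lift X F s)" .
  assume t: "t \<in> carr (free_space A)"
  let ?B = "Poly_Mapping.keys s \<union> Poly_Mapping.keys t"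
  have B: "finite ?B" "\<And>k. k \<in> ?B \<Longrightarrow> F k \<in> carr X" using s t F by (auto simp: carr_free_space)
  have fl: "free_lift X F u = vsum X (\<lambda>k. vscale X (Poly_Mapping.lookup u k) (F k)) ?B"
    if "Poly_Mapping.keys u \<subseteq> ?B" for u
    by (intro free_lift_superset X that B)
  have "free_lift X F (s + t) = vsum X (\<lambda>k. vplus X (vscale X (Poly_Mapping.lookup s k) (F k))
      (vscale X (Poly_Mapping.lookup t k) (F k))) ?B"
    using B X keys_add[of s t]
    by (subst free_lift_superset[of _ ?B]) (auto simp: lookup_add vscale_add intro!: vsum_cong)
  also have "\<dots> = vplus X (free_lift X F s) (free_lift X F t)"
    unfolding fl[OF Un_upper1] fl[OF Un_upper2] by (intro vsum_add vscale_carr X B(2))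
  finally show "free_lift X F (vplus (free_space A) s t) = vplus X (free_lift X F s) (free_lift X F t)"
    by simp
qed

lemma free_lift_single:
  assumes X: "is_vspace X" and F: "F a \<in> carr X"
  shows "free_lift X F (Poly_Mapping.single a c) = vscale X c (F a)"
proof -
  have "free_lift X F (Poly_Mapping.single a c)
      = vsum X (\<lambda>k. vscale X (Poly_Mapping.lookup (Poly_Mapping.single a c) k) (F k)) {a}"
    using assms by (intro free_lift_superset) auto
  also have "\<dots> = vscale X c (F a)"
    using assms vsum_insert(1)[OF X, of "{}" a] by simp
  finally show ?thesis .
qed

lemma bilinear_rels_carr:
  fixes V :: "('k::field, 'v) vspace" and W :: "('k, 'w) vspace"
  assumes "is_vspace V" "is_vspace W"
  shows "bilinear_rels V W \<subseteq> carr (free_space (carr V \<times> carr W))"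
proof -
  let ?A = "carr V \<times> carr W"
  have "Poly_Mapping.single a c - t \<in> carr (free_space ?A)"
    if "a \<in> ?A" "t \<in> carr (free_space ?A)" for a c and t :: "('v \<times> 'w) \<Rightarrow>\<^sub>0 'k"
    using vminus_carr[OF is_vspace_free_space single_carr, OF that] by simp
  moreover have "s - t \<in> carr (free_space ?A)"
    if "s \<in> carr (free_space ?A)" "t \<in> carr (free_space ?A)" for s t :: "('v \<times> 'w) \<Rightarrow>\<^sub>0 'k"
    using vminus_carr[OF is_vspace_free_space that] by simp
  ultimately show ?thesis
    unfolding bilinear_rels_def using assms by (auto simp: single_carr)
qed

context
  fixes V :: "('k::field, 'v) vspace" and W :: "('k, 'w) vspace"
  assumes V: "is_vspace V" and W: "is_vspace W"
begin

private abbreviation "Fr \<equiv> free_space (carr V \<times> carr W)"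
private abbreviation "Rl \<equiv> vspan Fr (bilinear_rels V W)"

private lemma Rl: "vsubspace Fr Rl"
  by (intro vsubspace_vspan is_vspace_free_space bilinear_rels_carr V W)

lemma is_vspace_tensor: "is_vspace (tensor V W)"
  unfolding tensor_def by (intro is_vspace_quot is_vspace_free_space Rl)

lemma pure_carr: "v \<in> carr V \<Longrightarrow> w \<in> carr W \<Longrightarrow> pure V W v w \<in> carr (tensor V W)"
  unfolding tensor_def pure_def carr_quot by (auto intro: single_carr)

private lemma pure_rel:
  assumes "s - t \<in> bilinear_rels V W" "s \<in> carr Fr" "t \<in> carr Fr"
  shows "coset Fr Rl s = coset Fr Rl t"
  using assms by (simp add: coset_eq_iff[OF is_vspace_free_space Rl] vspan_superset)

text \<open>Each law is one of the four families of \<open>bilinear_rels\<close>. The generators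
  have the form \<open>a - b - c\<close>, the difference of representatives the form
  \<open>a - (b + c)\<close>, hence \<open>diff_diff_eq\<close>.\<close>

lemma vbilinear_pure: "vbilinear V W (tensor V W) (pure V W)"
proof -
  note q = vplus_quot_coset[OF is_vspace_free_space Rl] vscale_quot_coset[OF is_vspace_free_space Rl]
  have p: "vplus (tensor V W) (pure V W v w) (pure V W v' w')
      = coset Fr Rl (Poly_Mapping.single (v, w) 1 + Poly_Mapping.single (v', w') 1)"
    and s: "vscale (tensor V W) c (pure V W v w) = coset Fr Rl (Poly_Mapping.single (v, w) c)"
    if "v \<in> carr V" "v' \<in> carr V" "w \<in> carr W" "w' \<in> carr W" for v v' w w' c
    using that by (simp_all add: pure_def tensor_def q single_carr vscale_single)
  have add: "Poly_Mapping.single a 1 + Poly_Mapping.single b 1 \<in> carr Fr"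
    if "a \<in> carr V \<times> carr W" "b \<in> carr V \<times> carr W" for a b
    using vplus_carr[OF is_vspace_free_space single_carr single_carr, OF that] by simp
  show ?thesis
  proof (intro vbilinearI vlinearI)
    fix v w w' c assume v: "v \<in> carr V" and w: "w \<in> carr W"
    show "pure V W v w \<in> carr (tensor V W)" using v w by (rule pure_carr)
    show "pure V W v (vscale W c w) = vscale (tensor V W) c (pure V W v w)"
      unfolding s[OF v v w w] unfolding pure_def using v w W
      by (intro pure_rel) (force simp: bilinear_rels_def intro: single_carr)+
    assume w': "w' \<in> carr W"
    show "pure V W v (vplus W w w') = vplus (tensor V W) (pure V W v w) (pure V W v w')"
      unfolding p[OF v v w w'] unfolding pure_def diff_diff_eq[symmetric] using v w w' W
      by (intro pure_rel)
         (force simp: bilinear_rels_def diff_diff_eq[symmetric] intro: single_carr add)+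
  next
    fix v v' w c assume v: "v \<in> carr V" and w: "w \<in> carr W"
    show "pure V W v w \<in> carr (tensor V W)" using v w by (rule pure_carr)
    show "pure V W (vscale V c v) w = vscale (tensor V W) c (pure V W v w)"
      unfolding s[OF v v w w] unfolding pure_def using v w V
      by (intro pure_rel) (force simp: bilinear_rels_def intro: single_carr)+
    assume v': "v' \<in> carr V"
    show "pure V W (vplus V v v') w = vplus (tensor V W) (pure V W v w) (pure V W v' w)"
      unfolding p[OF v v' w w] unfolding pure_def diff_diff_eq[symmetric] using v w v' V
      by (intro pure_rel)
         (force simp: bilinear_rels_def diff_diff_eq[symmetric] intro: single_carr add)+
  qed
qed

text \<open>The preimage of \<open>U\<close> in the free space is a subspace that contains all
  generators.\<close>

lemma tensor_induct:
  assumes U: "vsubspace (tensor V W) U"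
    and p: "\<And>v w. v \<in> carr V \<Longrightarrow> w \<in> carr W \<Longrightarrow> pure V W v w \<in> U"
    and t: "t \<in> carr (tensor V W)"
  shows "t \<in> U"
proof -
  obtain s where s: "s \<in> carr Fr" "t = coset Fr Rl s"
    using t by (auto simp: tensor_def carr_quot)
  have lin: "vlinear Fr (tensor V W) (coset Fr Rl)"
    unfolding tensor_def by (intro vlinear_coset is_vspace_free_space Rl)
  have "s \<in> {s \<in> carr Fr. coset Fr Rl s \<in> U}"
  proof (rule free_space_induct[OF _ _ s(1)])
    show "vsubspace Fr {s \<in> carr Fr. coset Fr Rl s \<in> U}"
      using U vlinear_vzero[OF is_vspace_free_space is_vspace_tensor lin]
        vzero_carr[OF is_vspace_free_space, of "carr V \<times> carr W"]
        vplus_carr[OF is_vspace_free_space, of _ "carr V \<times> carr W"]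
        vscale_carr[OF is_vspace_free_space, of _ "carr V \<times> carr W"]
        vlinear_vplus[OF lin] vlinear_vscale[OF lin]
      by (auto simp: vsubspace_def)
    show "Poly_Mapping.single a 1 \<in> {s \<in> carr Fr. coset Fr Rl s \<in> U}" if "a \<in> carr V \<times> carr W" for a
      using p[of "fst a" "snd a"] that by (auto simp: single_carr pure_def)
  qed
  with s show ?thesis by simp
qed

lemma tensor_ext:
  assumes X: "is_vspace X" and f: "vlinear (tensor V W) X f" and g: "vlinear (tensor V W) X g"
    and eq: "\<And>v w. v \<in> carr V \<Longrightarrow> w \<in> carr W \<Longrightarrow> f (pure V W v w) = g (pure V W v w)"
    and t: "t \<in> carr (tensor V W)"
  shows "f t = g t"
  using tensor_induct[OF vsubspace_equalizer[OF is_vspace_tensor X f g] _ t] by (simp add: pure_carr eq)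

text \<open>The linear extension to the free space kills the four families of relations, hence their
  span, and descends to the quotient.\<close>

lemma tlift_exists:
  assumes X: "is_vspace X" and F: "vbilinear V W X F"
  shows "\<exists>f. f \<in> extensional (carr (tensor V W)) \<and> vlinear (tensor V W) X f \<and>
       (\<forall>v\<in>carr V. \<forall>w\<in>carr W. f (pure V W v w) = F v w)"
proof -
  define f0 where "f0 = free_lift X (\<lambda>(v, w). F v w)"
  have lin: "vlinear Fr X f0"
    unfolding f0_def using F by (intro vlinear_free_lift X) (auto intro: vbilinear_carr)
  have sg: "f0 (Poly_Mapping.single (v, w) c) = vscale X c (F v w)" if "v \<in> carr V" "w \<in> carr W" for v w c
    unfolding f0_def using that F by (subst free_lift_single) (auto intro: vbilinear_carr X)
  have diff: "f0 (s - t) = vminus X (f0 s) (f0 t)" if "s \<in> carr Fr" "t \<in> carr Fr" for s t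
    using vlinear_vminus[OF is_vspace_free_space lin that] by simp
  have diffc: "s - t \<in> carr Fr" if "s \<in> carr Fr" "t \<in> carr Fr" for s t
    using vminus_carr[OF is_vspace_free_space that] by simp
  have sub: "vminus X (vminus X (vplus X x y) x) y = vzero X" if "x \<in> carr X" "y \<in> carr X" for x y
    using that X by (simp add: vplus_vminus)
  have "f0 r = vzero X" if "r \<in> bilinear_rels V W" for r
    using that unfolding bilinear_rels_def
  proof (elim UnE CollectE exE conjE)
    fix v v' w assume c: "v \<in> carr V" "v' \<in> carr V" "w \<in> carr W"
      and r: "r = Poly_Mapping.single (vplus V v v', w) 1 - Poly_Mapping.single (v, w) 1
        - Poly_Mapping.single (v', w) 1"
    show ?thesis unfolding r using c X V W
      by (simp add: diff diffc single_carr sg vbilinear_carr[OF F] vlinear_vplus[OF vbilinear_left[OF F]] sub)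
  next
    fix v w w' assume c: "v \<in> carr V" "w \<in> carr W" "w' \<in> carr W"
      and r: "r = Poly_Mapping.single (v, vplus W w w') 1 - Poly_Mapping.single (v, w) 1
        - Poly_Mapping.single (v, w') 1"
    show ?thesis unfolding r using c X V W
      by (simp add: diff diffc single_carr sg vbilinear_carr[OF F] vlinear_vplus[OF vbilinear_right[OF F]] sub)
  next
    fix c v w assume c: "v \<in> carr V" "w \<in> carr W"
      and r: "r = Poly_Mapping.single (vscale V c v, w) 1 - Poly_Mapping.single (v, w) c"
    show ?thesis unfolding r using c X V W
      by (simp add: diff single_carr sg vbilinear_carr[OF F] vlinear_vscale[OF vbilinear_left[OF F]])
  next
    fix c v w assume c: "v \<in> carr V" "w \<in> carr W"
      and r: "r = Poly_Mapping.single (v, vscale W c w) 1 - Poly_Mapping.single (v, w) c"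
    show ?thesis unfolding r using c X V W
      by (simp add: diff single_carr sg vbilinear_carr[OF F] vlinear_vscale[OF vbilinear_right[OF F]])
  qed
  then have z: "f0 r = vzero X" if "r \<in> Rl" for r
    using vlinear_zero_on_vspan[OF is_vspace_free_space X lin bilinear_rels_carr[OF V W] _ that] by auto
  define f where "f = restrict (\<lambda>A. the_elem (f0 ` A)) (carr (tensor V W))"
  have "vlinear (tensor V W) X f"
    unfolding f_def vlinear_restrict[OF is_vspace_tensor]
    unfolding tensor_def by (intro vlinear_quot_map is_vspace_free_space Rl X lin z)
  moreover have "f (pure V W v w) = F v w" if "v \<in> carr V" "w \<in> carr W" for v w
  proof -
    have "the_elem (f0 ` pure V W v w) = f0 (Poly_Mapping.single (v, w) 1)"
      unfolding pure_def using that
      by (intro the_elem_coset[OF is_vspace_free_space Rl X lin z]) (auto intro: single_carr)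
    then show ?thesis using that X vbilinear_carr[OF F] by (simp add: f_def pure_carr sg)
  qed
  ultimately show ?thesis by (intro exI[of _ f]) (auto simp: f_def)
qed

text \<open>\<open>tlift\<close> is a definite description, so uniqueness is needed as an equation
  of functions; extensionality fixes the values off the carrier.\<close>

lemma extensional_tensor_ext:
  assumes X: "is_vspace X" and f: "f \<in> extensional (carr (tensor V W))" "vlinear (tensor V W) X f"
    and g: "g \<in> extensional (carr (tensor V W))" "vlinear (tensor V W) X g"
    and eq: "\<forall>v\<in>carr V. \<forall>w\<in>carr W. f (pure V W v w) = g (pure V W v w)"
  shows "f = g"
proof (rule extensionalityI[OF f(1) g(1)])
  show "f t = g t" if "t \<in> carr (tensor V W)" for t
    by (rule tensor_ext[OF X f(2) g(2) _ that]) (use eq in simp)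
qed

lemma tlift_props:
  assumes X: "is_vspace X" and F: "vbilinear V W X F"
  shows "tlift V W X F \<in> extensional (carr (tensor V W)) \<and> vlinear (tensor V W) X (tlift V W X F) \<and>
       (\<forall>v\<in>carr V. \<forall>w\<in>carr W. tlift V W X F (pure V W v w) = F v w)"
proof -
  obtain f where f: "f \<in> extensional (carr (tensor V W)) \<and> vlinear (tensor V W) X f \<and>
       (\<forall>v\<in>carr V. \<forall>w\<in>carr W. f (pure V W v w) = F v w)"
    using tlift_exists[OF assms] by blast
  have "tlift V W X F = f"
    unfolding tlift_def by (rule the_equality, rule f) (rule extensional_tensor_ext[OF X]; simp add: f)
  with f show ?thesis by simp
qed

lemma vlinear_tlift: "is_vspace X \<Longrightarrow> vbilinear V W X F \<Longrightarrow> vlinear (tensor V W) X (tlift V W X F)"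
  and tlift_pure: "is_vspace X \<Longrightarrow> vbilinear V W X F \<Longrightarrow> v \<in> carr V \<Longrightarrow> w \<in> carr W \<Longrightarrow>
    tlift V W X F (pure V W v w) = F v w"
  using tlift_props by blast+

lemma tlift_compose:
  assumes X: "is_vspace X" and Y: "is_vspace Y" and F: "vbilinear V W X F" and f: "vlinear X Y f"
    and t: "t \<in> carr (tensor V W)"
  shows "f (tlift V W X F t) = tlift V W Y (\<lambda>v w. f (F v w)) t"
proof (rule tensor_ext[OF Y _ _ _ t])
  show "vlinear (tensor V W) Y (\<lambda>t. f (tlift V W X F t))"
    by (rule vlinear_compose[OF f vlinear_tlift[OF X F]])
  show "vlinear (tensor V W) Y (tlift V W Y (\<lambda>v w. f (F v w)))"
    by (rule vlinear_tlift[OF Y vbilinear_compose[OF f F]])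
qed (simp add: tlift_pure[OF X F] tlift_pure[OF Y vbilinear_compose[OF f F]])

lemma tlift_eqI:
  assumes X: "is_vspace X" and F: "vbilinear V W X F" and f: "vlinear (tensor V W) X f"
    and eq: "\<And>v w. v \<in> carr V \<Longrightarrow> w \<in> carr W \<Longrightarrow> f (pure V W v w) = F v w"
    and t: "t \<in> carr (tensor V W)"
  shows "tlift V W X F t = f t"
  by (rule tensor_ext[OF X vlinear_tlift[OF X F] f _ t]) (simp add: tlift_pure[OF X F] eq)

end

lemma tlift_cong:
  assumes "\<And>v w. v \<in> carr V \<Longrightarrow> w \<in> carr W \<Longrightarrow> F v w = G v w"
  shows "tlift V W X F = tlift V W X G"
  unfolding tlift_def using assms by (intro arg_cong[where f=The] ext) auto

lemma vlinear_pure_left: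
  assumes "is_vspace V" "is_vspace W" "vlinear U V g" "w \<in> carr W"
  shows "vlinear U (tensor V W) (\<lambda>u. pure V W (g u) w)"
  by (rule vlinear_compose[OF vbilinear_left[OF vbilinear_pure] assms(3)]) (use assms in auto)

lemma vlinear_pure_right:
  assumes "is_vspace V" "is_vspace W" "vlinear U W g" "v \<in> carr V"
  shows "vlinear U (tensor V W) (\<lambda>u. pure V W v (g u))"
  by (rule vlinear_compose[OF vbilinear_right[OF vbilinear_pure] assms(3)]) (use assms in auto)

text \<open>Both sides of each linearity law are linear in \<open>t\<close> and agree on pure
  tensors. This makes a Sweedler sum linear in the parameters of its summand, which nested sums
  require.\<close>

lemma vlinear_tlift_param:
  assumes V: "is_vspace V" and W: "is_vspace W" and X: "is_vspace X" and U: "is_vspace U"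
    and 1: "\<And>u. u \<in> carr U \<Longrightarrow> vbilinear V W X (F u)"
    and 2: "\<And>v w. v \<in> carr V \<Longrightarrow> w \<in> carr W \<Longrightarrow> vlinear U X (\<lambda>u. F u v w)"
    and t: "t \<in> carr (tensor V W)"
  shows "vlinear U X (\<lambda>u. tlift V W X (F u) t)"
proof (rule vlinearI)
  note L = vlinear_tlift[OF V W X 1]
  note P = tlift_pure[OF V W X 1]
  fix u u' c assume u: "u \<in> carr U"
  show "tlift V W X (F u) t \<in> carr X" by (rule vlinear_carr[OF L[OF u] t])
  show "tlift V W X (F (vscale U c u)) t = vscale X c (tlift V W X (F u) t)"
    by (rule tensor_ext[OF V W X L vlinear_scale[OF X L] _ t])
       (simp_all add: u U P vlinear_vscale[OF 2])
  assume u': "u' \<in> carr U"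
  show "tlift V W X (F (vplus U u u')) t = vplus X (tlift V W X (F u) t) (tlift V W X (F u') t)"
    by (rule tensor_ext[OF V W X L vlinear_add[OF X L L] _ t])
       (simp_all add: u u' U P vlinear_vplus[OF 2])
qed

section \<open>Linear isomorphisms and their inverses\<close>

lemma visoI:
  assumes f: "vlinear V X f" and g: "vlinear X V g"
    and "\<And>v. v \<in> carr V \<Longrightarrow> g (f v) = v" "\<And>x. x \<in> carr X \<Longrightarrow> f (g x) = x"
  shows "viso V X f"
  unfolding viso_def
  using assms vlinear_carr[OF f] vlinear_carr[OF g] by (auto intro: bij_betw_byWitness[where f' = g])

lemma viso_inv_left: "viso V X f \<Longrightarrow> v \<in> carr V \<Longrightarrow> inv_into (carr V) f (f v) = v"
  by (auto simp: viso_def intro: bij_betw_inv_into_left)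

lemma viso_inv_right: "viso V X f \<Longrightarrow> x \<in> carr X \<Longrightarrow> f (inv_into (carr V) f x) = x"
  by (auto simp: viso_def intro: bij_betw_inv_into_right)

lemma vlinear_viso: "viso V X f \<Longrightarrow> vlinear V X f"
  by (simp add: viso_def)

lemma vlinear_viso_inv:
  assumes V: "is_vspace V" and f: "viso V X f"
  shows "vlinear X V (inv_into (carr V) f)"
proof -
  note lf = vlinear_viso[OF f] and R = viso_inv_right[OF f] and L = viso_inv_left[OF f]
  have c: "inv_into (carr V) f x \<in> carr V" if "x \<in> carr X" for x
    using f that by (auto simp: viso_def bij_betw_def intro: inv_into_into)
  show ?thesis
  proof (rule vlinearI)
    fix x y k assume x: "x \<in> carr X"
    show "inv_into (carr V) f x \<in> carr V" by (rule c[OF x])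
    show "inv_into (carr V) f (vscale X k x) = vscale V k (inv_into (carr V) f x)"
      using L[of "vscale V k (inv_into (carr V) f x)"] V x by (simp add: vlinear_vscale[OF lf] c R)
    assume y: "y \<in> carr X"
    show "inv_into (carr V) f (vplus X x y) = vplus V (inv_into (carr V) f x) (inv_into (carr V) f y)"
      using L[of "vplus V (inv_into (carr V) f x) (inv_into (carr V) f y)"] V x y
      by (simp add: vlinear_vplus[OF lf] c R)
  qed
qed

lemma vsum_reindex:
  assumes V: "is_vspace V" and I: "finite I" and g: "inj_on g I" and f: "\<And>i. i \<in> I \<Longrightarrow> f (g i) \<in> carr V"
  shows "vsum V f (g ` I) = vsum V (\<lambda>i. f (g i)) I"
  using I g f
proof (induction I rule: finite_induct)
  case (insert i I)
  have "vsum V f (insert (g i) (g ` I)) = vplus V (f (g i)) (vsum V f (g ` I))"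
    using insert by (intro vsum_insert V) auto
  moreover have "vsum V (\<lambda>i. f (g i)) (insert i I) = vplus V (f (g i)) (vsum V (\<lambda>i. f (g i)) I)"
    using insert by (intro vsum_insert[where f = "\<lambda>i. f (g i)"] V) auto
  ultimately show ?case using insert by simp
qed simp

section \<open>Sweedler calculus\<close>

text \<open>Every Sweedler manipulation has linearity in each variable as a side condition. The
  rules collected here are mostly stated for composites \<open>\<lambda>u. F (g u)\<close>, so that
  repeated introduction descends to the variable itself.\<close>

named_theorems multilinear

lemmas [multilinear] = vlinear_ident vlinear_pure_left vlinear_pure_right vlinear_scale

lemma vlinear_scale_comp [multilinear]:
  assumes "is_vspace X" "x \<in> carr X" "vlinear U ground g"
  shows "vlinear U X (\<lambda>u. vscale X (g u) x)"
  using vlinear_scale_left[OF assms(1,2) vlinear_ident] assms(3) by (rule vlinear_compose)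

lemma vlinear_times_left [multilinear]: "vlinear U ground g \<Longrightarrow> vlinear U ground (\<lambda>u. g u * c)"
  and vlinear_times_right [multilinear]: "vlinear U ground g \<Longrightarrow> vlinear U ground (\<lambda>u. c * g u)"
  by (simp_all add: vlinear_def algebra_simps)

locale hopf =
  fixes C :: "('k::field, 'h::ring_1, 'z) hopf_data_scheme"
  assumes hopf: "hopf_algebra C"
begin

abbreviation "H \<equiv> Hsp C"
abbreviation "S \<equiv> antip C"
abbreviation "\<epsilon> \<equiv> counit C"
abbreviation "sw \<equiv> sweedler2 C"
abbreviation "bil \<equiv> vbilinear H H"

lemma vector_space_H: "vector_space (hscale C)"
  using hopf by (simp add: hopf_algebra_def)

lemma is_vspace_H [simp]: "is_vspace H"
  unfolding Hsp_def by (rule is_vspace_space_of[OF vector_space_H])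

lemma is_vspace_HH [simp]: "is_vspace (HH C)"
  by (rule is_vspace_tensor) simp_all

lemma H_simps [simp]: "carr H = UNIV" "vplus H = (+)" "vzero H = 0" "vscale H = hscale C"
  by (simp_all add: Hsp_def)

lemma hscale_simps [simp]: "hscale C 1 a = a" "hscale C 0 a = 0" "hscale C c 0 = 0"
    "hscale C c (hscale C d a) = hscale C (c * d) a" "hscale C (- 1) a = - a"
proof -
  interpret vector_space "hscale C" by (rule vector_space_H)
  show "hscale C 1 a = a" "hscale C 0 a = 0" "hscale C c 0 = 0"
    "hscale C c (hscale C d a) = hscale C (c * d) a" "hscale C (- 1) a = - a" by simp_all
qed

lemma vminus_H [simp]: "vminus H a b = a - b"
  by (simp add: vminus_def)

lemma hscale_mult_left [simp]: "hscale C c a * b = hscale C c (a * b)"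
  and hscale_mult_right [simp]: "a * hscale C c b = hscale C c (a * b)"
  using hopf by (auto simp: hopf_algebra_def)

lemma lin_comult: "vlinear H (HH C) (comult C)"
  and lin_counit: "vlinear H ground \<epsilon>" and lin_antip: "vlinear H H S"
  using hopf by (auto simp: hopf_algebra_def)

lemma comult_carr [simp]: "comult C h \<in> carr (HH C)"
  by (rule vlinear_carr[OF lin_comult]) simp

lemma hpure_carr [simp]: "hpure C a b \<in> carr (HH C)"
  by (rule pure_carr) simp_all

lemma counit_1 [simp]: "\<epsilon> 1 = 1" and counit_mult [simp]: "\<epsilon> (g * h) = \<epsilon> g * \<epsilon> h"
  using hopf by (auto simp: hopf_algebra_def)

lemma counit_add [simp]: "\<epsilon> (a + b) = \<epsilon> a + \<epsilon> b" and counit_hscale [simp]: "\<epsilon> (hscale C c a) = c * \<epsilon> a"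
  using vlinear_vplus[OF lin_counit, of a b] vlinear_vscale[OF lin_counit, of a c] by simp_all

lemma counit_diff [simp]: "\<epsilon> (a - b) = \<epsilon> a - \<epsilon> b"
  using vlinear_vminus[OF _ lin_counit, of a b] by simp

lemma lin_mult_left [multilinear]: "vlinear U H g \<Longrightarrow> vlinear U H (\<lambda>u. g u * b)"
  and lin_mult_right [multilinear]: "vlinear U H g \<Longrightarrow> vlinear U H (\<lambda>u. b * g u)"
  by (simp_all add: vlinear_def algebra_simps)

lemma lin_hscale_left [multilinear]: "vlinear U ground g \<Longrightarrow> vlinear U H (\<lambda>u. hscale C (g u) b)"
  and lin_hscale_right [multilinear]: "vlinear U H g' \<Longrightarrow> vlinear U H (\<lambda>u. hscale C c (g' u))"
  using vlinear_scale_comp[of H b U g] vlinear_scale[of H U g' c] by simp_all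

lemmas lin_compose [multilinear] = vlinear_compose[OF lin_counit] vlinear_compose[OF lin_antip]
  vlinear_compose[OF lin_comult]

lemma bilI [multilinear]:
  assumes "\<And>b. vlinear H X (\<lambda>a. F a b)" "\<And>a. vlinear H X (\<lambda>b. F a b)"
  shows "bil X F"
  using assms by (simp add: vbilinear_def)

lemma bilD1: "bil X F \<Longrightarrow> vlinear U H g \<Longrightarrow> vlinear U X (\<lambda>u. F (g u) b)"
  and bilD2: "bil X F \<Longrightarrow> vlinear U H g \<Longrightarrow> vlinear U X (\<lambda>u. F a (g u))"
  by (auto intro: vlinear_compose[OF vbilinear_left] vlinear_compose[OF vbilinear_right])

lemma bil_carr: "bil X F \<Longrightarrow> F a b \<in> carr X"
  by (simp add: vbilinear_carr)

definition tril :: "('k, 'x) vspace \<Rightarrow> ('h \<Rightarrow> 'h \<Rightarrow> 'h \<Rightarrow> 'x) \<Rightarrow> bool"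
  where "tril X F \<longleftrightarrow> (\<forall>c. bil X (\<lambda>a b. F a b c)) \<and> (\<forall>a b. vlinear H X (\<lambda>c. F a b c))"

lemma trilI [multilinear]:
  assumes "\<And>b c. vlinear H X (\<lambda>a. F a b c)" "\<And>a c. vlinear H X (\<lambda>b. F a b c)"
    "\<And>a b. vlinear H X (\<lambda>c. F a b c)"
  shows "tril X F"
  using assms by (simp add: tril_def vbilinear_def)

lemma trilD: assumes "tril X F" "vlinear U H g"
  shows trilD1: "vlinear U X (\<lambda>u. F (g u) b c)" and trilD2: "vlinear U X (\<lambda>u. F a (g u) c)"
    and trilD3: "vlinear U X (\<lambda>u. F a b (g u))"
  using assms unfolding tril_def vbilinear_def
  by (auto intro: vlinear_compose[of H X "\<lambda>a. F a b c"] vlinear_compose[of H X "\<lambda>b. F a b c"]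
      vlinear_compose[of H X "\<lambda>c. F a b c"])

lemma lin_sw: "is_vspace X \<Longrightarrow> bil X F \<Longrightarrow> vlinear H X (sw X F)"
  unfolding sweedler2_def by (intro vlinear_compose[OF vlinear_tlift lin_comult]) simp_all

lemma sw_carr [simp]: "is_vspace X \<Longrightarrow> bil X F \<Longrightarrow> sw X F h \<in> carr X"
  by (rule vlinear_carr[OF lin_sw]) simp_all

lemma lin_sw_arg [multilinear]: "is_vspace X \<Longrightarrow> bil X F \<Longrightarrow> vlinear U H g \<Longrightarrow> vlinear U X (\<lambda>u. sw X F (g u))"
  by (rule vlinear_compose[OF lin_sw])

lemma lin_sw_param_gen:
  assumes "is_vspace X" "is_vspace U" "\<And>u. u \<in> carr U \<Longrightarrow> bil X (F u)" "\<And>a b. vlinear U X (\<lambda>u. F u a b)"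
  shows "vlinear U X (\<lambda>u. sw X (F u) h)"
  unfolding sweedler2_def using assms by (intro vlinear_tlift_param) simp_all

lemma lin_sw_param [multilinear]:
  assumes "is_vspace X" "is_vspace U" "\<And>u b. u \<in> carr U \<Longrightarrow> vlinear H X (\<lambda>a. F u a b)"
    "\<And>u a. u \<in> carr U \<Longrightarrow> vlinear H X (\<lambda>b. F u a b)" "\<And>a b. vlinear U X (\<lambda>u. F u a b)"
  shows "vlinear U X (\<lambda>u. sw X (F u) h)"
  using assms by (intro lin_sw_param_gen bilI) simp_all

lemma sw_cong: "(\<And>a b. F a b = G a b) \<Longrightarrow> sw X F h = sw X G h"
  by presburger

lemma sw_map:
  assumes "is_vspace X" "is_vspace Y" "vlinear X Y f" "bil X F"
  shows "f (sw X F h) = sw Y (\<lambda>a b. f (F a b)) h"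
  unfolding sweedler2_def using assms by (intro tlift_compose) simp_all

text \<open>A Fubini rule for two independent coproducts: with a variable tensor \<open>t\<close> in
  place of \<open>comult C h\<close>, both sides are linear in \<open>t\<close> and agree on pure
  tensors.\<close>

lemma sw_swap:
  assumes X: "is_vspace X" and 1: "\<And>c d. bil X (\<lambda>a b. F a b c d)" and 2: "\<And>a b. bil X (F a b)"
  shows "sw X (\<lambda>a b. sw X (\<lambda>c d. F a b c d) h) g = sw X (\<lambda>c d. sw X (\<lambda>a b. F a b c d) g) h"
proof -
  have lin: "vlinear H X (\<lambda>a. F a b c d)" "vlinear H X (\<lambda>b. F a b c d)"
    "vlinear H X (\<lambda>c. F a b c d)" "vlinear H X (\<lambda>d. F a b c d)" for a b c d
    using bilD1[OF 1 vlinear_ident] bilD2[OF 1 vlinear_ident]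
      bilD1[OF 2 vlinear_ident] bilD2[OF 2 vlinear_ident] .
  have "tlift H H X (\<lambda>c d. sw X (\<lambda>a b. F a b c d) g) t = sw X (\<lambda>a b. tlift H H X (F a b) t) g"
    if t: "t \<in> carr (HH C)" for t
  proof (rule tlift_eqI[OF _ _ X _ _ _ t])
    show "bil X (\<lambda>c d. sw X (\<lambda>a b. F a b c d) g)"
      by (intro bilI lin_sw_param; simp add: X lin)
    show "vlinear (HH C) X (\<lambda>t. sw X (\<lambda>a b. tlift H H X (F a b) t) g)"
    proof (rule lin_sw_param_gen[OF X])
      show "bil X (\<lambda>a b. tlift H H X (F a b) u)" if "u \<in> carr (HH C)" for u
        by (intro bilI vlinear_tlift_param[OF _ _ X _ _ _ that])
           (simp_all add: X 2 lin)
      show "vlinear (HH C) X (\<lambda>u. tlift H H X (F a b) u)" for a b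
        by (rule vlinear_tlift[OF _ _ X 2]) simp_all
    qed simp
    show "sw X (\<lambda>a b. tlift H H X (F a b) (hpure C c d)) g = sw X (\<lambda>a b. F a b c d) g" for c d
      by (rule sw_cong) (simp add: tlift_pure X 2)
  qed simp_all
  from this[OF comult_carr] show ?thesis by (simp add: sweedler2_def)
qed

lemma sw_one: "is_vspace X \<Longrightarrow> bil X F \<Longrightarrow> sw X F 1 = F 1 1"
proof -
  have "comult C 1 = hpure C 1 1" using hopf by (auto simp: hopf_algebra_def)
  then show "is_vspace X \<Longrightarrow> bil X F \<Longrightarrow> sw X F 1 = F 1 1"
    by (simp add: sweedler2_def tlift_pure)
qed

lemma lin_tlift_HH [multilinear]:
  assumes "is_vspace X" "bil X F" "vlinear U (HH C) g"
  shows "vlinear U X (\<lambda>u. tlift H H X F (g u))"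
  by (rule vlinear_compose[OF vlinear_tlift assms(3)]) (simp_all add: assms)

lemma sw_hpure_comult: "sw (HH C) (\<lambda>a b. hpure C a b) h = comult C h"
proof -
  have "tlift H H (HH C) (\<lambda>a b. hpure C a b) (comult C h) = comult C h"
    by (rule tlift_eqI[where f = "\<lambda>t. t"]) (simp_all add: vlinear_ident vbilinear_pure)
  then show ?thesis by (simp add: sweedler2_def)
qed

lemma sw_mult:
  assumes X: "is_vspace X" and F: "bil X F"
  shows "sw X F (g * h) = sw X (\<lambda>a b. sw X (\<lambda>c d. F (a * c) (b * d)) h) g"
proof -
  have "comult C (g * h)
      = sw (HH C) (\<lambda>g1 g2. sw (HH C) (\<lambda>h1 h2. hpure C (g1 * h1) (g2 * h2)) h) g"
    using hopf by (auto simp: hopf_algebra_def)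
  then have "sw X F (g * h) = tlift H H X F
      (sw (HH C) (\<lambda>g1 g2. sw (HH C) (\<lambda>h1 h2. hpure C (g1 * h1) (g2 * h2)) h) g)"
    by (simp add: sweedler2_def)
  also have "\<dots> = sw X (\<lambda>g1 g2. tlift H H X F (sw (HH C) (\<lambda>h1 h2. hpure C (g1 * h1) (g2 * h2)) h)) g"
    by (rule sw_map[where f = "tlift H H X F"]; (intro multilinear bilD1[OF F] bilD2[OF F])?; simp add: X F vlinear_tlift)
  also have "\<dots> = sw X (\<lambda>g1 g2. sw X (\<lambda>h1 h2. tlift H H X F (hpure C (g1 * h1) (g2 * h2))) h) g"
    by (rule sw_cong, rule sw_map[where f = "tlift H H X F"]; (intro multilinear bilD1[OF F] bilD2[OF F])?; simp add: X F vlinear_tlift)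
  finally show ?thesis by (simp add: tlift_pure X F)
qed

text \<open>\<open>hopf_algebra\<close> states coassociativity for the universal trilinear map into
  \<open>H \<otimes> (H \<otimes> H)\<close> only. A general \<open>F\<close> factors through that
  map by the linear map \<open>G\<close>.\<close>

lemma sw_assoc:
  assumes X: "is_vspace X" and F: "tril X F"
  shows "sw X (\<lambda>x c. sw X (\<lambda>a b. F a b c) x) h = sw X (\<lambda>a x. sw X (\<lambda>b c. F a b c) x) h"
proof -
  let ?Y = "tensor H (HH C)"
  have Y: "is_vspace ?Y" by (rule is_vspace_tensor) simp_all
  note lin = multilinear trilD[OF F]
  have F2: "bil X (F a)" for a by (intro lin)
  define G where "G = tlift H (HH C) X (\<lambda>a. tlift H H X (F a))"
  have bG: "vbilinear H (HH C) X (\<lambda>a. tlift H H X (F a))"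
    by (intro vbilinearI vlinear_tlift vlinear_tlift_param X F2) (simp_all, (intro lin)+)
  have lG: "vlinear ?Y X G" unfolding G_def by (rule vlinear_tlift[OF _ _ X bG]) simp_all
  have Gp: "G (pure H (HH C) a t) = tlift H H X (F a) t" if "t \<in> carr (HH C)" for a t
    unfolding G_def using that by (intro tlift_pure X bG) simp_all
  have p3: "bil ?Y (\<lambda>a b. pure H (HH C) a (hpure C b c))" for c
    by (intro multilinear; simp)
  have eq: "sw ?Y (\<lambda>x c. sw ?Y (\<lambda>a b. pure H (HH C) a (hpure C b c)) x) h
      = sw ?Y (\<lambda>a b. pure H (HH C) a (comult C b)) h"
    using hopf by (auto simp: hopf_algebra_def sweedler3_def)
  have "sw X (\<lambda>x c. sw X (\<lambda>a b. F a b c) x) h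
      = sw X (\<lambda>x c. sw X (\<lambda>a b. G (pure H (HH C) a (hpure C b c))) x) h"
    by (simp add: Gp tlift_pure X F2)
  also have "\<dots> = sw X (\<lambda>x c. G (sw ?Y (\<lambda>a b. pure H (HH C) a (hpure C b c)) x)) h"
    by (rule sw_cong, rule sw_map[symmetric]) (intro X Y lG p3)+
  also have "\<dots> = G (sw ?Y (\<lambda>x c. sw ?Y (\<lambda>a b. pure H (HH C) a (hpure C b c)) x) h)"
    by (rule sw_map[symmetric]; (intro multilinear X Y lG)?; simp add: Y)
  also have "\<dots> = sw X (\<lambda>a b. G (pure H (HH C) a (comult C b))) h"
    unfolding eq by (rule sw_map; (intro multilinear X Y lG)?; simp add: Y)
  finally show ?thesis by (simp add: Gp sweedler2_def)
qed

section \<open>Contractions with the counit and the antipode\<close>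

lemma sw_counit_left:
  assumes X: "is_vspace X" and f: "vlinear H X f"
  shows "sw X (\<lambda>a b. vscale X (\<epsilon> a) (f b)) h = f h"
proof -
  have "sw H (\<lambda>a b. hscale C (\<epsilon> a) b) h = h" using hopf by (auto simp: hopf_algebra_def)
  then have "f h = f (sw H (\<lambda>a b. hscale C (\<epsilon> a) b) h)" by simp
  also have "\<dots> = sw X (\<lambda>a b. f (hscale C (\<epsilon> a) b)) h"
    by (rule sw_map[OF _ X f]; (intro multilinear)?; simp)
  finally show ?thesis using vlinear_vscale[OF f] by simp
qed

lemma sw_counit_right:
  assumes X: "is_vspace X" and f: "vlinear H X f"
  shows "sw X (\<lambda>a b. vscale X (\<epsilon> b) (f a)) h = f h"
proof -
  have "sw H (\<lambda>a b. hscale C (\<epsilon> b) a) h = h" using hopf by (auto simp: hopf_algebra_def)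
  then have "f h = f (sw H (\<lambda>a b. hscale C (\<epsilon> b) a) h)" by simp
  also have "\<dots> = sw X (\<lambda>a b. f (hscale C (\<epsilon> b) a)) h"
    by (rule sw_map[OF _ X f]; (intro multilinear)?; simp)
  finally show ?thesis using vlinear_vscale[OF f] by simp
qed

text \<open>One predicate covers the contractions \<open>S a * b\<close> and \<open>a * S b\<close>
  as well as, for the inverse antipode, \<open>Si b * a\<close> and \<open>b * Si a\<close>, so that
  the rules below serve all four.\<close>

definition cancels :: "('h \<Rightarrow> 'h \<Rightarrow> 'h) \<Rightarrow> bool"
  where "cancels K \<longleftrightarrow> bil H K \<and> (\<forall>h. sw H K h = hscale C (\<epsilon> h) 1)"

lemma cancels_antip_left: "cancels (\<lambda>a b. S a * b)"
  and cancels_antip_right: "cancels (\<lambda>a b. a * S b)"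
  using hopf by (auto simp: cancels_def hopf_algebra_def intro!: multilinear)

lemma sw_cancel:
  assumes K: "cancels K" and X: "is_vspace X" and f: "vlinear H X f"
  shows "sw X (\<lambda>a b. f (K a b)) h = vscale X (\<epsilon> h) (f 1)"
  using sw_map[OF _ X f, of K h] K vlinear_vscale[OF f, of 1] by (simp add: cancels_def)

lemma cancels_lin: "cancels K \<Longrightarrow> vlinear U H g \<Longrightarrow> vlinear U H (\<lambda>u. K (g u) b)"
  "cancels K \<Longrightarrow> vlinear U H g \<Longrightarrow> vlinear U H (\<lambda>u. K a (g u))"
  by (auto simp: cancels_def intro: bilD1 bilD2)

lemma sw_cancel_right:
  assumes K: "cancels K" and X: "is_vspace X" and F: "bil X F"
  shows "sw X (\<lambda>a x. sw X (\<lambda>b c. F a (K b c)) x) h = F h 1"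
proof -
  have "sw X (\<lambda>a x. sw X (\<lambda>b c. F a (K b c)) x) h = sw X (\<lambda>a x. vscale X (\<epsilon> x) (F a 1)) h"
    by (rule sw_cong, rule sw_cancel[OF K X]) (intro bilD2[OF F] multilinear)
  also have "\<dots> = F h 1" by (rule sw_counit_right[OF X]) (intro bilD1[OF F] multilinear)
  finally show ?thesis .
qed

lemma sw_cancel_left:
  assumes K: "cancels K" and X: "is_vspace X" and F: "bil X F"
  shows "sw X (\<lambda>a x. sw X (\<lambda>b c. F (K a b) c) x) h = F 1 h"
proof -
  note lin = bilD1[OF F] bilD2[OF F] cancels_lin[OF K] multilinear
  have "sw X (\<lambda>a x. sw X (\<lambda>b c. F (K a b) c) x) h = sw X (\<lambda>x c. sw X (\<lambda>a b. F (K a b) c) x) h"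
    by (rule sw_assoc[OF X, symmetric]) (intro lin)
  also have "\<dots> = sw X (\<lambda>x c. vscale X (\<epsilon> x) (F 1 c)) h"
    by (rule sw_cong, rule sw_cancel[OF K X]) (intro lin)
  also have "\<dots> = F 1 h" by (rule sw_counit_left[OF X]) (intro lin)
  finally show ?thesis .
qed

lemma antip_1 [simp]: "S 1 = 1"
  using sw_one[of H "\<lambda>a b. S a * b"] cancels_antip_left by (simp add: cancels_def)

text \<open>Two evaluations of \<open>S(h1) S(g1) g2 h2 S(g3 h3)\<close>: contracting
  \<open>g2 h2 S(g3 h3)\<close> leaves \<open>S(h) S(g)\<close>, while contracting
  \<open>S(g1) g2\<close> and then \<open>S(h1) h2\<close> leaves \<open>S(g h)\<close>.\<close>

lemma antip_mult: "S (g * h) = S h * S g"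
proof -
  let ?E = "sw H (\<lambda>g1 x. sw H (\<lambda>h1 y. sw H (\<lambda>u v. S h1 * S g1 * (u * S v)) (x * y)) h) g"
  have "?E = sw H (\<lambda>g1 x. sw H (\<lambda>h1 y. hscale C (\<epsilon> x) (hscale C (\<epsilon> y) (S h1 * S g1))) h) g"
  proof (intro sw_cong)
    fix g1 x h1 y
    show "sw H (\<lambda>u v. S h1 * S g1 * (u * S v)) (x * y) = hscale C (\<epsilon> x) (hscale C (\<epsilon> y) (S h1 * S g1))"
      by (subst sw_cancel[OF cancels_antip_right]; (intro multilinear)?; simp)
  qed
  also have "\<dots> = sw H (\<lambda>g1 x. hscale C (\<epsilon> x) (S h * S g1)) g"
  proof (rule sw_cong)
    fix g1 x
    have "sw H (\<lambda>h1 y. vscale H (\<epsilon> y) (hscale C (\<epsilon> x) (S h1 * S g1))) h = hscale C (\<epsilon> x) (S h * S g1)"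
      by (rule sw_counit_right[where f = "\<lambda>u. hscale C (\<epsilon> x) (S u * S g1)"]; (intro multilinear)?; simp)
    then show "sw H (\<lambda>h1 y. hscale C (\<epsilon> x) (hscale C (\<epsilon> y) (S h1 * S g1))) h
        = hscale C (\<epsilon> x) (S h * S g1)"
      by (simp add: mult.commute)
  qed
  also have "\<dots> = S h * S g"
    by (rule sw_counit_right[of H "\<lambda>u. S h * S u", simplified]) (intro multilinear)
  finally have 1: "?E = S h * S g" .
  have "?E = sw H (\<lambda>g1 x. sw H (\<lambda>h1 y. sw H (\<lambda>g2 g3. sw H (\<lambda>h2 h3.
      S h1 * (S g1 * g2) * h2 * S (g3 * h3)) y) x) h) g"
    by (intro sw_cong, subst sw_mult; (intro multilinear)?; simp add: mult.assoc)
  also have "\<dots> = sw H (\<lambda>g1 x. sw H (\<lambda>g2 g3. sw H (\<lambda>h1 y. sw H (\<lambda>h2 h3.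
      S h1 * (S g1 * g2) * h2 * S (g3 * h3)) y) h) x) g"
    by (rule sw_cong, rule sw_swap; (intro multilinear)?; simp)
  also have "\<dots> = sw H (\<lambda>h1 y. sw H (\<lambda>h2 h3. S h1 * 1 * h2 * S (g * h3)) y) h"
    by (rule sw_cancel_left[OF cancels_antip_left, where F = "\<lambda>u g3. sw H (\<lambda>h1 y. sw H (\<lambda>h2 h3.
      S h1 * u * h2 * S (g3 * h3)) y) h"]; (intro multilinear)?; simp)
  also have "\<dots> = 1 * S (g * h)" unfolding mult_1_right
    by (rule sw_cancel_left[OF cancels_antip_left, where F = "\<lambda>u h3. u * S (g * h3)"];
      (intro multilinear)?; simp)
  finally show ?thesis using 1 by simp
qed

text \<open>The antipode reverses the coproduct. In \<open>?E\<close> the factors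
  \<open>S(h2)\<close> and \<open>S(h1)\<close> multiply the two legs of the coproduct of
  \<open>h3 S(h4)\<close>. Contracting that product gives the right-hand side. Splitting its
  coproduct and contracting first with \<open>S(h2)\<close>, then with \<open>S(h1)\<close>, leaves
  the legs of \<open>S h\<close> alone.\<close>

lemma sw_antip:
  assumes X: "is_vspace X" and F: "bil X F"
  shows "sw X F (S h) = sw X (\<lambda>a b. F (S b) (S a)) h"
proof -
  note lin = bilD1[OF F] bilD2[OF F] multilinear
  let ?E = "sw X (\<lambda>a x. sw X (\<lambda>b y. sw X (\<lambda>c d. sw X (\<lambda>u v. F (S b * u) (S a * v)) (c * S d)) y) x) h"
  have "?E = sw X (\<lambda>a x. sw X (\<lambda>u v. F (S x * u) (S a * v)) 1) h"
    by (rule sw_cong, rule sw_cancel_right[OF cancels_antip_right X,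
        where F = "\<lambda>b w. sw X (\<lambda>u v. F (S b * u) (S _ * v)) w"]; (intro lin)?; simp add: X)
  also have "\<dots> = sw X (\<lambda>a b. F (S b) (S a)) h"
    by (rule sw_cong, subst sw_one; (intro lin)?; simp add: X)
  finally have 1: "?E = sw X (\<lambda>a b. F (S b) (S a)) h" .
  have "?E = sw X (\<lambda>a x. sw X (\<lambda>b y. sw X (\<lambda>c d. sw X (\<lambda>c1 c2. sw X (\<lambda>d1 d2.
      F ((S b * c1) * d1) (S a * (c2 * d2))) (S d)) c) y) x) h"
    by (intro sw_cong, subst sw_mult; (intro lin)?; simp add: X mult.assoc)
  also have "\<dots> = sw X (\<lambda>a x. sw X (\<lambda>b y. sw X (\<lambda>c1 z. sw X (\<lambda>c2 d. sw X (\<lambda>d1 d2.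
      F ((S b * c1) * d1) (S a * (c2 * d2))) (S d)) z) y) x) h"
    by (rule sw_cong, rule sw_cong, rule sw_assoc; (intro lin)?; simp add: X)
  also have "\<dots> = sw X (\<lambda>a x. sw X (\<lambda>c2 d. sw X (\<lambda>d1 d2. F (1 * d1) (S a * (c2 * d2))) (S d)) x) h"
    by (rule sw_cong, rule sw_cancel_left[OF cancels_antip_left X,
        where F = "\<lambda>w z. sw X (\<lambda>c2 d. sw X (\<lambda>d1 d2. F (w * d1) (S _ * (c2 * d2))) (S d)) z"];
      (intro lin)?; simp add: X)
  also have "\<dots> = sw X (\<lambda>a x. sw X (\<lambda>c2 d. sw X (\<lambda>d1 d2. F d1 ((S a * c2) * d2)) (S d)) x) h"
    by (simp add: mult.assoc)
  also have "\<dots> = sw X (\<lambda>d1 d2. F d1 (1 * d2)) (S h)"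
    by (rule sw_cancel_left[OF cancels_antip_left X, where F = "\<lambda>w d. sw X (\<lambda>d1 d2. F d1 (w * d2)) (S d)"];
      (intro lin)?; simp add: X)
  finally show ?thesis using 1 by simp
qed

lemma hscale_diff_left: "hscale C (c - d) a = hscale C c a - hscale C d a"
proof -
  interpret vector_space "hscale C" by (rule vector_space_H)
  show ?thesis by (rule scale_left_diff_distrib)
qed

lemma sw_vsum:
  assumes X: "is_vspace X" and I: "finite I" and F: "\<And>i. i \<in> I \<Longrightarrow> bil X (F i)"
  shows "sw X (\<lambda>a b. vsum X (\<lambda>i. F i a b) I) h = vsum X (\<lambda>i. sw X (F i) h) I"
  unfolding sweedler2_def
proof (rule tlift_eqI[OF _ _ X _ _ _ comult_carr])
  show "bil X (\<lambda>a b. vsum X (\<lambda>i. F i a b) I)"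
    by (intro bilI vlinear_sum X is_vspace_H) (auto intro: bilD1[OF F vlinear_ident] bilD2[OF F vlinear_ident])
  show "vlinear (HH C) X (\<lambda>t. vsum X (\<lambda>i. tlift H H X (F i) t) I)"
    by (intro vlinear_sum X is_vspace_HH vlinear_tlift F) simp_all
  show "vsum X (\<lambda>i. tlift H H X (F i) (hpure C a b)) I = vsum X (\<lambda>i. F i a b) I" for a b
    by (rule vsum_cong) (simp add: tlift_pure X F)
qed simp_all

lemma sw_vminus:
  assumes X: "is_vspace X" and F: "bil X F" and G: "bil X G"
  shows "sw X (\<lambda>a b. vminus X (F a b) (G a b)) h = vminus X (sw X F h) (sw X G h)"
  unfolding sweedler2_def
proof (rule tlift_eqI[OF _ _ X _ _ _ comult_carr])
  show "bil X (\<lambda>a b. vminus X (F a b) (G a b))"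
    by (intro bilI vlinear_minus X bilD1[OF F] bilD1[OF G] bilD2[OF F] bilD2[OF G] vlinear_ident)
  show "vlinear (HH C) X (\<lambda>t. vminus X (tlift H H X F t) (tlift H H X G t))"
    by (intro vlinear_minus X vlinear_tlift F G) simp_all
qed (simp_all add: tlift_pure X F G)

lemma sw_times_left:
  assumes F: "bil ground F"
  shows "sw ground (\<lambda>a b. c * F a b) h = c * sw ground F h"
  by (rule sw_map[where f = "\<lambda>t. c * t", symmetric]; (intro multilinear bilD1[OF F] bilD2[OF F])?; simp)

lemma sw_times_right:
  assumes F: "bil ground F"
  shows "sw ground (\<lambda>a b. F a b * c) h = sw ground F h * c"
  by (rule sw_map[where f = "\<lambda>t. t * c", symmetric]; (intro multilinear bilD1[OF F] bilD2[OF F])?; simp)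

text \<open>The triple coproducts of \<open>g\<close> and \<open>h\<close> are reassociated
  together, so that an identity involving two adjacent legs of both can be applied under the sum.
  \<open>Q_comm\<close> uses it to pass from the first two legs to the last two.\<close>

lemma sw_assoc_pair:
  assumes X: "is_vspace X"
    and lin: "\<And>b c a' b' c'. vlinear H X (\<lambda>a. E a b c a' b' c')"
      "\<And>a c a' b' c'. vlinear H X (\<lambda>b. E a b c a' b' c')"
      "\<And>a b a' b' c'. vlinear H X (\<lambda>c. E a b c a' b' c')"
      "\<And>a b c b' c'. vlinear H X (\<lambda>a'. E a b c a' b' c')"
      "\<And>a b c a' c'. vlinear H X (\<lambda>b'. E a b c a' b' c')"
      "\<And>a b c a' b'. vlinear H X (\<lambda>c'. E a b c a' b' c')"
  shows "sw X (\<lambda>a x. sw X (\<lambda>a' y. sw X (\<lambda>b c. sw X (\<lambda>b' c'. E a b c a' b' c') y) x) h) g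
    = sw X (\<lambda>w c. sw X (\<lambda>v c'. sw X (\<lambda>a b. sw X (\<lambda>a' b'. E a b c a' b' c') v) w) h) g"
proof -
  note lins = multilinear lin[THEN vlinear_compose]
  have "sw X (\<lambda>a x. sw X (\<lambda>a' y. sw X (\<lambda>b c. sw X (\<lambda>b' c'. E a b c a' b' c') y) x) h) g
      = sw X (\<lambda>a x. sw X (\<lambda>b c. sw X (\<lambda>a' y. sw X (\<lambda>b' c'. E a b c a' b' c') y) h) x) g"
    by (rule sw_cong, rule sw_swap; (intro lins)?; simp add: X)
  also have "\<dots> = sw X (\<lambda>a x. sw X (\<lambda>b c. sw X (\<lambda>v c'. sw X (\<lambda>a' b'. E a b c a' b' c') v) h) x) g"
    by (rule sw_cong, rule sw_cong, rule sw_assoc[symmetric]; (intro lins)?; simp add: X)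
  also have "\<dots> = sw X (\<lambda>w c. sw X (\<lambda>a b. sw X (\<lambda>v c'. sw X (\<lambda>a' b'. E a b c a' b' c') v) h) w) g"
    by (rule sw_assoc[symmetric]; (intro lins)?; simp add: X)
  also have "\<dots> = sw X (\<lambda>w c. sw X (\<lambda>v c'. sw X (\<lambda>a b. sw X (\<lambda>a' b'. E a b c a' b' c') v) w) h) g"
    by (rule sw_cong, rule sw_swap; (intro lins)?; simp add: X)
  finally show ?thesis .
qed

end

section \<open>Dual-quasitriangular structure\<close>

locale calc = hopf C for C :: "('k::field, 'h::ring_1, 'w::ab_group_add) calc_data" +
  assumes bij_antip: "bij (antip C)"
    and dqt: "dual_quasitriangular C"
    and comod: "fd_right_comodule C"
    and surj: "rhoQ C ` ker_counit C = carr (EndW C)"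
begin

abbreviation "R a b \<equiv> Rform C (hpure C a b)"

lemma lin_Rform: "vlinear (HH C) ground (Rform C)"
  using dqt by (simp add: dual_quasitriangular_def)

lemma lin_R [multilinear]:
  "vlinear U H g \<Longrightarrow> vlinear U ground (\<lambda>u. R (g u) b)"
  "vlinear U H g \<Longrightarrow> vlinear U ground (\<lambda>u. R a (g u))"
  by (auto intro!: vlinear_compose[OF lin_Rform] multilinear)

lemma R_mult_left: "R (a * b) c = sw ground (\<lambda>c1 c2. R a c1 * R b c2) c"
  and R_mult_right: "R a (b * c) = sw ground (\<lambda>a1 a2. R a1 c * R a2 b) a"
  and R_comm: "sw H (\<lambda>a1 a2. sw H (\<lambda>b1 b2. hscale C (R a2 b2) (b1 * a1)) b) a
    = sw H (\<lambda>a1 a2. sw H (\<lambda>b1 b2. hscale C (R a1 b1) (a2 * b2)) b) a"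
  using dqt by (simp_all add: dual_quasitriangular_def)

text \<open>With \<open>*\<close> for convolution,
  \<open>u = u * (u * w) = (u * u) * w = u * w = \<epsilon>\<close>.\<close>

lemma idempotent_eq_counit:
  assumes u: "vlinear H ground u" and w: "vlinear H ground w"
    and uu: "\<And>a. u a = sw ground (\<lambda>x y. u x * u y) a"
    and uw: "\<And>a. sw ground (\<lambda>x y. u x * w y) a = \<epsilon> a"
  shows "u a = \<epsilon> a"
proof -
  note lin = multilinear vlinear_compose[OF u] vlinear_compose[OF w]
  have "u a = sw ground (\<lambda>x y. \<epsilon> y * u x) a"
    using sw_counit_right[OF _ u, of a] by simp
  also have "\<dots> = sw ground (\<lambda>x y. sw ground (\<lambda>b c. u x * (u b * w c)) y) a"
  proof (rule sw_cong)
    fix x y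
    have "u x * sw ground (\<lambda>b c. u b * w c) y = sw ground (\<lambda>b c. u x * (u b * w c)) y"
      by (rule sw_map[where f = "\<lambda>t. u x * t"]; (intro lin)?; simp)
    then show "\<epsilon> y * u x = sw ground (\<lambda>b c. u x * (u b * w c)) y" by (simp add: uw mult.commute)
  qed
  also have "\<dots> = sw ground (\<lambda>x c. sw ground (\<lambda>a b. u a * (u b * w c)) x) a"
    by (rule sw_assoc[symmetric]; (intro lin)?; simp)
  also have "\<dots> = sw ground (\<lambda>x c. u x * w c) a"
  proof (rule sw_cong)
    fix x c
    have "sw ground (\<lambda>a b. u a * u b) x * w c = sw ground (\<lambda>a b. u a * u b * w c) x"
      by (rule sw_map[where f = "\<lambda>t. t * w c"]; (intro lin)?; simp)
    then show "sw ground (\<lambda>a b. u a * (u b * w c)) x = u x * w c"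
      by (simp add: uu[symmetric] mult.assoc)
  qed
  finally show ?thesis by (simp add: uw)
qed

text \<open>Normalization is derived from invertibility: multiplicativity at \<open>1\<close> makes
  both functionals convolution idempotents, and the convolution inverse of \<open>R\<close>, with
  the same argument set to \<open>1\<close>, is a right inverse of them.\<close>

lemma R_one_right [simp]: "R a 1 = \<epsilon> a" and R_one_left [simp]: "R 1 a = \<epsilon> a"
proof -
  obtain R' where R': "vlinear (HH C) ground R'" "conv_inverse C (Rform C) R'"
    using dqt by (auto simp: dual_quasitriangular_def)
  note lin = multilinear vlinear_compose[OF R'(1)]
  have inv: "sw ground (\<lambda>a1 a2. sw ground (\<lambda>b1 b2. R a1 b1 * R' (hpure C a2 b2)) b) a = \<epsilon> a * \<epsilon> b" for a b
    using R'(2) by (auto simp: conv_inverse_def)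
  show "R a 1 = \<epsilon> a"
  proof (rule idempotent_eq_counit[where w = "\<lambda>a. R' (hpure C a 1)"])
    show "R a 1 = sw ground (\<lambda>x y. R x 1 * R y 1) a" for a
      using R_mult_right[of a 1 1] by simp
    have "sw ground (\<lambda>x y. R x 1 * R' (hpure C y 1)) a
        = sw ground (\<lambda>a1 a2. sw ground (\<lambda>b1 b2. R a1 b1 * R' (hpure C a2 b2)) 1) a" for a
      by (rule sw_cong, rule sw_one[symmetric]; (intro lin)?; simp)
    then show "sw ground (\<lambda>x y. R x 1 * R' (hpure C y 1)) a = \<epsilon> a" for a
      by (simp add: inv)
  qed (intro lin; simp)+
  show "R 1 a = \<epsilon> a"
  proof (rule idempotent_eq_counit[where w = "\<lambda>a. R' (hpure C 1 a)"])
    show "R 1 a = sw ground (\<lambda>x y. R 1 x * R 1 y) a" for a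
      using R_mult_left[of 1 1 a] by simp
    have "sw ground (\<lambda>x y. R 1 x * R' (hpure C 1 y)) a
        = sw ground (\<lambda>a1 a2. sw ground (\<lambda>b1 b2. R a1 b1 * R' (hpure C a2 b2)) a) 1" for a
      by (rule sw_one[symmetric]; (intro lin)?; simp)
    then show "sw ground (\<lambda>x y. R 1 x * R' (hpure C 1 y)) a = \<epsilon> a" for a
      by (simp add: inv)
  qed (intro lin; simp)+
qed

definition vfun :: "'h \<Rightarrow> 'k"
  where "vfun h = sw ground (\<lambda>a b. R a (S b)) h"

lemma lin_vfun [multilinear]: "vlinear U H g \<Longrightarrow> vlinear U ground (\<lambda>u. vfun (g u))"
  unfolding vfun_def by (intro multilinear; simp)

text \<open>This is \<open>S(h\<^sub>(\<^sub>4\<^sub>)) h\<^sub>(\<^sub>1\<^sub>) R(h\<^sub>(\<^sub>2\<^sub>) \<otimes> S h\<^sub>(\<^sub>3\<^sub>)) = R(h\<^sub>(\<^sub>1\<^sub>) \<otimes> S h\<^sub>(\<^sub>2\<^sub>)) 1\<close>, the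
  quasi-commutativity of \<open>h\<^sub>(\<^sub>1\<^sub>)\<close> and \<open>S h\<^sub>(\<^sub>2\<^sub>)\<close>; it is equivalent to \<open>S\<^sup>2 = v\<^sup>-\<^sup>1 * id * v\<close>.\<close>

lemma vfun_antip: "sw H (\<lambda>a z. sw H (\<lambda>w b. hscale C (vfun w) (S b * a)) z) h = hscale C (vfun h) 1"
proof -
  have "sw H (\<lambda>x y. sw H (\<lambda>a1 a2. sw H (\<lambda>b1 b2. hscale C (R a2 b2) (b1 * a1)) (S y)) x) h
    = sw H (\<lambda>x y. sw H (\<lambda>a1 a2. sw H (\<lambda>b1 b2. hscale C (R a1 b1) (a2 * b2)) (S y)) x) h"
    (is "?L = ?R") by (simp add: R_comm)
  \<comment> \<open>The antipode reverses the legs of its argument, so the two inner legs meet as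
    \<open>a2 * S b1\<close> and cancel.\<close>
  have "?R = sw H (\<lambda>x y. sw H (\<lambda>a1 a2. sw H (\<lambda>b1 b2. hscale C (R a1 (S b2)) (a2 * S b1)) y) x) h"
    by (rule sw_cong, rule sw_cong, rule sw_antip; (intro multilinear)?; simp)
  also have "\<dots> = sw H (\<lambda>a1 z. sw H (\<lambda>a2 y. sw H (\<lambda>b1 b2. hscale C (R a1 (S b2)) (a2 * S b1)) y) z) h"
    by (rule sw_assoc; (intro multilinear)?; simp)
  also have "\<dots> = sw H (\<lambda>a1 z. hscale C (R a1 (S z)) 1) h"
    by (rule sw_cong, rule sw_cancel_left[OF cancels_antip_right,
      where F = "\<lambda>u b. hscale C (R _ (S b)) u"]; (intro multilinear)?; simp)
  also have "\<dots> = hscale C (vfun h) 1"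
    unfolding vfun_def
    by (rule sw_map[where f = "\<lambda>u. hscale C u 1", symmetric]; (intro multilinear)?; simp)
  finally have r: "?R = hscale C (vfun h) 1" .
  \<comment> \<open>On this side the two inner legs meet inside \<open>R\<close> and assemble to
    \<open>vfun\<close>.\<close>
  have "?L = sw H (\<lambda>x y. sw H (\<lambda>a1 a2. sw H (\<lambda>b1 b2. hscale C (R a2 (S b1)) (S b2 * a1)) y) x) h"
    by (rule sw_cong, rule sw_cong, rule sw_antip; (intro multilinear)?; simp)
  also have "\<dots> = sw H (\<lambda>a1 z. sw H (\<lambda>a2 y. sw H (\<lambda>b1 b2. hscale C (R a2 (S b1)) (S b2 * a1)) y) z) h"
    by (rule sw_assoc; (intro multilinear)?; simp)
  also have "\<dots> = sw H (\<lambda>a1 z. sw H (\<lambda>w b2. sw H (\<lambda>a2 b1. hscale C (R a2 (S b1)) (S b2 * a1)) w) z) h"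
    by (rule sw_cong, rule sw_assoc[symmetric]; (intro multilinear)?; simp)
  also have "\<dots> = sw H (\<lambda>a1 z. sw H (\<lambda>w b2. hscale C (vfun w) (S b2 * a1)) z) h"
    unfolding vfun_def
    by (rule sw_cong, rule sw_cong, rule sw_map[where f = "\<lambda>u. hscale C u (S _ * _)", symmetric];
      (intro multilinear)?; simp)
  finally show ?thesis using r \<open>?L = ?R\<close> by simp
qed

section \<open>Matrix coefficients and the element \<open>T\<close>\<close>

abbreviation "W \<equiv> Wsp C"
abbreviation "B \<equiv> wbasis C"
abbreviation "coord \<gamma> w \<equiv> module.representation (wscale C) B w \<gamma>"

lemma fdvs_W: "finite_dimensional_vector_space (wscale C) B"
  using comod by (simp add: fd_right_comodule_def)

lemma vector_space_W: "vector_space (wscale C)"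
  using fdvs_W by (simp add: finite_dimensional_vector_space_def)

lemma is_vspace_W [simp]: "is_vspace W"
  unfolding Wsp_def by (rule is_vspace_space_of[OF vector_space_W])

lemma W_simps [simp]: "carr W = UNIV" "vplus W = (+)" "vzero W = 0" "vscale W = wscale C"
  by (simp_all add: Wsp_def)

lemma finite_B [simp]: "finite B"
  using fdvs_W by (simp add: finite_dimensional_vector_space_def finite_dimensional_vector_space_axioms_def)

lemma lin_coord: "vlinear W ground (\<lambda>w. coord \<gamma> w)"
proof -
  interpret finite_dimensional_vector_space "wscale C" B by (rule fdvs_W)
  show ?thesis
    by (rule vlinearI)
       (simp_all add: representation_add representation_scale independent_Basis span_Basis)
qed

lemma coord_basis: "\<beta> \<in> B \<Longrightarrow> coord \<gamma> \<beta> = (if \<gamma> = \<beta> then 1 else 0)"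
proof -
  interpret finite_dimensional_vector_space "wscale C" B by (rule fdvs_W)
  show "\<beta> \<in> B \<Longrightarrow> coord \<gamma> \<beta> = (if \<gamma> = \<beta> then 1 else 0)"
    by (simp add: representation_basis independent_Basis)
qed

lemma sum_coord: "(\<Sum>\<beta>\<in>B. wscale C (coord \<beta> w) \<beta>) = w"
proof -
  interpret finite_dimensional_vector_space "wscale C" B by (rule fdvs_W)
  show ?thesis by (rule sum_representation_eq) (simp_all add: independent_Basis span_Basis)
qed

lemma coact_basis: "\<alpha> \<in> B \<Longrightarrow> coact C \<alpha> = vsum (tensor W H) (\<lambda>\<beta>. pure W H \<beta> (rho C \<beta> \<alpha>)) B"
  using comod by (auto simp: fd_right_comodule_def)

lemma tlift_coact:
  assumes X: "is_vspace X" and F: "vbilinear W H X F" and \<alpha>: "\<alpha> \<in> B"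
  shows "tlift W H X F (coact C \<alpha>) = vsum X (\<lambda>\<beta>. F \<beta> (rho C \<beta> \<alpha>)) B"
proof -
  have "tlift W H X F (coact C \<alpha>)
      = vsum X (\<lambda>\<beta>. tlift W H X F (pure W H \<beta> (rho C \<beta> \<alpha>))) B"
    unfolding coact_basis[OF \<alpha>]
    by (rule vlinear_vsum_apply[OF _ X]) (simp_all add: is_vspace_tensor X F vlinear_tlift pure_carr)
  then show ?thesis by (simp add: tlift_pure X F)
qed

text \<open>This is the \<open>\<gamma>\<close>-coordinate of the counit law of the comodule at the
  basis vector \<open>\<alpha>\<close>.\<close>

lemma counit_rho:
  assumes "\<gamma> \<in> B" "\<alpha> \<in> B"
  shows "\<epsilon> (rho C \<gamma> \<alpha>) = (if \<gamma> = \<alpha> then 1 else 0)"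
proof -
  have bl: "vbilinear W H W (\<lambda>w0 h. wscale C (\<epsilon> h) w0)"
    using vlinear_scale[OF is_vspace_W vlinear_ident]
      vlinear_scale_comp[OF is_vspace_W _ lin_counit] by (intro vbilinearI) simp_all
  have "\<alpha> = tlift W H W (\<lambda>w0 h. wscale C (\<epsilon> h) w0) (coact C \<alpha>)"
    using comod by (simp add: fd_right_comodule_def)
  also have "\<dots> = vsum W (\<lambda>\<beta>. wscale C (\<epsilon> (rho C \<beta> \<alpha>)) \<beta>) B"
    by (rule tlift_coact[OF is_vspace_W bl assms(2)])
  finally have "coord \<gamma> \<alpha> = coord \<gamma> (vsum W (\<lambda>\<beta>. wscale C (\<epsilon> (rho C \<beta> \<alpha>)) \<beta>) B)" by simp
  also have "\<dots> = vsum ground (\<lambda>\<beta>. coord \<gamma> (wscale C (\<epsilon> (rho C \<beta> \<alpha>)) \<beta>)) B"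
    by (rule vlinear_vsum_apply[OF _ _ lin_coord]) simp_all
  also have "\<dots> = (\<Sum>\<beta>\<in>B. \<epsilon> (rho C \<beta> \<alpha>) * coord \<gamma> \<beta>)"
    using vlinear_vscale[OF lin_coord] by (simp add: vsum_ground)
  also have "\<dots> = (\<Sum>\<beta>\<in>B. if \<beta> = \<gamma> then \<epsilon> (rho C \<beta> \<alpha>) else 0)"
    by (rule sum.cong) (auto simp: coord_basis)
  also have "\<dots> = \<epsilon> (rho C \<gamma> \<alpha>)" using assms by simp
  finally show ?thesis using assms by (simp add: coord_basis)
qed

text \<open>Coassociativity of the coaction at \<open>\<alpha>\<close> is an equation in
  \<open>W \<otimes> (H \<otimes> H)\<close>. The map \<open>L\<close> applies the coordinate
  functional of \<open>\<gamma>\<close> to the leg in \<open>W\<close>; on the iterated coaction it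
  picks the summand \<open>\<delta> = \<gamma>\<close>, on the other side the single
  coproduct.\<close>

lemma comult_rho:
  assumes \<gamma>: "\<gamma> \<in> B" and \<alpha>: "\<alpha> \<in> B"
  shows "comult C (rho C \<gamma> \<alpha>) = vsum (HH C) (\<lambda>\<beta>. hpure C (rho C \<gamma> \<beta>) (rho C \<beta> \<alpha>)) B"
proof -
  let ?Y = "tensor W (HH C)"
  have Y [simp]: "is_vspace ?Y" by (rule is_vspace_tensor) simp_all
  have [simp]: "pure W (HH C) w t \<in> carr ?Y" if "t \<in> carr (HH C)" for w t
    using that by (simp add: pure_carr)
  have b1: "vbilinear W H ?Y (\<lambda>w0' h'. pure W (HH C) w0' (hpure C h' h))" for h
    by (intro vbilinearI multilinear; simp)
  have b2: "vbilinear W H ?Y (\<lambda>w0 h. pure W (HH C) w0 (comult C h))"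
    by (intro vbilinearI multilinear; simp)
  have lc: "vlinear W (tensor W H) (coact C)"
    using comod by (simp add: fd_right_comodule_def)
  have b3: "vbilinear W H ?Y (\<lambda>w0 h. tlift W H ?Y
      (\<lambda>w0' h'. pure W (HH C) w0' (hpure C h' h)) (coact C w0))"
  proof (rule vbilinearI)
    fix w
    show "vlinear H ?Y (\<lambda>h. tlift W H ?Y (\<lambda>w0' h'. pure W (HH C) w0' (hpure C h' h)) (coact C w))"
      by (rule vlinear_tlift_param; (intro b1 multilinear vlinear_carr[OF lc])?; simp)
  next
    fix h
    show "vlinear W ?Y (\<lambda>w. tlift W H ?Y (\<lambda>w0' h'. pure W (HH C) w0' (hpure C h' h)) (coact C w))"
      by (rule vlinear_compose[OF vlinear_tlift lc]) (simp_all add: b1)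
  qed
  have "vsum ?Y (\<lambda>\<beta>. vsum ?Y (\<lambda>\<delta>. pure W (HH C) \<delta> (hpure C (rho C \<delta> \<beta>) (rho C \<beta> \<alpha>))) B) B
      = vsum ?Y (\<lambda>\<beta>. tlift W H ?Y (\<lambda>w0' h'. pure W (HH C) w0' (hpure C h' (rho C \<beta> \<alpha>))) (coact C \<beta>)) B"
    by (rule vsum_cong, rule tlift_coact[OF Y b1, symmetric])
  also have "\<dots> = tlift W H ?Y (\<lambda>w0 h. tlift W H ?Y
      (\<lambda>w0' h'. pure W (HH C) w0' (hpure C h' h)) (coact C w0)) (coact C \<alpha>)"
    by (rule tlift_coact[OF Y b3 \<alpha>, symmetric])
  also have "\<dots> = tlift W H ?Y (\<lambda>w0 h. pure W (HH C) w0 (comult C h)) (coact C \<alpha>)"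
    using comod by (simp add: fd_right_comodule_def)
  also have "\<dots> = vsum ?Y (\<lambda>\<beta>. pure W (HH C) \<beta> (comult C (rho C \<beta> \<alpha>))) B"
    by (rule tlift_coact[OF Y b2 \<alpha>])
  finally have eq: "vsum ?Y (\<lambda>\<beta>. vsum ?Y (\<lambda>\<delta>. pure W (HH C) \<delta> (hpure C (rho C \<delta> \<beta>) (rho C \<beta> \<alpha>))) B) B
      = vsum ?Y (\<lambda>\<beta>. pure W (HH C) \<beta> (comult C (rho C \<beta> \<alpha>))) B" .
  define L where "L = tlift W (HH C) (HH C) (\<lambda>w t. vscale (HH C) (coord \<gamma> w) t)"
  have bL: "vbilinear W (HH C) (HH C) (\<lambda>w t. vscale (HH C) (coord \<gamma> w) t)"
    by (intro vbilinearI multilinear lin_coord; simp)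
  have lL: "vlinear ?Y (HH C) L" unfolding L_def by (rule vlinear_tlift[OF _ _ _ bL]) simp_all
  have Lp: "L (pure W (HH C) \<delta> t) = vscale (HH C) (if \<delta> = \<gamma> then 1 else 0) t"
    if "t \<in> carr (HH C)" "\<delta> \<in> B" for \<delta> t
    using that by (auto simp: L_def tlift_pure bL coord_basis)
  have "vsum (HH C) (\<lambda>\<beta>. hpure C (rho C \<gamma> \<beta>) (rho C \<beta> \<alpha>)) B
      = vsum (HH C) (\<lambda>\<beta>. vsum (HH C) (\<lambda>\<delta>. vscale (HH C) (if \<delta> = \<gamma> then 1 else 0)
          (hpure C (rho C \<delta> \<beta>) (rho C \<beta> \<alpha>))) B) B"
    by (rule vsum_cong, rule vsum_delta[symmetric]) (simp_all add: \<gamma>)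
  also have "\<dots> = vsum (HH C) (\<lambda>\<beta>. vsum (HH C) (\<lambda>\<delta>. L (pure W (HH C) \<delta>
          (hpure C (rho C \<delta> \<beta>) (rho C \<beta> \<alpha>)))) B) B"
    by (rule vsum_cong, rule vsum_cong) (simp add: Lp)
  also have "\<dots> = vsum (HH C) (\<lambda>\<beta>. L (vsum ?Y (\<lambda>\<delta>. pure W (HH C) \<delta>
          (hpure C (rho C \<delta> \<beta>) (rho C \<beta> \<alpha>))) B)) B"
    by (rule vsum_cong, rule vlinear_vsum_apply[OF _ _ lL, symmetric]) simp_all
  also have "\<dots> = L (vsum ?Y (\<lambda>\<beta>. vsum ?Y (\<lambda>\<delta>. pure W (HH C) \<delta>
          (hpure C (rho C \<delta> \<beta>) (rho C \<beta> \<alpha>))) B) B)"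
    by (rule vlinear_vsum_apply[OF _ _ lL, symmetric]) simp_all
  also have "\<dots> = vsum (HH C) (\<lambda>\<beta>. L (pure W (HH C) \<beta> (comult C (rho C \<beta> \<alpha>)))) B"
    unfolding eq by (rule vlinear_vsum_apply[OF _ _ lL]) simp_all
  also have "\<dots> = vsum (HH C) (\<lambda>\<beta>. vscale (HH C) (if \<beta> = \<gamma> then 1 else 0) (comult C (rho C \<beta> \<alpha>))) B"
    by (rule vsum_cong) (simp add: Lp)
  also have "\<dots> = comult C (rho C \<gamma> \<alpha>)" by (rule vsum_delta) (simp_all add: \<gamma>)
  finally show ?thesis by simp
qed

lemma sw_rho:
  assumes X: "is_vspace X" and F: "bil X F" and "\<gamma> \<in> B" "\<alpha> \<in> B"
  shows "sw X F (rho C \<gamma> \<alpha>) = vsum X (\<lambda>\<beta>. F (rho C \<gamma> \<beta>) (rho C \<beta> \<alpha>)) B"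
proof -
  have "tlift H H X F (vsum (HH C) (\<lambda>\<beta>. hpure C (rho C \<gamma> \<beta>) (rho C \<beta> \<alpha>)) B)
      = vsum X (\<lambda>\<beta>. tlift H H X F (hpure C (rho C \<gamma> \<beta>) (rho C \<beta> \<alpha>))) B"
    by (rule vlinear_vsum_apply[OF _ X]) (simp_all add: X F vlinear_tlift)
  then show ?thesis by (simp add: sweedler2_def comult_rho assms tlift_pure)
qed

section \<open>Cocommutative elements\<close>

definition cocomm :: "'h \<Rightarrow> bool"
  where "cocomm t \<longleftrightarrow> sw (HH C) (\<lambda>a b. hpure C b a) t = comult C t"

lemma sw_cocomm:
  assumes t: "cocomm t" and X: "is_vspace X" and F: "bil X F"
  shows "sw X F t = sw X (\<lambda>a b. F b a) t"
proof -
  note lin = multilinear bilD1[OF F] bilD2[OF F]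
  have "sw X F t = tlift H H X F (sw (HH C) (\<lambda>a b. hpure C b a) t)"
    using t by (simp add: cocomm_def sweedler2_def)
  also have "\<dots> = sw X (\<lambda>a b. tlift H H X F (hpure C b a)) t"
    by (rule sw_map[where f = "tlift H H X F"]; (intro lin)?; simp add: X)
  finally show ?thesis by (simp add: tlift_pure X F)
qed

lemma cocommI: "sw (HH C) (\<lambda>a b. hpure C b a) t = sw (HH C) (\<lambda>a b. hpure C a b) t \<Longrightarrow> cocomm t"
  by (simp add: cocomm_def sw_hpure_comult)

lemma cocomm_mult:
  assumes "cocomm g" "cocomm h"
  shows "cocomm (g * h)"
proof (rule cocommI)
  have "sw (HH C) (\<lambda>a b. hpure C b a) (g * h)
      = sw (HH C) (\<lambda>a b. sw (HH C) (\<lambda>c d. hpure C (b * d) (a * c)) h) g"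
    by (rule sw_mult; (intro multilinear)?; simp)
  also have "\<dots> = sw (HH C) (\<lambda>b a. sw (HH C) (\<lambda>c d. hpure C (b * d) (a * c)) h) g"
    by (rule sw_cocomm[OF assms(1)]; (intro multilinear)?; simp)
  also have "\<dots> = sw (HH C) (\<lambda>b a. sw (HH C) (\<lambda>d c. hpure C (b * d) (a * c)) h) g"
    by (rule sw_cong, rule sw_cocomm[OF assms(2)]; (intro multilinear)?; simp)
  also have "\<dots> = sw (HH C) (\<lambda>a b. hpure C a b) (g * h)"
    by (rule sw_mult[symmetric]; (intro multilinear)?; simp)
  finally show "sw (HH C) (\<lambda>a b. hpure C b a) (g * h) = sw (HH C) (\<lambda>a b. hpure C a b) (g * h)" .
qed

text \<open>\<open>S\<close> reverses the order of the legs, and cocommutativity of \<open>h\<close>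
  reverses it back.\<close>

lemma cocomm_antip:
  assumes "cocomm h"
  shows "cocomm (S h)"
proof (rule cocommI)
  have "sw (HH C) (\<lambda>a b. hpure C b a) (S h) = sw (HH C) (\<lambda>a b. hpure C (S a) (S b)) h"
    by (rule sw_antip; (intro multilinear)?; simp)
  also have "\<dots> = sw (HH C) (\<lambda>a b. hpure C (S b) (S a)) h"
    by (rule sw_cocomm[OF assms]; (intro multilinear)?; simp)
  also have "\<dots> = sw (HH C) (\<lambda>a b. hpure C a b) (S h)"
    by (rule sw_antip[symmetric]; (intro multilinear)?; simp)
  finally show "sw (HH C) (\<lambda>a b. hpure C b a) (S h) = sw (HH C) (\<lambda>a b. hpure C a b) (S h)" .
qed

text \<open>Cyclicity of the trace: the coproduct of the character is the double sum of
  \<open>rho C \<alpha> \<beta> \<otimes> rho C \<beta> \<alpha>\<close>, and flipping the legs only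
  exchanges the names of the indices.\<close>

lemma cocomm_character: "cocomm (\<Sum>\<alpha>\<in>B. rho C \<alpha> \<alpha>)"
proof (rule cocommI)
  have *: "sw (HH C) F (\<Sum>\<alpha>\<in>B. rho C \<alpha> \<alpha>)
      = vsum (HH C) (\<lambda>\<alpha>. vsum (HH C) (\<lambda>\<beta>. F (rho C \<alpha> \<beta>) (rho C \<beta> \<alpha>)) B) B" if F: "bil (HH C) F" for F
  proof -
    have "(\<Sum>\<alpha>\<in>B. rho C \<alpha> \<alpha>) = vsum H (\<lambda>\<alpha>. rho C \<alpha> \<alpha>) B"
      by (simp add: Hsp_def vsum_space_of vector_space_H)
    then have "sw (HH C) F (\<Sum>\<alpha>\<in>B. rho C \<alpha> \<alpha>) = vsum (HH C) (\<lambda>\<alpha>. sw (HH C) F (rho C \<alpha> \<alpha>)) B"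
      using vlinear_vsum_apply[OF _ _ lin_sw[OF _ F]] by simp
    also have "\<dots> = vsum (HH C) (\<lambda>\<alpha>. vsum (HH C) (\<lambda>\<beta>. F (rho C \<alpha> \<beta>) (rho C \<beta> \<alpha>)) B) B"
      by (rule vsum_cong, rule sw_rho[OF _ F]) simp_all
    finally show ?thesis .
  qed
  have b1: "bil (HH C) (\<lambda>a b. hpure C b a)" and b2: "bil (HH C) (\<lambda>a b. hpure C a b)"
    by (intro multilinear; simp)+
  show "sw (HH C) (\<lambda>a b. hpure C b a) (\<Sum>\<alpha>\<in>B. rho C \<alpha> \<alpha>) = sw (HH C) (\<lambda>a b. hpure C a b) (\<Sum>\<alpha>\<in>B. rho C \<alpha> \<alpha>)"
    unfolding *[OF b1] *[OF b2] by (rule vsum_swap) simp_all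
qed

lemma antip_sum: "S (\<Sum>\<alpha>\<in>A. f \<alpha>) = (\<Sum>\<alpha>\<in>A. S (f \<alpha>))"
proof (cases "finite A")
  case True
  then show ?thesis
    using vlinear_vsum_apply[OF is_vspace_H is_vspace_H lin_antip, of A f]
    by (simp add: Hsp_def vsum_space_of vector_space_H)
next
  case False
  then show ?thesis using vlinear_vzero[OF is_vspace_H is_vspace_H lin_antip] by simp
qed

lemma cocomm_tau: "cocomm (tau C)"
proof -
  have "tau C = (\<Sum>\<alpha>\<in>B. rho C \<alpha> \<alpha>) * S (\<Sum>\<beta>\<in>B. rho C \<beta> \<beta>)"
    by (simp add: tau_def antip_sum sum_product)
  then show ?thesis by (simp add: cocomm_mult cocomm_antip cocomm_character)
qed

section \<open>The element \<open>T\<close> and its invariance under \<open>Ad\<close>\<close>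

lemma Tel_eq: "Tel C = sw H (\<lambda>x c. hscale C (vfun x) c) (tau C)"
  unfolding Tel_def sweedler3_def vfun_def
  by (rule sw_cong, rule sw_map[where f = "\<lambda>u. hscale C u _", symmetric]; (intro multilinear)?; simp)

text \<open>Rotating the last leg of \<open>\<tau>\<close> to the front brings together the legs that
  \<open>vfun_antip\<close> contracts.\<close>

lemma Ad_Tel:
  assumes X: "is_vspace X" and F: "bil X F"
  shows "sw X (\<lambda>a x. sw X (\<lambda>b c. F b (S a * c)) x) (Tel C) = F (Tel C) 1"
proof -
  note lin = multilinear bilD1[OF F] bilD2[OF F]
  define G where "G = (\<lambda>t. sw X (\<lambda>a x. sw X (\<lambda>b c. F b (S a * c)) x) t)"
  have lG: "vlinear H X G" unfolding G_def by (intro lin; simp add: X)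
  let ?E = "\<lambda>x a b d. vscale X (vfun x) (F b (S a * d))"
  have [simp]: "F a b \<in> carr X" for a b by (rule bil_carr[OF F])
  have "G (Tel C) = sw X (\<lambda>x c. G (hscale C (vfun x) c)) (tau C)"
    unfolding Tel_eq by (rule sw_map[OF _ X lG]; (intro lin)?; simp)
  also have "\<dots> = sw X (\<lambda>x c. vscale X (vfun x) (G c)) (tau C)"
    using vlinear_vscale[OF lG] by simp
  also have "\<dots> = sw X (\<lambda>x c. sw X (\<lambda>a y. vscale X (vfun x) (sw X (\<lambda>b d. F b (S a * d)) y)) c) (tau C)"
    unfolding G_def by (rule sw_cong, rule sw_map[OF X X]; (intro lin)?; simp add: X)
  also have "\<dots> = sw X (\<lambda>x c. sw X (\<lambda>a y. sw X (\<lambda>b d. ?E x a b d) y) c) (tau C)"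
    by (rule sw_cong, rule sw_cong, rule sw_map[OF X X, where f = "\<lambda>u. vscale X _ u"]; (intro lin)?; simp add: X)
  also have "\<dots> = sw X (\<lambda>x c. sw X (\<lambda>y d. sw X (\<lambda>a b. ?E x a b d) y) c) (tau C)"
    by (rule sw_cong, rule sw_assoc[symmetric]; (intro lin)?; simp add: X)
  also have "\<dots> = sw X (\<lambda>w d. sw X (\<lambda>x y. sw X (\<lambda>a b. ?E x a b d) y) w) (tau C)"
    by (rule sw_assoc[symmetric]; (intro lin)?; simp add: X)
  also have "\<dots> = sw X (\<lambda>d w. sw X (\<lambda>x y. sw X (\<lambda>a b. ?E x a b d) y) w) (tau C)"
    by (rule sw_cocomm[OF cocomm_tau]; (intro lin)?; simp add: X)
  also have "\<dots> = sw X (\<lambda>d w. sw X (\<lambda>p b. sw X (\<lambda>x a. ?E x a b d) p) w) (tau C)"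
    by (rule sw_cong, rule sw_assoc[symmetric]; (intro lin)?; simp add: X)
  also have "\<dots> = sw X (\<lambda>q b. sw X (\<lambda>d p. sw X (\<lambda>x a. ?E x a b d) p) q) (tau C)"
    by (rule sw_assoc[symmetric]; (intro lin)?; simp add: X)
  also have "\<dots> = sw X (\<lambda>q b. sw X (\<lambda>d p. sw X (\<lambda>x a. F b (hscale C (vfun x) (S a * d))) p) q) (tau C)"
    using vlinear_vscale[OF bilD2[OF F vlinear_ident]] by simp
  also have "\<dots> = sw X (\<lambda>q b. sw X (\<lambda>d p. F b (sw H (\<lambda>x a. hscale C (vfun x) (S a * d)) p)) q) (tau C)"
    by (rule sw_cong, rule sw_cong, rule sw_map[OF _ X, symmetric]; (intro lin)?; simp add: X)
  also have "\<dots> = sw X (\<lambda>q b. F b (sw H (\<lambda>d p. sw H (\<lambda>x a. hscale C (vfun x) (S a * d)) p) q)) (tau C)"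
    by (rule sw_cong, rule sw_map[OF _ X, symmetric]; (intro lin)?; simp add: X)
  also have "\<dots> = sw X (\<lambda>q b. F (hscale C (vfun q) b) 1) (tau C)"
    using vlinear_vscale[OF bilD2[OF F vlinear_ident]] vlinear_vscale[OF bilD1[OF F vlinear_ident]]
    by (simp add: vfun_antip)
  also have "\<dots> = F (Tel C) 1"
    unfolding Tel_eq by (rule sw_map[OF _ X, where f = "\<lambda>u. F u 1", symmetric]; (intro lin)?; simp)
  finally show ?thesis by (simp add: G_def)
qed

section \<open>The map \<open>Q\<close> and the ideal \<open>Q\<^sub>H\<close>\<close>

abbreviation "Q \<equiv> Qmap C"

lemma lin_Q [multilinear]:
  "vlinear U H f \<Longrightarrow> vlinear U ground (\<lambda>u. Q (f u) g)"
  "vlinear U H f \<Longrightarrow> vlinear U ground (\<lambda>u. Q h (f u))"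
proof -
  have l: "vlinear H ground (\<lambda>h. Q h g)" "vlinear H ground (\<lambda>g. Q h g)"
    unfolding Qmap_def by ((intro multilinear; simp)+)
  show "vlinear U H f \<Longrightarrow> vlinear U ground (\<lambda>u. Q (f u) g)"
    "vlinear U H f \<Longrightarrow> vlinear U ground (\<lambda>u. Q h (f u))"
    by (rule vlinear_compose[OF l(1)], assumption) (rule vlinear_compose[OF l(2)], assumption)
qed

lemma Q_one: "Q 1 g = \<epsilon> g"
proof -
  have "Q 1 g = sw ground (\<lambda>g1 g2. \<epsilon> g1 * \<epsilon> g2) g"
    unfolding Qmap_def by (rule sw_cong, subst sw_one; (intro multilinear)?; simp)
  also have "\<dots> = \<epsilon> g" using sw_counit_left[OF _ lin_counit, of g] by simp
  finally show ?thesis .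
qed

text \<open>Multiplicativity of \<open>R\<close> in both arguments puts the contributions of
  \<open>h\<close> inside those of \<open>h'\<close>, on the middle legs of \<open>g\<close>, where
  they form \<open>Q h\<close>. The triple coproduct of a matrix coefficient has a matrix
  coefficient in the middle, which is why the formula yields a right ideal.\<close>

lemma Q_mult: "Q (h * h') g = sw ground (\<lambda>a z. sw ground (\<lambda>y d.
    sw ground (\<lambda>k1 k2. R a k1 * Q h y * R k2 d) h') z) g"
proof -
  let ?E = "\<lambda>a b c d k1 k2 h1 h2. R a k1 * (R b h1 * R h2 c) * R k2 d"
  have "Q (h * h') g = sw ground (\<lambda>g1 g2. sw ground (\<lambda>h1 h2. sw ground (\<lambda>k1 k2.
      R g1 (h1 * k1) * R (h2 * k2) g2) h') h) g"
    unfolding Qmap_def by (rule sw_cong, rule sw_mult; (intro multilinear)?; simp)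
  also have "\<dots> = sw ground (\<lambda>g1 g2. sw ground (\<lambda>h1 h2. sw ground (\<lambda>k1 k2.
      sw ground (\<lambda>a b. sw ground (\<lambda>c d. ?E a b c d k1 k2 h1 h2) g2) g1) h') h) g"
  proof (intro sw_cong[of "\<lambda>g1 g2. sw ground (\<lambda>h1 h2. F g1 g2 h1 h2) h"
        "\<lambda>g1 g2. sw ground (\<lambda>h1 h2. G g1 g2 h1 h2) h" for F G] sw_cong)
    fix g1 g2 h1 h2 k1 k2
    have "R g1 (h1 * k1) * R (h2 * k2) g2
        = sw ground (\<lambda>a b. R a k1 * R b h1 * sw ground (\<lambda>c d. R h2 c * R k2 d) g2) g1"
      unfolding R_mult_left R_mult_right by (subst sw_times_right; (intro multilinear)?; simp)
    also have "\<dots> = sw ground (\<lambda>a b. sw ground (\<lambda>c d. R a k1 * R b h1 * (R h2 c * R k2 d)) g2) g1"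
      by (rule sw_cong, subst sw_times_left; (intro multilinear)?; simp)
    finally show "R g1 (h1 * k1) * R (h2 * k2) g2
        = sw ground (\<lambda>a b. sw ground (\<lambda>c d. ?E a b c d k1 k2 h1 h2) g2) g1" by (simp add: mult.assoc)
  qed
  \<comment> \<open>The steps from here on permute and reassociate the sums until those over the
    legs of \<open>h\<close> and over the two middle legs of \<open>g\<close> are innermost.\<close>
  also have "\<dots> = sw ground (\<lambda>g1 g2. sw ground (\<lambda>h1 h2. sw ground (\<lambda>a b. sw ground (\<lambda>k1 k2.
      sw ground (\<lambda>c d. ?E a b c d k1 k2 h1 h2) g2) h') g1) h) g"
    by (rule sw_cong, rule sw_cong, rule sw_swap; (intro multilinear)?; simp)
  also have "\<dots> = sw ground (\<lambda>g1 g2. sw ground (\<lambda>a b. sw ground (\<lambda>h1 h2. sw ground (\<lambda>k1 k2.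
      sw ground (\<lambda>c d. ?E a b c d k1 k2 h1 h2) g2) h') h) g1) g"
    by (rule sw_cong, rule sw_swap; (intro multilinear)?; simp)
  also have "\<dots> = sw ground (\<lambda>g1 g2. sw ground (\<lambda>a b. sw ground (\<lambda>h1 h2. sw ground (\<lambda>c d.
      sw ground (\<lambda>k1 k2. ?E a b c d k1 k2 h1 h2) h') g2) h) g1) g"
    by (rule sw_cong, rule sw_cong, rule sw_cong, rule sw_swap; (intro multilinear)?; simp)
  also have "\<dots> = sw ground (\<lambda>g1 g2. sw ground (\<lambda>a b. sw ground (\<lambda>c d. sw ground (\<lambda>h1 h2.
      sw ground (\<lambda>k1 k2. ?E a b c d k1 k2 h1 h2) h') h) g2) g1) g"
    by (rule sw_cong, rule sw_cong, rule sw_swap; (intro multilinear)?; simp)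
  also have "\<dots> = sw ground (\<lambda>a z. sw ground (\<lambda>b w. sw ground (\<lambda>c d. sw ground (\<lambda>h1 h2.
      sw ground (\<lambda>k1 k2. ?E a b c d k1 k2 h1 h2) h') h) w) z) g"
    by (rule sw_assoc; (intro multilinear)?; simp)
  also have "\<dots> = sw ground (\<lambda>a z. sw ground (\<lambda>y d. sw ground (\<lambda>b c. sw ground (\<lambda>h1 h2.
      sw ground (\<lambda>k1 k2. ?E a b c d k1 k2 h1 h2) h') h) y) z) g"
    by (rule sw_cong, rule sw_assoc[symmetric]; (intro multilinear)?; simp)
  also have "\<dots> = sw ground (\<lambda>a z. sw ground (\<lambda>y d. sw ground (\<lambda>b c. sw ground (\<lambda>k1 k2.
      sw ground (\<lambda>h1 h2. ?E a b c d k1 k2 h1 h2) h) h') y) z) g"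
    by (rule sw_cong, rule sw_cong, rule sw_cong, rule sw_swap; (intro multilinear)?; simp)
  also have "\<dots> = sw ground (\<lambda>a z. sw ground (\<lambda>y d. sw ground (\<lambda>k1 k2. sw ground (\<lambda>b c.
      sw ground (\<lambda>h1 h2. ?E a b c d k1 k2 h1 h2) h) y) h') z) g"
    by (rule sw_cong, rule sw_cong, rule sw_swap; (intro multilinear)?; simp)
  also have "\<dots> = sw ground (\<lambda>a z. sw ground (\<lambda>y d. sw ground (\<lambda>k1 k2. R a k1 * Q h y * R k2 d) h') z) g"
  proof -
    have "sw ground (\<lambda>b c. sw ground (\<lambda>h1 h2. ?E a b c d k1 k2 h1 h2) h) y = R a k1 * Q h y * R k2 d"
      for a d k1 k2 y
    proof -
      have "sw ground (\<lambda>b c. sw ground (\<lambda>h1 h2. ?E a b c d k1 k2 h1 h2) h) y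
          = sw ground (\<lambda>b c. R a k1 * sw ground (\<lambda>h1 h2. R b h1 * R h2 c) h * R k2 d) y"
        by (rule sw_cong, subst sw_times_right, (intro multilinear)?, subst sw_times_left;
            (intro multilinear)?; simp)
      also have "\<dots> = R a k1 * Q h y * R k2 d"
        unfolding Qmap_def
        by (subst sw_times_right, (intro multilinear)?; (subst sw_times_left)?;
            (intro multilinear)?; simp)
      finally show ?thesis .
    qed
    then show ?thesis by simp
  qed
  finally show ?thesis .
qed

text \<open>The scalar \<open>c\<close> stands for a second value of \<open>R\<close> on legs that
  quasi-commutativity leaves alone.\<close>

lemma R_comm_scaled: "sw H (\<lambda>a1 a2. sw H (\<lambda>b1 b2. hscale C (c * R a2 b2) (b1 * a1)) b) a
    = sw H (\<lambda>a1 a2. sw H (\<lambda>b1 b2. hscale C (c * R a1 b1) (a2 * b2)) b) a"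
proof -
  have "hscale C c (sw H (\<lambda>a1 a2. sw H (\<lambda>b1 b2. hscale C (R (f a1 a2) (f b1 b2)) (k a1 a2 b1 b2)) b) a)
      = sw H (\<lambda>a1 a2. sw H (\<lambda>b1 b2. hscale C (c * R (f a1 a2) (f b1 b2)) (k a1 a2 b1 b2)) b) a"
    if l: "\<And>a1 a2. bil H (\<lambda>b1 b2. hscale C (R (f a1 a2) (f b1 b2)) (k a1 a2 b1 b2))"
      "\<And>b1 b2. bil H (\<lambda>a1 a2. hscale C (R (f a1 a2) (f b1 b2)) (k a1 a2 b1 b2))" for f k
  proof -
    have "hscale C c (sw H (\<lambda>a1 a2. sw H (\<lambda>b1 b2. hscale C (R (f a1 a2) (f b1 b2)) (k a1 a2 b1 b2)) b) a)
      = sw H (\<lambda>a1 a2. hscale C c (sw H (\<lambda>b1 b2. hscale C (R (f a1 a2) (f b1 b2)) (k a1 a2 b1 b2)) b)) a"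
      by (rule sw_map[where f = "hscale C c"]; (intro multilinear bilD1[OF l(1) vlinear_ident]
        bilD2[OF l(1) vlinear_ident] bilD1[OF l(2) vlinear_ident] bilD2[OF l(2) vlinear_ident])?; simp)
    also have "\<dots> = sw H (\<lambda>a1 a2. sw H (\<lambda>b1 b2. hscale C c (hscale C (R (f a1 a2) (f b1 b2)) (k a1 a2 b1 b2))) b) a"
      by (rule sw_cong, rule sw_map[where f = "hscale C c"]; (intro multilinear l)?; simp add: l)
    finally show ?thesis by simp
  qed
  note * = this
  have "hscale C c (sw H (\<lambda>a1 a2. sw H (\<lambda>b1 b2. hscale C (R a2 b2) (b1 * a1)) b) a)
      = sw H (\<lambda>a1 a2. sw H (\<lambda>b1 b2. hscale C (c * R a2 b2) (b1 * a1)) b) a"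
    by (rule *; intro multilinear)
  moreover have "hscale C c (sw H (\<lambda>a1 a2. sw H (\<lambda>b1 b2. hscale C (R a1 b1) (a2 * b2)) b) a)
      = sw H (\<lambda>a1 a2. sw H (\<lambda>b1 b2. hscale C (c * R a1 b1) (a2 * b2)) b) a"
    by (rule *; intro multilinear)
  ultimately show ?thesis by (simp add: R_comm)
qed

text \<open>Quasi-commutativity is used twice. Moving the products past \<open>R g2 h2\<close> turns
  \<open>h1 * g1\<close> into \<open>g2 * h2\<close>; moving them past \<open>R h3 g3\<close>, with
  the roles of \<open>g\<close> and \<open>h\<close> exchanged, restores the original order of the
  factors. The two values of \<open>R\<close> together are \<open>Q\<close>.\<close>

lemma Q_comm: "sw H (\<lambda>g1 g2. sw H (\<lambda>h1 h2. hscale C (Q h2 g2) (h1 * g1)) h) g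
    = sw H (\<lambda>g1 g2. sw H (\<lambda>h1 h2. hscale C (Q h1 g1) (h2 * g2)) h) g"
proof -
  have expand: "hscale C (Q y x) z = sw H (\<lambda>b c. sw H (\<lambda>b' c'. hscale C (R b b' * R c' c) z) y) x" for x y z
    unfolding Qmap_def
    by (subst sw_map[where f = "\<lambda>t. hscale C t z" and Y = H]; (intro multilinear)?; simp?)
       (rule sw_cong, rule sw_map[where f = "\<lambda>t. hscale C t z"]; (intro multilinear)?; simp)
  have "sw H (\<lambda>g1 g2. sw H (\<lambda>h1 h2. hscale C (Q h2 g2) (h1 * g1)) h) g
      = sw H (\<lambda>g1 x. sw H (\<lambda>h1 y. sw H (\<lambda>g2 g3. sw H (\<lambda>h2 h3. hscale C (R g2 h2 * R h3 g3) (h1 * g1)) y) x) h) g"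
    by (simp add: expand)
  also have "\<dots> = sw H (\<lambda>w g3. sw H (\<lambda>v h3. sw H (\<lambda>g1 g2. sw H (\<lambda>h1 h2.
      hscale C (R g2 h2 * R h3 g3) (h1 * g1)) v) w) h) g"
    by (rule sw_assoc_pair; (intro multilinear)?; simp)
  also have "\<dots> = sw H (\<lambda>w g3. sw H (\<lambda>v h3. sw H (\<lambda>g1 g2. sw H (\<lambda>h1 h2.
      hscale C (R h3 g3 * R g2 h2) (h1 * g1)) v) w) h) g" by (simp add: mult.commute)
  also have "\<dots> = sw H (\<lambda>w g3. sw H (\<lambda>v h3. sw H (\<lambda>g1 g2. sw H (\<lambda>h1 h2.
      hscale C (R h3 g3 * R g1 h1) (g2 * h2)) v) w) h) g"
    by (rule sw_cong, rule sw_cong, rule R_comm_scaled)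
  also have "\<dots> = sw H (\<lambda>g1 x. sw H (\<lambda>h1 y. sw H (\<lambda>g2 g3. sw H (\<lambda>h2 h3.
      hscale C (R h3 g3 * R g1 h1) (g2 * h2)) y) x) h) g"
    by (rule sw_assoc_pair[symmetric]; (intro multilinear)?; simp)
  also have "\<dots> = sw H (\<lambda>g1 x. sw H (\<lambda>h1 y. sw H (\<lambda>h2 h3. sw H (\<lambda>g2 g3.
      hscale C (R g1 h1 * R h3 g3) (g2 * h2)) x) y) h) g"
    by (rule sw_cong, rule sw_cong, subst sw_swap; (intro multilinear)?; simp add: mult.commute)
  also have "\<dots> = sw H (\<lambda>g1 x. sw H (\<lambda>h1 y. sw H (\<lambda>h2 h3. sw H (\<lambda>g2 g3.
      hscale C (R g1 h1 * R h2 g2) (h3 * g3)) x) y) h) g"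
    by (rule sw_cong, rule sw_cong, rule R_comm_scaled)
  also have "\<dots> = sw H (\<lambda>g1 x. sw H (\<lambda>h1 y. sw H (\<lambda>g2 g3. sw H (\<lambda>h2 h3.
      hscale C (R g1 h1 * R h2 g2) (h3 * g3)) y) x) h) g"
    by (rule sw_cong, rule sw_cong, rule sw_swap; (intro multilinear)?; simp)
  also have "\<dots> = sw H (\<lambda>w g3. sw H (\<lambda>v h3. sw H (\<lambda>g1 g2. sw H (\<lambda>h1 h2.
      hscale C (R g1 h1 * R h2 g2) (h3 * g3)) v) w) h) g"
    by (rule sw_assoc_pair; (intro multilinear)?; simp)
  also have "\<dots> = sw H (\<lambda>g1 g2. sw H (\<lambda>h1 h2. hscale C (Q h1 g1) (h2 * g2)) h) g"
    by (simp add: expand)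
  finally show ?thesis .
qed

text \<open>\<open>Q\<close> intertwines \<open>Ad\<close> with the coadjoint coaction:
  \<open>\<langle>Q(h), g\<^sub>(\<^sub>2\<^sub>)\<rangle> g\<^sub>(\<^sub>1\<^sub>) S g\<^sub>(\<^sub>3\<^sub>) = \<langle>Q(h\<^sub>(\<^sub>2\<^sub>)), g\<rangle> S(h\<^sub>(\<^sub>1\<^sub>)) h\<^sub>(\<^sub>3\<^sub>)\<close>.\<close>

lemma Q_Ad: "sw H (\<lambda>g1 x. sw H (\<lambda>g2 g3. hscale C (Q h g2) (g1 * S g3)) x) g
    = sw H (\<lambda>h1 y. sw H (\<lambda>h2 h3. hscale C (Q h2 g) (S h1 * h3)) y) h"
proof -
  have pull: "s * sw H F x * t = sw H (\<lambda>a b. s * F a b * t) x" if "bil H F" for s t F x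
    by (rule sw_map[where f = "\<lambda>u. s * u * t"]; (intro multilinear that)?; simp add: that)
  have pull2: "s * sw H (\<lambda>g1 g2. sw H (\<lambda>h1 h2. F g1 g2 h1 h2) y) x * t
      = sw H (\<lambda>g1 g2. sw H (\<lambda>h1 h2. s * F g1 g2 h1 h2 * t) y) x"
    if "\<And>g1 g2. bil H (F g1 g2)" "bil H (\<lambda>g1 g2. sw H (\<lambda>h1 h2. F g1 g2 h1 h2) y)" for s t F x y
    by (simp add: pull that)
  \<comment> \<open>\<open>Q_comm\<close> for the inner legs is multiplied by the antipode of the
    first leg of \<open>h\<close> on the left and of the last leg of \<open>g\<close> on the right.
    One side then contracts at \<open>S h0 * h1\<close>, the other at
    \<open>g2 * S g4\<close>.\<close>
  have "sw H (\<lambda>h0 y. sw H (\<lambda>x g4. S h0 * sw H (\<lambda>g1 g2. sw H (\<lambda>h1 h2. hscale C (Q h2 g2) (h1 * g1)) y) x * S g4) g) h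
      = sw H (\<lambda>h0 y. sw H (\<lambda>x g4. S h0 * sw H (\<lambda>g1 g2. sw H (\<lambda>h1 h2. hscale C (Q h1 g1) (h2 * g2)) y) x * S g4) g) h"
    (is "?L = ?R") by (simp add: Q_comm)
  have "?L = sw H (\<lambda>h0 y. sw H (\<lambda>x g4. sw H (\<lambda>g1 g2. sw H (\<lambda>h1 h2.
      S h0 * hscale C (Q h2 g2) (h1 * g1) * S g4) y) x) g) h"
    by (rule sw_cong, rule sw_cong, rule pull2; (intro multilinear)?; simp)
  also have "\<dots> = sw H (\<lambda>h0 y. sw H (\<lambda>x g4. sw H (\<lambda>g1 g2. sw H (\<lambda>h1 h2.
      hscale C (Q h2 g2) ((S h0 * h1) * g1 * S g4)) y) x) g) h"
    by (simp add: mult.assoc)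
  also have "\<dots> = sw H (\<lambda>h0 y. sw H (\<lambda>x g4. sw H (\<lambda>h1 h2. sw H (\<lambda>g1 g2.
      hscale C (Q h2 g2) ((S h0 * h1) * g1 * S g4)) x) y) g) h"
    by (rule sw_cong, rule sw_cong, rule sw_swap; (intro multilinear)?; simp)
  also have "\<dots> = sw H (\<lambda>h0 y. sw H (\<lambda>h1 h2. sw H (\<lambda>x g4. sw H (\<lambda>g1 g2.
      hscale C (Q h2 g2) ((S h0 * h1) * g1 * S g4)) x) g) y) h"
    by (rule sw_cong, rule sw_swap; (intro multilinear)?; simp)
  also have "\<dots> = sw H (\<lambda>x g4. sw H (\<lambda>g1 g2. hscale C (Q h g2) (1 * g1 * S g4)) x) g"
    by (rule sw_cancel_left[OF cancels_antip_left, where F = "\<lambda>u h2. sw H (\<lambda>x g4. sw H (\<lambda>g1 g2.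
      hscale C (Q h2 g2) (u * g1 * S g4)) x) g"]; (intro multilinear)?; simp)
  also have "\<dots> = sw H (\<lambda>g1 x. sw H (\<lambda>g2 g3. hscale C (Q h g2) (1 * g1 * S g3)) x) g"
    by (rule sw_assoc; (intro multilinear)?; simp)
  finally have l: "?L = sw H (\<lambda>g1 x. sw H (\<lambda>g2 g3. hscale C (Q h g2) (g1 * S g3)) x) g" by simp
  have "?R = sw H (\<lambda>h0 y. sw H (\<lambda>x g4. sw H (\<lambda>g1 g2. sw H (\<lambda>h1 h2.
      S h0 * hscale C (Q h1 g1) (h2 * g2) * S g4) y) x) g) h"
    by (rule sw_cong, rule sw_cong, rule pull2; (intro multilinear)?; simp)
  also have "\<dots> = sw H (\<lambda>h0 y. sw H (\<lambda>x g4. sw H (\<lambda>g1 g2. sw H (\<lambda>h1 h2.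
      hscale C (Q h1 g1) (S h0 * h2 * (g2 * S g4))) y) x) g) h"
    by (simp add: mult.assoc)
  also have "\<dots> = sw H (\<lambda>h0 y. sw H (\<lambda>g1 z. sw H (\<lambda>g2 g4. sw H (\<lambda>h1 h2.
      hscale C (Q h1 g1) (S h0 * h2 * (g2 * S g4))) y) z) g) h"
    by (rule sw_cong, rule sw_assoc; (intro multilinear)?; simp)
  also have "\<dots> = sw H (\<lambda>h0 y. sw H (\<lambda>h1 h2. hscale C (Q h1 g) (S h0 * h2 * 1)) y) h"
    by (rule sw_cong, rule sw_cancel_right[OF cancels_antip_right, where F = "\<lambda>g1 u. sw H (\<lambda>h1 h2.
      hscale C (Q h1 g1) (S _ * h2 * u)) _"]; (intro multilinear)?; simp)
  finally show ?thesis using l \<open>?L = ?R\<close> by simp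
qed

section \<open>Coordinates in \<open>End(W)\<close>\<close>

lemma sum_W: "finite I \<Longrightarrow> (\<Sum>i\<in>I. f i) = vsum W f I"
  by (simp add: Wsp_def vsum_space_of vector_space_W)

lemma EndW_carr: "f \<in> carr (EndW C) \<longleftrightarrow> vlinear W W f"
  by (simp add: EndW_def vhom_simps)

lemma is_vspace_EndW [simp]: "is_vspace (EndW C)"
  by (simp add: EndW_def is_vspace_vhom)

definition munit :: "'w \<Rightarrow> 'w \<Rightarrow> 'w \<Rightarrow> 'w"
  where "munit \<alpha> \<beta> w = wscale C (coord \<beta> w) \<alpha>"

lemma munit_carr [simp]: "munit \<alpha> \<beta> \<in> carr (EndW C)"
  using vlinear_scale_comp[OF is_vspace_W _ lin_coord, of \<alpha> \<beta>]
  by (simp add: EndW_carr munit_def[abs_def])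

lemma EndW_simps: "vplus (EndW C) f g = (\<lambda>w. f w + g w)" "vzero (EndW C) = (\<lambda>w. 0)"
    "vscale (EndW C) c f = (\<lambda>w. wscale C c (f w))"
  by (simp_all add: EndW_def vhom_simps restrict_def)

lemma vsum_EndW:
  assumes "\<And>i. i \<in> I \<Longrightarrow> f i \<in> carr (EndW C)" "finite I"
  shows "vsum (EndW C) f I w = (\<Sum>i\<in>I. f i w)"
proof -
  have "vlinear (EndW C) W (\<lambda>f. f w)"
    unfolding EndW_def by (rule vlinear_eval) simp
  from vlinear_vsum_apply[OF is_vspace_EndW is_vspace_W this, of I f] show ?thesis
    using assms by (simp add: sum_W)
qed

lemma rhoQ_eq: "rhoQ C h = vsum (EndW C)
    (\<lambda>i. vscale (EndW C) (Q h (rho C (fst i) (snd i))) (munit (fst i) (snd i))) (B \<times> B)"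
proof
  fix w
  have s: "wscale C (c * d) v = wscale C c (wscale C d v)" for c d v
    using vscale_vscale[OF is_vspace_W, of v c d] by simp
  have "vsum (EndW C) (\<lambda>i. vscale (EndW C) (Q h (rho C (fst i) (snd i))) (munit (fst i) (snd i))) (B \<times> B) w
      = (\<Sum>i\<in>B \<times> B. vscale (EndW C) (Q h (rho C (fst i) (snd i))) (munit (fst i) (snd i)) w)"
    by (rule vsum_EndW) simp_all
  also have "\<dots> = rhoQ C h w"
    by (simp add: rhoQ_def rhoW_def sum.cartesian_product EndW_simps munit_def s case_prod_beta)
  finally show "rhoQ C h w = vsum (EndW C)
    (\<lambda>i. vscale (EndW C) (Q h (rho C (fst i) (snd i))) (munit (fst i) (snd i))) (B \<times> B) w" by simp
qed

lemma lin_rhoQ: "vlinear H (EndW C) (rhoQ C)"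
proof -
  have "vlinear H (EndW C) (\<lambda>h. vsum (EndW C)
      (\<lambda>i. vscale (EndW C) (Q h (rho C (fst i) (snd i))) (munit (fst i) (snd i))) (B \<times> B))"
    by (rule vlinear_sum; (intro multilinear)?; simp)
  then show ?thesis unfolding rhoQ_eq[abs_def] .
qed

lemma coord_rhoQ:
  assumes "\<alpha> \<in> B" "\<beta> \<in> B"
  shows "coord \<alpha> (rhoQ C h \<beta>) = Q h (rho C \<alpha> \<beta>)"
proof -
  have "rhoQ C h \<beta> = (\<Sum>\<gamma>\<in>B. \<Sum>\<delta>\<in>B. if \<delta> = \<beta> then wscale C (Q h (rho C \<gamma> \<delta>)) \<gamma> else 0)"
    unfolding rhoQ_def rhoW_def using vscale_0[OF is_vspace_W]
    by (intro sum.cong refl) (auto simp: coord_basis assms)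
  also have "\<dots> = vsum W (\<lambda>\<gamma>. wscale C (Q h (rho C \<gamma> \<beta>)) \<gamma>) B"
    using assms by (simp add: sum_W)
  finally have "coord \<alpha> (rhoQ C h \<beta>) = vsum ground (\<lambda>\<gamma>. coord \<alpha> (wscale C (Q h (rho C \<gamma> \<beta>)) \<gamma>)) B"
    using vlinear_vsum_apply[OF is_vspace_W is_vspace_ground lin_coord, of B] by simp
  also have "\<dots> = (\<Sum>\<gamma>\<in>B. Q h (rho C \<gamma> \<beta>) * coord \<alpha> \<gamma>)"
    using vlinear_vscale[OF lin_coord] by (simp add: vsum_ground)
  also have "\<dots> = (\<Sum>\<gamma>\<in>B. if \<gamma> = \<alpha> then Q h (rho C \<gamma> \<beta>) else 0)"
    by (rule sum.cong) (auto simp: coord_basis)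
  finally show ?thesis using assms by simp
qed

text \<open>\<open>Q 1\<close> is the counit, and the counits of the matrix coefficients form the
  identity matrix.\<close>

lemma rhoQ_one: "rhoQ C 1 = id"
proof
  fix w
  have "rhoQ C 1 w = (\<Sum>\<alpha>\<in>B. \<Sum>\<beta>\<in>B. if \<beta> = \<alpha> then wscale C (coord \<alpha> w) \<alpha> else 0)"
    unfolding rhoQ_def rhoW_def using vscale_0[OF is_vspace_W]
    by (intro sum.cong refl) (auto simp: Q_one counit_rho)
  also have "\<dots> = w" by (simp add: sum_coord)
  finally show "rhoQ C 1 w = id w" by simp
qed

section \<open>The right ideal \<open>QH C\<close> and its stability under \<open>Ad\<close>\<close>

lemma QH_iff: "h \<in> QH C \<longleftrightarrow> \<epsilon> h = 0 \<and> (\<forall>\<alpha>\<in>B. \<forall>\<beta>\<in>B. Q h (rho C \<alpha> \<beta>) = 0)"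
proof
  assume "h \<in> QH C"
  then have "\<epsilon> h = 0" "rhoQ C h = (\<lambda>w. 0)" by (auto simp: QH_def ker_counit_def EndW_simps)
  moreover have "coord \<alpha> 0 = 0" for \<alpha>
    using vlinear_vzero[OF is_vspace_W _ lin_coord] by simp
  ultimately show "\<epsilon> h = 0 \<and> (\<forall>\<alpha>\<in>B. \<forall>\<beta>\<in>B. Q h (rho C \<alpha> \<beta>) = 0)"
    by (auto simp flip: coord_rhoQ)
next
  assume h: "\<epsilon> h = 0 \<and> (\<forall>\<alpha>\<in>B. \<forall>\<beta>\<in>B. Q h (rho C \<alpha> \<beta>) = 0)"
  then have "rhoQ C h = (\<lambda>w. 0)"
    using vscale_0[OF is_vspace_W] by (auto simp: rhoQ_def rhoW_def)
  with h show "h \<in> QH C" by (simp add: QH_def ker_counit_def EndW_simps)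
qed

text \<open>In \<open>Q_mult\<close> at a matrix coefficient, every summand contains a factor
  \<open>Q q (rho C \<gamma> \<delta>)\<close>, which is zero.\<close>

lemma QH_mult: "q \<in> QH C \<Longrightarrow> q * h \<in> QH C"
proof -
  assume q: "q \<in> QH C"
  have "Q (q * h) (rho C \<alpha> \<beta>) = 0" if "\<alpha> \<in> B" "\<beta> \<in> B" for \<alpha> \<beta>
  proof -
    have "Q (q * h) (rho C \<alpha> \<beta>) = vsum ground (\<lambda>\<gamma>. vsum ground (\<lambda>\<delta>.
        sw ground (\<lambda>k1 k2. R (rho C \<alpha> \<gamma>) k1 * Q q (rho C \<gamma> \<delta>) * R k2 (rho C \<delta> \<beta>)) h) B) B"
      unfolding Q_mult
      by (subst sw_rho; (intro multilinear that)?; simp?)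
         (rule vsum_cong, rule sw_rho; (intro multilinear that)?; simp add: that)
    also have "\<dots> = vsum ground (\<lambda>\<gamma>. vsum ground (\<lambda>\<delta>. 0) B) B"
    proof (rule vsum_cong, rule vsum_cong)
      fix \<gamma> \<delta> assume "\<gamma> \<in> B" "\<delta> \<in> B"
      then have "Q q (rho C \<gamma> \<delta>) = 0" using q by (simp add: QH_iff)
      moreover have "sw ground (\<lambda>k1 k2. 0 * R k1 k2) h = 0"
        by (subst sw_times_left; (intro multilinear)?; simp)
      ultimately show "sw ground (\<lambda>k1 k2. R (rho C \<alpha> \<gamma>) k1 * Q q (rho C \<gamma> \<delta>) * R k2 (rho C \<delta> \<beta>)) h = 0"
        by simp
    qed
    finally show ?thesis by (simp add: vsum_ground)
  qed
  with q show "q * h \<in> QH C" by (auto simp: QH_iff)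
qed

lemma vsubspace_QH: "vsubspace H (QH C)"
proof -
  have *: "vlinear H ground (\<lambda>h. Q h g)" for g by (intro multilinear)
  show ?thesis
    using vlinear_vplus[OF *] vlinear_vscale[OF *] vlinear_vzero[OF _ _ *] vlinear_vzero[OF _ _ lin_counit]
    by (auto simp: vsubspace_def QH_iff)
qed

lemma counit_QH: "q \<in> QH C \<Longrightarrow> \<epsilon> q = 0"
  by (simp add: QH_iff)

text \<open>Preimages of the matrix units; modulo \<open>Q\<^sub>H\<close> they form a basis of \<open>ker \<epsilon>\<close>.\<close>

definition hunit :: "'w \<times> 'w \<Rightarrow> 'h"
  where "hunit i = (SOME h. h \<in> ker_counit C \<and> rhoQ C h = munit (fst i) (snd i))"

lemma hunit: "\<epsilon> (hunit i) = 0" "rhoQ C (hunit i) = munit (fst i) (snd i)"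
proof -
  have "munit (fst i) (snd i) \<in> rhoQ C ` ker_counit C" using surj by simp
  then have "\<exists>h. h \<in> ker_counit C \<and> rhoQ C h = munit (fst i) (snd i)" by force
  from someI_ex[OF this] show "\<epsilon> (hunit i) = 0" "rhoQ C (hunit i) = munit (fst i) (snd i)"
    by (auto simp: hunit_def ker_counit_def)
qed

text \<open>With these coefficients, \<open>h - \<epsilon>(h) 1\<close> differs from the combination
  of the \<open>hunit i\<close> by an element of \<open>QH C\<close>. The subtracted product of
  counits is the matrix entry of \<open>rhoQ C (\<epsilon>(h) 1)\<close>, a multiple of the
  identity.\<close>

lemma expand_mod_QH:
  assumes X: "is_vspace X" and f: "vlinear H X f" and f1: "f 1 = vzero X"
    and fq: "\<And>q. q \<in> QH C \<Longrightarrow> f q = vzero X"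
  shows "f h = vsum X (\<lambda>i. vscale X (Q h (rho C (fst i) (snd i)) - \<epsilon> h * \<epsilon> (rho C (fst i) (snd i)))
    (f (hunit i))) (B \<times> B)"
proof -
  let ?c = "\<lambda>i. Q h (rho C (fst i) (snd i)) - \<epsilon> h * \<epsilon> (rho C (fst i) (snd i))"
  let ?s = "vsum H (\<lambda>i. hscale C (?c i) (hunit i)) (B \<times> B)"
  let ?h = "h - hscale C (\<epsilon> h) 1"
  have lQ: "vlinear H ground (\<lambda>h. Q h g)" for g by (intro multilinear)
  have "rhoQ C ?h = vsum (EndW C) (\<lambda>i. vscale (EndW C) (?c i) (munit (fst i) (snd i))) (B \<times> B)"
    unfolding rhoQ_eq
    using vlinear_vminus[OF _ lQ, of h "hscale C (\<epsilon> h) 1"] vlinear_vscale[OF lQ, of 1 "\<epsilon> h"]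
    by (auto intro!: vsum_cong simp: Q_one)
  moreover have "rhoQ C ?s = vsum (EndW C) (\<lambda>i. rhoQ C (hscale C (?c i) (hunit i))) (B \<times> B)"
    by (rule vlinear_vsum_apply[OF _ _ lin_rhoQ]) simp_all
  ultimately have "rhoQ C ?h = rhoQ C ?s"
    using vlinear_vscale[OF lin_rhoQ] by (simp add: hunit)
  then have "rhoQ C (?h - ?s) = vzero (EndW C)"
    using vlinear_vminus[OF _ lin_rhoQ, of ?h ?s] vlinear_carr[OF lin_rhoQ, of ?s] by simp
  moreover have "\<epsilon> ?s = vsum ground (\<lambda>i. \<epsilon> (hscale C (?c i) (hunit i))) (B \<times> B)"
    by (rule vlinear_vsum_apply[OF _ _ lin_counit]) simp_all
  then have "\<epsilon> (?h - ?s) = 0" by (simp add: hunit vsum_ground)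
  ultimately have "?h - ?s \<in> QH C" by (simp add: QH_def ker_counit_def)
  then have "vminus X (f ?h) (f ?s) = vzero X"
    using vlinear_vminus[OF _ f, of ?h ?s] fq by simp
  then have "f ?h = f ?s" using X vlinear_carr[OF f] by simp
  moreover have "f ?h = f h"
    using vlinear_vminus[OF _ f, of h "hscale C (\<epsilon> h) 1"] vlinear_vscale[OF f, of 1 "\<epsilon> h"] f1 X
      vlinear_carr[OF f, of h] by simp
  moreover have "f ?s = vsum X (\<lambda>i. f (hscale C (?c i) (hunit i))) (B \<times> B)"
    by (rule vlinear_vsum_apply[OF _ X f]) simp_all
  ultimately show ?thesis using vlinear_vscale[OF f] by simp
qed

text \<open>\<open>F\<close> is a test map for the claim that \<open>Ad(q)\<close> lies in
  \<open>Q_H \<otimes> H\<close>. Expanding its first argument by \<open>expand_mod_QH\<close> moves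
  all dependence on \<open>q\<close> into the second argument, as \<open>c_i(q2) S(q1) q3\<close>.
  The \<open>Q\<close> part of this element vanishes by \<open>Q_Ad\<close>, after which
  \<open>q\<close> enters only through \<open>Q q\<close> on matrix coefficients; the counit part
  vanishes because \<open>S(q1) q2 = \<epsilon>(q) 1 = 0\<close>.\<close>

lemma Ad_QH:
  assumes X: "is_vspace X" and F: "bil X F" and F1: "\<And>b. F 1 b = vzero X"
    and Fq: "\<And>q b. q \<in> QH C \<Longrightarrow> F q b = vzero X" and q: "q \<in> QH C"
  shows "sw X (\<lambda>a y. sw X (\<lambda>b c. F b (S a * c)) y) q = vzero X"
proof -
  note lin = multilinear bilD1[OF F] bilD2[OF F]
  have [simp]: "F a b \<in> carr X" for a b by (rule bil_carr[OF F])
  let ?\<rho> = "\<lambda>i. rho C (fst i) (snd i)"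
  let ?c = "\<lambda>i b. Q b (?\<rho> i) - \<epsilon> b * \<epsilon> (?\<rho> i)"
  have lc: "vlinear H ground (?c i)" for i
    using vlinear_minus[of ground H "\<lambda>b. Q b (?\<rho> i)" "\<lambda>b. \<epsilon> b * \<epsilon> (?\<rho> i)"]
    by (simp add: multilinear vlinear_ident)
  note lin' = lin vlinear_compose[OF lc]
  have e: "F b x = vsum X (\<lambda>i. vscale X (?c i b) (F (hunit i) x)) (B \<times> B)" for b x
    by (rule expand_mod_QH[OF X bilD1[OF F vlinear_ident]]) (simp_all add: F1 Fq)
  have "sw X (\<lambda>a y. sw X (\<lambda>b c. F b (S a * c)) y) q
      = sw X (\<lambda>a y. sw X (\<lambda>b c. vsum X (\<lambda>i. vscale X (?c i b) (F (hunit i) (S a * c))) (B \<times> B)) y) q"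
    by (rule sw_cong, rule sw_cong, rule e)
  also have "\<dots> = sw X (\<lambda>a y. vsum X (\<lambda>i. sw X (\<lambda>b c. vscale X (?c i b) (F (hunit i) (S a * c))) y) (B \<times> B)) q"
    by (rule sw_cong, rule sw_vsum[OF X]; (intro lin')?; simp add: X)
  also have "\<dots> = vsum X (\<lambda>i. sw X (\<lambda>a y. sw X (\<lambda>b c. vscale X (?c i b) (F (hunit i) (S a * c))) y) q) (B \<times> B)"
    by (rule sw_vsum[OF X]; (intro lin')?; simp add: X)
  also have "\<dots> = vsum X (\<lambda>i. vzero X) (B \<times> B)"
  proof (rule vsum_cong)
    fix i assume i: "i \<in> B \<times> B"
    have pull: "sw X (\<lambda>a y. sw X (\<lambda>b c. vscale X (f b) (F (hunit i) (S a * c))) y) q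
        = F (hunit i) (sw H (\<lambda>a y. sw H (\<lambda>b c. hscale C (f b) (S a * c)) y) q)"
      if f: "vlinear H ground f" for f
    proof -
      note linf = lin vlinear_compose[OF f]
      have "F (hunit i) (sw H (\<lambda>a y. sw H (\<lambda>b c. hscale C (f b) (S a * c)) y) q)
          = sw X (\<lambda>a y. F (hunit i) (sw H (\<lambda>b c. hscale C (f b) (S a * c)) y)) q"
        by (rule sw_map[OF _ X]; (intro linf)?; simp add: X)
      also have "\<dots> = sw X (\<lambda>a y. sw X (\<lambda>b c. F (hunit i) (hscale C (f b) (S a * c))) y) q"
        by (rule sw_cong, rule sw_map[OF _ X]; (intro linf)?; simp add: X)
      finally show ?thesis using vlinear_vscale[OF bilD2[OF F vlinear_ident]] by simp
    qed
    have "sw H (\<lambda>a y. sw H (\<lambda>b c. hscale C (?c i b) (S a * c)) y) q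
        = sw H (\<lambda>a y. vminus H (sw H (\<lambda>b c. hscale C (Q b (?\<rho> i)) (S a * c)) y)
            (sw H (\<lambda>b c. hscale C (\<epsilon> b * \<epsilon> (?\<rho> i)) (S a * c)) y)) q"
    proof (rule sw_cong)
      fix a y
      have d: "hscale C (s - t) z = vminus H (hscale C s z) (hscale C t z)" for s t z
        by (simp add: hscale_diff_left)
      show "sw H (\<lambda>b c. hscale C (?c i b) (S a * c)) y
        = vminus H (sw H (\<lambda>b c. hscale C (Q b (?\<rho> i)) (S a * c)) y)
            (sw H (\<lambda>b c. hscale C (\<epsilon> b * \<epsilon> (?\<rho> i)) (S a * c)) y)"
        unfolding d by (rule sw_vminus; (intro multilinear)?; simp)
    qed
    also have "\<dots> = vminus H (sw H (\<lambda>a y. sw H (\<lambda>b c. hscale C (Q b (?\<rho> i)) (S a * c)) y) q)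
        (sw H (\<lambda>a y. sw H (\<lambda>b c. hscale C (\<epsilon> b * \<epsilon> (?\<rho> i)) (S a * c)) y) q)"
      by (rule sw_vminus; (intro multilinear)?; simp)
    also have "sw H (\<lambda>a y. sw H (\<lambda>b c. hscale C (Q b (?\<rho> i)) (S a * c)) y) q = 0"
    proof -
      have "sw H (\<lambda>a y. sw H (\<lambda>b c. hscale C (Q b (?\<rho> i)) (S a * c)) y) q
          = sw H (\<lambda>g1 x. sw H (\<lambda>g2 g3. hscale C (Q q g2) (g1 * S g3)) x) (?\<rho> i)"
        by (rule Q_Ad[symmetric])
      also have "\<dots> = vsum H (\<lambda>\<gamma>. vsum H (\<lambda>\<delta>. hscale C (Q q (rho C \<gamma> \<delta>))
          (rho C (fst i) \<gamma> * S (rho C \<delta> (snd i)))) B) B"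
        using i by (subst sw_rho; (intro multilinear)?; auto?)
           (rule vsum_cong, rule sw_rho; (intro multilinear)?; auto)
      also have "\<dots> = vsum H (\<lambda>\<gamma>. vsum H (\<lambda>\<delta>. 0) B) B"
        using q by (intro vsum_cong) (simp add: QH_iff)
      finally show ?thesis by (simp add: Hsp_def vsum_space_of vector_space_H)
    qed
    also have "sw H (\<lambda>a y. sw H (\<lambda>b c. hscale C (\<epsilon> b * \<epsilon> (?\<rho> i)) (S a * c)) y) q = 0"
    proof -
      have "sw H (\<lambda>b c. hscale C (\<epsilon> b * \<epsilon> (?\<rho> i)) (S a * c)) y = hscale C (\<epsilon> (?\<rho> i)) (S a * y)" for a y
      proof -
        have "sw H (\<lambda>b c. vscale H (\<epsilon> b) (hscale C (\<epsilon> (?\<rho> i)) (S a * c))) y = hscale C (\<epsilon> (?\<rho> i)) (S a * y)"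
          by (rule sw_counit_left; (intro multilinear)?; simp)
        then show ?thesis by simp
      qed
      moreover have "sw H (\<lambda>a y. hscale C (\<epsilon> (?\<rho> i)) (S a * y)) q = vscale H (\<epsilon> q) (hscale C (\<epsilon> (?\<rho> i)) 1)"
        by (rule sw_cancel[OF cancels_antip_left]; (intro multilinear)?; simp)
      ultimately show ?thesis using q by (simp add: counit_QH)
    qed
    finally have "sw H (\<lambda>a y. sw H (\<lambda>b c. hscale C (?c i b) (S a * c)) y) q = 0" by simp
    with pull[OF lc, of i] show "sw X (\<lambda>a y. sw X (\<lambda>b c. vscale X (?c i b) (F (hunit i) (S a * c))) y) q = vzero X"
      using vlinear_vzero[OF _ X bilD2[OF F vlinear_ident]] by simp
  qed
  also have "\<dots> = vzero X"
    using vsum_mono_neutral[OF X _ empty_subsetI, of "B \<times> B" "\<lambda>i. vzero X"] X by simp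
  finally show ?thesis .
qed

section \<open>The space \<open>\<Omega>\<^sub>0\<close> and the braided-Killing form\<close>

abbreviation "O0 \<equiv> Omega0 C"
abbreviation "O00 \<equiv> tensor O0 O0"
abbreviation "p \<equiv> tproj0 C"
abbreviation "Kv \<equiv> vsub H (ker_counit C)"

lemma vsubspace_ker_counit: "vsubspace H (ker_counit C)"
  using vsubspace_kernel[OF is_vspace_H is_vspace_ground lin_counit] by (simp add: ker_counit_def)

lemma is_vspace_Kv: "is_vspace Kv"
  by (intro is_vspace_vsub vsubspace_ker_counit) simp

lemma vsubspace_Kv_QH: "vsubspace Kv (QH C)"
  by (rule vsubspace_vsub[OF vsubspace_QH]) (auto simp: QH_def)

lemma is_vspace_O0 [simp]: "is_vspace O0"
  unfolding Omega0_def by (rule is_vspace_quot[OF is_vspace_Kv vsubspace_Kv_QH])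

lemma is_vspace_O00 [simp]: "is_vspace O00"
  by (rule is_vspace_tensor) simp_all

lemma p_eq: "p h = coset Kv (QH C) (h - hscale C (\<epsilon> h) 1)"
  by (simp add: tproj0_def proj0_def)

lemma proj0_eq: "\<epsilon> x = 0 \<Longrightarrow> proj0 C x = p x"
  by (simp add: tproj0_def)

lemma ker_part: "h - hscale C (\<epsilon> h) 1 \<in> carr Kv"
  by (simp add: ker_counit_def)

lemma lin_p: "vlinear H O0 p"
proof -
  have "vlinear H H (\<lambda>h. vminus H h (hscale C (\<epsilon> h) 1))"
    by (rule vlinear_minus; (intro multilinear)?; simp)
  then have "vlinear H Kv (\<lambda>h. h - hscale C (\<epsilon> h) 1)"
    using ker_part by (simp add: vlinear_def Pi_iff)
  then have "vlinear H O0 (\<lambda>h. coset Kv (QH C) (h - hscale C (\<epsilon> h) 1))"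
    unfolding Omega0_def by (rule vlinear_compose[OF vlinear_coset[OF is_vspace_Kv vsubspace_Kv_QH]])
  then show ?thesis unfolding p_eq[abs_def] .
qed

lemmas lin_p_comp [multilinear] = vlinear_compose[OF lin_p]

lemma p_carr [simp]: "p h \<in> carr O0"
  by (rule vlinear_carr[OF lin_p]) simp

lemma p_eq_iff: "p x = p y \<longleftrightarrow> x - hscale C (\<epsilon> x) 1 - (y - hscale C (\<epsilon> y) 1) \<in> QH C"
  unfolding p_eq by (subst coset_eq_iff[OF is_vspace_Kv vsubspace_Kv_QH ker_part ker_part]) simp

lemma counit_zero [simp]: "\<epsilon> 0 = 0"
  using vlinear_vzero[OF _ _ lin_counit] by simp

lemma p_zero: "p 0 = vzero O0"
  using vlinear_vzero[OF _ _ lin_p] by simp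

lemma p_one [simp]: "p 1 = vzero O0"
  using p_eq_iff[of 1 0] vsubspace_QH by (simp add: p_zero vsubspace_def)

lemma p_QH: "q \<in> QH C \<Longrightarrow> p q = vzero O0"
  using p_eq_iff[of q 0] by (simp add: p_zero counit_QH)

lemma p_surj: assumes "v \<in> carr O0" obtains x where "\<epsilon> x = 0" "v = p x"
proof -
  obtain x where "x \<in> ker_counit C" "v = coset Kv (QH C) x"
    using assms by (auto simp: Omega0_def carr_quot)
  then show ?thesis using that[of x] by (simp add: p_eq ker_counit_def)
qed

lemma Omega0_lift_ker:
  assumes X: "is_vspace X" and f: "vlinear Kv X f" and fq: "\<And>q. q \<in> QH C \<Longrightarrow> f q = vzero X"
  shows "the_elem (f ` p h) = f (h - hscale C (\<epsilon> h) 1)" "vlinear O0 X (\<lambda>v. the_elem (f ` v))"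
  using the_elem_coset[OF is_vspace_Kv vsubspace_Kv_QH X f fq ker_part, of h]
    vlinear_quot_map[OF is_vspace_Kv vsubspace_Kv_QH X f fq]
  by (simp_all add: p_eq Omega0_def)

text \<open>The form used for Sweedler legs, which need not lie in \<open>ker \<epsilon>\<close>: a
  map given on all of \<open>H\<close> that kills \<open>1\<close> has the same value at
  \<open>h\<close> and at \<open>h - \<epsilon>(h) 1\<close>.\<close>

lemma Omega0_lift:
  assumes X: "is_vspace X" and f: "vlinear H X f" and f1: "f 1 = vzero X"
    and fq: "\<And>q. q \<in> QH C \<Longrightarrow> f q = vzero X"
  shows "the_elem (f ` p h) = f h" "vlinear O0 X (\<lambda>v. the_elem (f ` v))"
proof -
  have "f (h - hscale C (\<epsilon> h) 1) = f h"
    using vlinear_vminus[OF _ f, of h "hscale C (\<epsilon> h) 1"] vlinear_vscale[OF f, of 1 "\<epsilon> h"] f1 X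
      vlinear_carr[OF f, of h] by simp
  then show "the_elem (f ` p h) = f h" "vlinear O0 X (\<lambda>v. the_elem (f ` v))"
    using Omega0_lift_ker[OF X vlinear_vsub[OF vsubspace_ker_counit f] fq] by simp_all
qed

text \<open>\<open>rhoQ C\<close> sends \<open>1\<close> to the identity and not to zero, so it is
  lifted from \<open>ker \<epsilon>\<close> and the subtraction of \<open>\<epsilon>(h) 1\<close>
  remains visible. This is the origin of the last three summands of \<open>eta\<close>.\<close>

lemma rhoQ0_p: "rhoQ0 C (p h) = vminus (EndW C) (rhoQ C h) (vscale (EndW C) (\<epsilon> h) id)"
  and lin_rhoQ0: "vlinear O0 (EndW C) (rhoQ0 C)"
proof -
  have z: "rhoQ C q = vzero (EndW C)" if "q \<in> QH C" for q
    using that by (simp add: QH_def)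
  note L = Omega0_lift_ker[OF is_vspace_EndW vlinear_vsub[OF vsubspace_ker_counit lin_rhoQ] z]
  show "rhoQ0 C (p h) = vminus (EndW C) (rhoQ C h) (vscale (EndW C) (\<epsilon> h) id)"
    using L(1)[of h] vlinear_vminus[OF _ lin_rhoQ, of h "hscale C (\<epsilon> h) 1"]
      vlinear_vscale[OF lin_rhoQ, of 1 "\<epsilon> h"]
    by (simp add: rhoQ0_def rhoQ_one)
  show "vlinear O0 (EndW C) (rhoQ0 C)" using L(2) unfolding rhoQ0_def[abs_def] .
qed

lemma rhoQ_carr [simp]: "rhoQ C h \<in> carr (EndW C)"
  by (rule vlinear_carr[OF lin_rhoQ]) simp

lemma id_carr [simp]: "id \<in> carr (EndW C)"
  using rhoQ_carr[of 1] by (simp add: rhoQ_one)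

text \<open>Injectivity holds because \<open>QH C\<close> is by definition the kernel of
  \<open>rhoQ C\<close> on \<open>ker \<epsilon>\<close>; surjectivity is the assumption on
  \<open>W\<close>.\<close>

lemma viso_rhoQ0: "viso O0 (EndW C) (rhoQ0 C)"
  unfolding viso_def
proof (intro conjI lin_rhoQ0 bij_betwI')
  fix v w assume "v \<in> carr O0" "w \<in> carr O0"
  then obtain x y where x: "\<epsilon> x = 0" "v = p x" and y: "\<epsilon> y = 0" "w = p y"
    by (metis p_surj)
  have "v = w" if "rhoQ0 C v = rhoQ0 C w"
  proof -
    have "rhoQ C (x - y) = vzero (EndW C)"
      using that x y vlinear_vminus[OF _ lin_rhoQ, of x y] by (simp add: rhoQ0_p)
    then show ?thesis using x y by (simp add: p_eq_iff QH_def ker_counit_def)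
  qed
  then show "(rhoQ0 C v = rhoQ0 C w) = (v = w)" by auto
next
  show "rhoQ0 C v \<in> carr (EndW C)" if "v \<in> carr O0" for v
    by (rule vlinear_carr[OF lin_rhoQ0 that])
  fix m assume "m \<in> carr (EndW C)"
  then obtain x where "\<epsilon> x = 0" "m = rhoQ C x"
    using surj by (force simp: ker_counit_def)
  then have "m = rhoQ0 C (p x)" by (simp add: rhoQ0_p)
  then show "\<exists>v\<in>carr O0. m = rhoQ0 C v" using p_carr by blast
qed

section \<open>The right action and the coaction on \<open>\<Omega>_0\<close>\<close>

lemma ract0_p: "\<epsilon> x = 0 \<Longrightarrow> ract0 C (p x) h = p (x * h)"
  and ract0_p_gen: "ract0 C (p x) h = vminus O0 (p (x * h)) (vscale O0 (\<epsilon> x) (p h))"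
  and lin_ract0_left: "vlinear O0 O0 (\<lambda>v. ract0 C v h)"
proof -
  have "vlinear Kv O0 (\<lambda>x. p (x * h))"
    by (rule vlinear_vsub[OF vsubspace_ker_counit]) (intro multilinear)
  then have l: "vlinear Kv O0 (\<lambda>x. proj0 C (x * h))"
    by (rule iffD1[OF vlinear_cong[OF is_vspace_Kv], rotated]) (simp add: proj0_eq ker_counit_def)
  have z: "proj0 C (q * h) = vzero O0" if "q \<in> QH C" for q
    by (simp add: proj0_eq p_QH QH_mult counit_QH that)
  note L = Omega0_lift_ker[OF is_vspace_O0 l z]
  \<comment> \<open>For \<open>x\<close> outside \<open>ker \<epsilon>\<close>, \<open>p x\<close>
    is the class of \<open>x - \<epsilon>(x) 1\<close>, and multiplying the subtracted part by
    \<open>h\<close> gives the second term.\<close>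
  show "ract0 C (p x) h = vminus O0 (p (x * h)) (vscale O0 (\<epsilon> x) (p h))" for x
    using L(1)[of x] vlinear_vminus[OF _ lin_p, of "x * h" "hscale C (\<epsilon> x) h"]
      vlinear_vscale[OF lin_p, of h "\<epsilon> x"]
    by (simp add: ract0_def proj0_eq left_diff_distrib)
  then show "\<epsilon> x = 0 \<Longrightarrow> ract0 C (p x) h = p (x * h)" by simp
  show "vlinear O0 O0 (\<lambda>v. ract0 C v h)" using L(2) unfolding ract0_def .
qed

lemma lin_ract0_right: "v \<in> carr O0 \<Longrightarrow> vlinear H O0 (\<lambda>h. ract0 C v h)"
  by (elim p_surj) (simp add: ract0_p, intro multilinear)

lemma lin_ract0 [multilinear]:
  "vlinear U O0 g \<Longrightarrow> vlinear U O0 (\<lambda>u. ract0 C (g u) h)"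
  "vlinear U H g' \<Longrightarrow> v \<in> carr O0 \<Longrightarrow> vlinear U O0 (\<lambda>u. ract0 C v (g' u))"
  by (auto intro: vlinear_compose[OF lin_ract0_left] vlinear_compose[OF lin_ract0_right])

lemma ract0_carr [simp]: "v \<in> carr O0 \<Longrightarrow> ract0 C v h \<in> carr O0"
  by (rule vlinear_carr[OF lin_ract0_left])

lemma ract0_one [simp]: "v \<in> carr O0 \<Longrightarrow> ract0 C v 1 = v"
  by (elim p_surj) (simp add: ract0_p)

lemma ract0_mult: "v \<in> carr O0 \<Longrightarrow> ract0 C (ract0 C v a) b = ract0 C v (a * b)"
  by (elim p_surj) (simp add: ract0_p mult.assoc)

text \<open>\<open>Ad_apply X G v\<close> is \<open>G v\<^sub>(\<^sub>0\<^sub>) v\<^sub>(\<^sub>1\<^sub>)\<close> for the coaction \<open>v \<mapsto> v\<^sub>(\<^sub>0\<^sub>) \<otimes> v\<^sub>(\<^sub>1\<^sub>)\<close> induced by \<open>Ad\<close>.\<close>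

definition Ad_apply :: "('k, 'x) vspace \<Rightarrow> ('h set \<Rightarrow> 'h \<Rightarrow> 'x) \<Rightarrow> 'h set \<Rightarrow> 'x"
  where "Ad_apply X G v = the_elem (sweedler3 C X (\<lambda>a b c. G (p b) (S a * c)) ` v)"

lemma bil_p:
  assumes G: "vbilinear O0 H X G"
  shows "vlinear U H g \<Longrightarrow> vlinear U X (\<lambda>u. G (p (g u)) x)"
    "vlinear U H g \<Longrightarrow> v \<in> carr O0 \<Longrightarrow> vlinear U X (\<lambda>u. G v (g u))"
    "vlinear U O0 g' \<Longrightarrow> vlinear U X (\<lambda>u. G (g' u) x)"
  using vlinear_compose[OF vbilinear_left[OF G, of x] vlinear_compose[OF lin_p, of U g]]
    vlinear_compose[OF vbilinear_right[OF G, of v], of U g]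
    vlinear_compose[OF vbilinear_left[OF G, of x], of U g'] by simp_all

text \<open>Independence of the representative is \<open>Ad_QH\<close> for the test map
  \<open>G (p b) x\<close>, which kills \<open>1\<close> and \<open>QH C\<close> because
  \<open>p\<close> does.\<close>

lemma
  assumes X: "is_vspace X" and G: "vbilinear O0 H X G"
  shows Ad_apply_p: "Ad_apply X G (p y) = sw X (\<lambda>a z. sw X (\<lambda>b c. G (p b) (S a * c)) z) y"
    and lin_Ad_apply: "vlinear O0 X (Ad_apply X G)"
proof -
  note lin = multilinear bil_p[OF G]
  define f where "f = (\<lambda>y. sw X (\<lambda>a z. sw X (\<lambda>b c. G (p b) (S a * c)) z) y)"
  have s: "sweedler3 C X (\<lambda>a b c. G (p b) (S a * c)) = f"
    unfolding sweedler3_def f_def by (rule ext, rule sw_assoc; (intro lin)?; simp add: X)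
  have G0: "G (vzero O0) x = vzero X" for x
    by (rule vlinear_vzero[OF is_vspace_O0 X vbilinear_left[OF G]]) simp
  have "vlinear H X f" unfolding f_def by (intro lin; simp add: X)
  moreover have "f 1 = vzero X"
    unfolding f_def by (subst sw_one, simp add: X, (intro lin; simp add: X), subst sw_one; (intro lin)?; simp add: X G0)
  moreover have "f q = vzero X" if "q \<in> QH C" for q
    unfolding f_def by (rule Ad_QH[OF X _ _ _ that, where F = "\<lambda>b x. G (p b) x"]; (intro lin)?; simp add: G0 p_QH)
  ultimately show "Ad_apply X G (p y) = sw X (\<lambda>a z. sw X (\<lambda>b c. G (p b) (S a * c)) z) y"
    and "vlinear O0 X (Ad_apply X G)"
    using Omega0_lift[OF X, of f] unfolding Ad_apply_def[abs_def] s by (simp_all add: f_def)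
qed

lemma lin_Ad_apply_param:
  assumes X: "is_vspace X" and U: "is_vspace U" and G: "\<And>u. u \<in> carr U \<Longrightarrow> vbilinear O0 H X (G u)"
    and l: "\<And>v x. v \<in> carr O0 \<Longrightarrow> vlinear U X (\<lambda>u. G u v x)" and w: "w \<in> carr O0"
  shows "vlinear U X (\<lambda>u. Ad_apply X (G u) w)"
proof -
  obtain y where y: "w = p y" using w by (elim p_surj)
  have "vlinear U X (\<lambda>u. sw X (\<lambda>a z. sw X (\<lambda>b c. G u (p b) (S a * c)) z) y)"
    by (intro lin_sw_param lin_sw_arg bilI multilinear bil_p[OF G] l; simp add: X U)
  then show ?thesis
    by (rule iffD1[OF vlinear_cong[OF U], rotated]) (simp add: y Ad_apply_p[OF X G])
qed

lemma Ad_apply_map: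
  assumes X: "is_vspace X" and Y: "is_vspace Y" and G: "vbilinear O0 H X G" and f: "vlinear X Y f"
    and v: "v \<in> carr O0"
  shows "f (Ad_apply X G v) = Ad_apply Y (\<lambda>u x. f (G u x)) v"
proof -
  note lin = multilinear bil_p[OF G] vlinear_compose[OF f]
  obtain y where y: "v = p y" using v by (elim p_surj)
  have "f (Ad_apply X G v) = sw Y (\<lambda>a z. f (sw X (\<lambda>b c. G (p b) (S a * c)) z)) y"
    unfolding y Ad_apply_p[OF X G] by (rule sw_map[OF X Y f]; (intro lin)?; simp add: X Y)
  also have "\<dots> = sw Y (\<lambda>a z. sw Y (\<lambda>b c. f (G (p b) (S a * c))) z) y"
    by (rule sw_cong, rule sw_map[OF X Y f]; (intro lin)?; simp add: X Y)
  finally show ?thesis unfolding y Ad_apply_p[OF Y vbilinear_compose[OF f G]] .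
qed

section \<open>Braided symmetry and invariance of the Killing form\<close>

lemma eta0_eq: "eta0 C = sw O00 (\<lambda>a b. pure O0 O0 (p a) (p b)) (Tel C)"
  by (simp add: eta0_def tmap_def sweedler2_def)

lemma bil_pp: "bil O00 (\<lambda>a b. pure O0 O0 (p a) (p b))"
  by (intro multilinear; simp)

lemma eta0_carr: "eta0 C \<in> carr O00"
  unfolding eta0_eq by (rule sw_carr[OF is_vspace_O00 bil_pp])

lemma pure00_carr [simp]: "v \<in> carr O0 \<Longrightarrow> w \<in> carr O0 \<Longrightarrow> pure O0 O0 v w \<in> carr O00"
  by (rule pure_carr) simp_all

lemma bil_Psi: "v \<in> carr O0 \<Longrightarrow> vbilinear O0 H O00 (\<lambda>u x. pure O0 O0 u (ract0 C v x))"
  by (intro vbilinearI multilinear; simp)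

lemma Psi0_pure: "v \<in> carr O0 \<Longrightarrow> w \<in> carr O0 \<Longrightarrow>
    Psi0 C (pure O0 O0 v w) = Ad_apply O00 (\<lambda>u x. pure O0 O0 u (ract0 C v x)) w"
  and lin_Psi0: "vlinear O00 O00 (Psi0 C)"
proof -
  have e: "Psi0 C = tlift O0 O0 O00 (\<lambda>v w. Ad_apply O00 (\<lambda>u x. pure O0 O0 u (ract0 C v x)) w)"
    by (simp add: Psi0_def Ad_apply_def Let_def)
  have b: "vbilinear O0 O0 O00 (\<lambda>v w. Ad_apply O00 (\<lambda>u x. pure O0 O0 u (ract0 C v x)) w)"
    by (intro vbilinearI lin_Ad_apply lin_Ad_apply_param bil_Psi multilinear; simp)
  show "v \<in> carr O0 \<Longrightarrow> w \<in> carr O0 \<Longrightarrow>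
    Psi0 C (pure O0 O0 v w) = Ad_apply O00 (\<lambda>u x. pure O0 O0 u (ract0 C v x)) w"
    unfolding e by (rule tlift_pure) (simp_all add: b)
  show "vlinear O00 O00 (Psi0 C)" unfolding e by (rule vlinear_tlift) (simp_all add: b)
qed

lemma vlinear_pure_minus:
  assumes "is_vspace V" "is_vspace V'" "v \<in> carr V" "w \<in> carr V'" "w' \<in> carr V'"
  shows "pure V V' v (vminus V' w w') = vminus (tensor V V') (pure V V' v w) (pure V V' v w')"
  by (rule vlinear_vminus[OF _ vlinear_pure_right[OF _ _ vlinear_ident]]) (use assms in simp_all)

lemma Psi0_eta0: "Psi0 C (eta0 C) = eta0 C"
proof -
  note p2 = vlinear_vscale[OF vlinear_pure_right[OF is_vspace_O0 is_vspace_O0 vlinear_ident]]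
  \<comment> \<open>\<open>?G\<close> is the correction of \<open>ract0_p_gen\<close>; it arises
    because the first leg of \<open>T\<close> need not lie in \<open>ker \<epsilon>\<close>.\<close>
  let ?F = "\<lambda>a b c d. pure O0 O0 (p c) (p (a * S b * d))"
  let ?G = "\<lambda>a b c d. vscale O00 (\<epsilon> a) (pure O0 O0 (p c) (p (S b * d)))"
  have "Psi0 C (eta0 C) = sw O00 (\<lambda>a t. Psi0 C (pure O0 O0 (p a) (p t))) (Tel C)"
    unfolding eta0_eq by (rule sw_map[OF _ _ lin_Psi0 bil_pp]) simp_all
  also have "\<dots> = sw O00 (\<lambda>a t. sw O00 (\<lambda>b z. sw O00 (\<lambda>c d. vminus O00 (?F a b c d) (?G a b c d)) z) t) (Tel C)"
    unfolding Psi0_pure[OF p_carr p_carr] Ad_apply_p[OF is_vspace_O00 bil_Psi[OF p_carr]]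
    by (simp add: ract0_p_gen vlinear_pure_minus p2 mult.assoc)
  also have "\<dots> = sw O00 (\<lambda>a t. sw O00 (\<lambda>b z. vminus O00 (sw O00 (\<lambda>c d. ?F a b c d) z) (sw O00 (\<lambda>c d. ?G a b c d) z)) t) (Tel C)"
    by (rule sw_cong, rule sw_cong, rule sw_vminus; (intro multilinear)?; simp)
  also have "\<dots> = sw O00 (\<lambda>a t. vminus O00 (sw O00 (\<lambda>b z. sw O00 (\<lambda>c d. ?F a b c d) z) t)
      (sw O00 (\<lambda>b z. sw O00 (\<lambda>c d. ?G a b c d) z) t)) (Tel C)"
    by (rule sw_cong, rule sw_vminus; (intro multilinear)?; simp)
  also have "\<dots> = vminus O00 (sw O00 (\<lambda>a t. sw O00 (\<lambda>b z. sw O00 (\<lambda>c d. ?F a b c d) z) t) (Tel C))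
      (sw O00 (\<lambda>a t. sw O00 (\<lambda>b z. sw O00 (\<lambda>c d. ?G a b c d) z) t) (Tel C))"
    by (rule sw_vminus; (intro multilinear)?; simp)
  also have "sw O00 (\<lambda>a t. sw O00 (\<lambda>b z. sw O00 (\<lambda>c d. ?F a b c d) z) t) (Tel C)
      = sw O00 (\<lambda>c d. pure O0 O0 (p c) (p (1 * d))) (Tel C)"
    by (rule sw_cancel_left[OF cancels_antip_right, where F = "\<lambda>u z. sw O00 (\<lambda>c d. pure O0 O0 (p c) (p (u * d))) z"];
      (intro multilinear)?; simp)
  also have "\<dots> = eta0 C" by (simp add: eta0_eq)
  also have "sw O00 (\<lambda>a t. sw O00 (\<lambda>b z. sw O00 (\<lambda>c d. ?G a b c d) z) t) (Tel C)
      = sw O00 (\<lambda>a t. vscale O00 (\<epsilon> a) (sw O00 (\<lambda>b z. sw O00 (\<lambda>c d. pure O0 O0 (p c) (p (S b * d))) z) t)) (Tel C)"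
  proof (rule sw_cong)
    fix a t
    have "vscale O00 (\<epsilon> a) (sw O00 (\<lambda>b z. sw O00 (\<lambda>c d. pure O0 O0 (p c) (p (S b * d))) z) t)
      = sw O00 (\<lambda>b z. vscale O00 (\<epsilon> a) (sw O00 (\<lambda>c d. pure O0 O0 (p c) (p (S b * d))) z)) t"
      by (rule sw_map[where f = "vscale O00 (\<epsilon> a)"]; (intro multilinear)?; simp)
    also have "\<dots> = sw O00 (\<lambda>b z. sw O00 (\<lambda>c d. ?G a b c d) z) t"
      by (rule sw_cong, rule sw_map[where f = "vscale O00 (\<epsilon> a)"]; (intro multilinear)?; simp)
    finally show "sw O00 (\<lambda>b z. sw O00 (\<lambda>c d. ?G a b c d) z) t
      = vscale O00 (\<epsilon> a) (sw O00 (\<lambda>b z. sw O00 (\<lambda>c d. pure O0 O0 (p c) (p (S b * d))) z) t)" by simp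
  qed
  also have "\<dots> = sw O00 (\<lambda>b z. sw O00 (\<lambda>c d. pure O0 O0 (p c) (p (S b * d))) z) (Tel C)"
    by (rule sw_counit_left; (intro multilinear)?; simp)
  \<comment> \<open>Once the counit has absorbed the first leg, \<open>Ad(T)\<close> remains with
    \<open>p\<close> applied to both factors. By \<open>Ad_Tel\<close> its second factor is
    \<open>1\<close>, and \<open>p 1\<close> is zero.\<close>
  also have "\<dots> = pure O0 O0 (p (Tel C)) (p 1)"
    by (rule Ad_Tel[where F = "\<lambda>b x. pure O0 O0 (p b) (p x)"]; (intro multilinear)?; simp)
  also have "\<dots> = vzero O00"
    using vlinear_vzero[OF is_vspace_O0 is_vspace_O00 vlinear_pure_right[OF _ _ vlinear_ident]] by simp
  finally show ?thesis using eta0_carr by simp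
qed

text \<open>This connects the coaction \<open>Ad0\<close>, with values in
  \<open>\<Omega>_0 \<otimes> H\<close>, to its form evaluated on a bilinear map, which is the one
  used in computations.\<close>

lemma tlift_Ad0:
  assumes X: "is_vspace X" and G: "vbilinear O0 H X G" and v: "v \<in> carr O0"
  shows "tlift O0 H X G (Ad0 C v) = Ad_apply X G v"
proof -
  let ?Y = "tensor O0 H"
  have Y [simp]: "is_vspace ?Y" by (rule is_vspace_tensor) simp_all
  have P: "vbilinear O0 H ?Y (pure O0 H)" by (rule vbilinear_pure) simp_all
  have "Ad0 C v = Ad_apply ?Y (pure O0 H) v" by (simp add: Ad0_def Ad_apply_def)
  then have "tlift O0 H X G (Ad0 C v) = Ad_apply X (\<lambda>u x. tlift O0 H X G (pure O0 H u x)) v"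
    using Ad_apply_map[OF Y X P vlinear_tlift[OF _ _ X G] v] by simp
  also have "\<dots> = Ad_apply X G v"
    using v by (elim p_surj) (simp add: Ad_apply_p X vbilinear_compose[OF vlinear_tlift[OF _ _ X G] P] G tlift_pure)
  finally show ?thesis .
qed

lemma Ad_invariant_eta0: "Ad_invariant C (eta0 C)"
proof -
  let ?X = "tensor O00 H"
  have X [simp]: "is_vspace ?X" by (rule is_vspace_tensor) simp_all
  have [simp]: "pure O00 H t x \<in> carr ?X" if "t \<in> carr O00" for t x
    using that by (intro pure_carr) simp_all
  let ?P = "\<lambda>v w x. pure O00 H (pure O0 O0 v w) x"
  have b2: "vbilinear O0 H ?X (\<lambda>w0 y. ?P v0 w0 (x * y))" if "v0 \<in> carr O0" for v0 x
    using that by (intro vbilinearI multilinear; simp)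
  have b1: "vbilinear O0 H ?X (\<lambda>v0 x. Ad_apply ?X (\<lambda>w0 y. ?P v0 w0 (x * y)) w)" if "w \<in> carr O0" for w
    by (rule vbilinearI; rule lin_Ad_apply_param[OF X _ b2 _ that]; (intro multilinear)?; simp)
  have b0: "vbilinear O0 O0 ?X (\<lambda>v w. Ad_apply ?X (\<lambda>v0 x. Ad_apply ?X (\<lambda>w0 y. ?P v0 w0 (x * y)) w) v)"
  proof (rule vbilinearI)
    fix v assume v: "v \<in> carr O0"
    show "vlinear O0 ?X (\<lambda>w. Ad_apply ?X (\<lambda>v0 x. Ad_apply ?X (\<lambda>w0 y. ?P v0 w0 (x * y)) w) v)"
      by (rule lin_Ad_apply_param[OF X is_vspace_O0 b1 lin_Ad_apply[OF X b2] v])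
  qed (rule lin_Ad_apply[OF X b1])
  have e: "Ad00 C = tlift O0 O0 ?X (\<lambda>v w. Ad_apply ?X (\<lambda>v0 x. Ad_apply ?X (\<lambda>w0 y. ?P v0 w0 (x * y)) w) v)"
    unfolding Ad00_def Let_def
  proof (rule tlift_cong)
    fix v w assume v: "v \<in> carr O0" and w: "w \<in> carr O0"
    have "tlift O0 H ?X (\<lambda>v0 a. tlift O0 H ?X (\<lambda>w0 b. ?P v0 w0 (a * b)) (Ad0 C w)) (Ad0 C v)
        = tlift O0 H ?X (\<lambda>v0 a. Ad_apply ?X (\<lambda>w0 b. ?P v0 w0 (a * b)) w) (Ad0 C v)"
      by (rule fun_cong[OF tlift_cong]) (rule tlift_Ad0[OF X b2 w])
    also have "\<dots> = Ad_apply ?X (\<lambda>v0 x. Ad_apply ?X (\<lambda>w0 y. ?P v0 w0 (x * y)) w) v"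
      by (rule tlift_Ad0[OF X b1[OF w] v])
    finally show "tlift O0 H ?X (\<lambda>v0 a. tlift O0 H ?X (\<lambda>w0 b. ?P v0 w0 (a * b)) (Ad0 C w)) (Ad0 C v)
        = Ad_apply ?X (\<lambda>v0 x. Ad_apply ?X (\<lambda>w0 y. ?P v0 w0 (x * y)) w) v" .
  qed
  let ?E = "\<lambda>a1 a2 a3 t1 t2 t3. ?P (p a2) (p t2) (S a1 * (a3 * S t1) * t3)"
  have "Ad00 C (eta0 C) = sw ?X (\<lambda>a t. Ad00 C (pure O0 O0 (p a) (p t))) (Tel C)"
    unfolding eta0_eq e by (rule sw_map[OF _ _ vlinear_tlift[OF _ _ _ b0] bil_pp]) simp_all
  also have "\<dots> = sw ?X (\<lambda>a t. sw ?X (\<lambda>a1 z. sw ?X (\<lambda>a2 a3. sw ?X (\<lambda>t1 y. sw ?X (\<lambda>t2 t3.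
      ?E a1 a2 a3 t1 t2 t3) y) t) z) a) (Tel C)"
    unfolding e tlift_pure[OF is_vspace_O0 is_vspace_O0 X b0 p_carr p_carr]
      Ad_apply_p[OF X b1[OF p_carr]] Ad_apply_p[OF X b2[OF p_carr]] by (simp add: mult.assoc)
  also have "\<dots> = sw ?X (\<lambda>a1 u. sw ?X (\<lambda>z t. sw ?X (\<lambda>a2 a3. sw ?X (\<lambda>t1 y. sw ?X (\<lambda>t2 t3.
      ?E a1 a2 a3 t1 t2 t3) y) t) z) u) (Tel C)"
    by (rule sw_assoc; (intro multilinear)?; simp)
  also have "\<dots> = sw ?X (\<lambda>a1 u. sw ?X (\<lambda>a2 r. sw ?X (\<lambda>a3 t. sw ?X (\<lambda>t1 y. sw ?X (\<lambda>t2 t3.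
      ?E a1 a2 a3 t1 t2 t3) y) t) r) u) (Tel C)"
    by (rule sw_cong, rule sw_assoc; (intro multilinear)?; simp)
  \<comment> \<open>The factor \<open>a3 * S t1\<close> between the two coactions cancels. What is
    left is \<open>Ad(T)\<close> with the coproduct applied to its middle leg, so
    \<open>Ad_Tel\<close> applies with that coproduct inside \<open>F\<close>.\<close>
  also have "\<dots> = sw ?X (\<lambda>a1 u. sw ?X (\<lambda>a2 r. sw ?X (\<lambda>t2 t3. ?P (p a2) (p t2) (S a1 * 1 * t3)) r) u) (Tel C)"
    by (rule sw_cong, rule sw_cong, rule sw_cancel_left[OF cancels_antip_right X, where
        F = "\<lambda>x y. sw ?X (\<lambda>t2 t3. ?P (p _) (p t2) (S _ * x * t3)) y"]; (intro multilinear)?; simp)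
  also have "\<dots> = sw ?X (\<lambda>a1 u. sw ?X (\<lambda>w t3. sw ?X (\<lambda>a2 t2. ?P (p a2) (p t2) (S a1 * t3)) w) u) (Tel C)"
    unfolding mult_1_right by (rule sw_cong, rule sw_assoc[symmetric]; (intro multilinear)?; simp)
  also have "\<dots> = sw ?X (\<lambda>a2 t2. ?P (p a2) (p t2) 1) (Tel C)"
    by (rule Ad_Tel[OF X, where F = "\<lambda>w x. sw ?X (\<lambda>a2 t2. ?P (p a2) (p t2) x) w"]; (intro multilinear)?; simp)
  also have "\<dots> = pure O00 H (eta0 C) 1"
    unfolding eta0_eq by (rule sw_map[where f = "\<lambda>t. pure O00 H t 1", symmetric]; (intro multilinear)?; simp)
  finally show ?thesis by (simp add: Ad_invariant_def)
qed

text \<open>Each leg contributes \<open>rhoQ C a - \<epsilon>(a) id\<close>, and the counits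
  contract the coproduct of \<open>T\<close>. The left leg is expanded first, which leaves
  \<open>rhoQ0 C (p T)\<close> in one term.\<close>

lemma tmap_rhoQ0_eta0: "tmap O0 O0 (EndW C) (EndW C) (rhoQ0 C) (rhoQ0 C) (eta0 C) = eta C"
proof -
  let ?V = "EndW C"
  define VV where "VV = tensor ?V ?V"
  have VV [simp]: "is_vspace VV" unfolding VV_def by (rule is_vspace_tensor) simp_all
  have pc [simp]: "pure ?V ?V m n \<in> carr VV" if "m \<in> carr ?V" "n \<in> carr ?V" for m n
    unfolding VV_def using that by (intro pure_carr) simp_all
  have b: "vbilinear ?V ?V VV (pure ?V ?V)" unfolding VV_def by (rule vbilinear_pure) simp_all
  have r0 [simp]: "rhoQ0 C v \<in> carr ?V" if "v \<in> carr O0" for v by (rule vlinear_carr[OF lin_rhoQ0 that])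
  have pl: "vlinear H VV (\<lambda>h. pure ?V ?V (g h) m)" if "vlinear H ?V g" "m \<in> carr ?V" for g m
    by (rule vlinear_compose[OF vbilinear_left[OF b] that(1)]) (rule that)
  have pr: "vlinear H VV (\<lambda>h. pure ?V ?V m (g h))" if "vlinear H ?V g" "m \<in> carr ?V" for g m
    by (rule vlinear_compose[OF vbilinear_right[OF b] that(1)]) (rule that)
  note lin = multilinear pl pr vlinear_compose[OF lin_rhoQ] vlinear_compose[OF lin_rhoQ0]
  have bb: "vbilinear O0 O0 VV (\<lambda>v w. pure ?V ?V (rhoQ0 C v) (rhoQ0 C w))"
    unfolding VV_def by (intro vbilinearI lin lin_rhoQ0; simp add: lin_rhoQ0)
  let ?T = "Tel C"
  let ?A = "sw VV (\<lambda>a b. pure ?V ?V (rhoQ C a) (rhoQ C b)) ?T"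
  have idl: "pure ?V ?V (rhoQ0 C (p a)) m = vminus VV (pure ?V ?V (rhoQ C a) m) (vscale VV (\<epsilon> a) (pure ?V ?V id m))"
    if m: "m \<in> carr ?V" for a m
    unfolding rhoQ0_p
    using vlinear_vminus[OF _ vbilinear_left[OF b m], of "rhoQ C a" "vscale ?V (\<epsilon> a) id"]
      vlinear_vscale[OF vbilinear_left[OF b m], of id "\<epsilon> a"] by simp
  have idr: "pure ?V ?V m (rhoQ0 C (p a)) = vminus VV (pure ?V ?V m (rhoQ C a)) (vscale VV (\<epsilon> a) (pure ?V ?V m id))"
    if m: "m \<in> carr ?V" for a m
    unfolding rhoQ0_p
    using vlinear_vminus[OF _ vbilinear_right[OF b m], of "rhoQ C a" "vscale ?V (\<epsilon> a) id"]
      vlinear_vscale[OF vbilinear_right[OF b m], of id "\<epsilon> a"] by simp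
  have "tmap O0 O0 ?V ?V (rhoQ0 C) (rhoQ0 C) (eta0 C)
      = sw VV (\<lambda>a b. tlift O0 O0 VV (\<lambda>v w. pure ?V ?V (rhoQ0 C v) (rhoQ0 C w)) (pure O0 O0 (p a) (p b))) ?T"
    unfolding tmap_def eta0_eq VV_def[symmetric]
    by (rule sw_map[OF _ _ vlinear_tlift[OF _ _ _ bb] bil_pp]) simp_all
  also have "\<dots> = sw VV (\<lambda>a b. vminus VV (pure ?V ?V (rhoQ C a) (rhoQ0 C (p b)))
      (vscale VV (\<epsilon> a) (pure ?V ?V id (rhoQ0 C (p b))))) ?T"
    by (simp add: tlift_pure[OF _ _ _ bb] idl)
  also have "\<dots> = vminus VV (sw VV (\<lambda>a b. pure ?V ?V (rhoQ C a) (rhoQ0 C (p b))) ?T)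
      (sw VV (\<lambda>a b. vscale VV (\<epsilon> a) (pure ?V ?V id (rhoQ0 C (p b)))) ?T)"
    by (rule sw_vminus; (intro lin)?; simp)
  also have "sw VV (\<lambda>a b. vscale VV (\<epsilon> a) (pure ?V ?V id (rhoQ0 C (p b)))) ?T = pure ?V ?V id (rhoQ0 C (p ?T))"
    by (rule sw_counit_left; (intro lin)?; simp)
  also have "sw VV (\<lambda>a b. pure ?V ?V (rhoQ C a) (rhoQ0 C (p b))) ?T
      = sw VV (\<lambda>a b. vminus VV (pure ?V ?V (rhoQ C a) (rhoQ C b)) (vscale VV (\<epsilon> b) (pure ?V ?V (rhoQ C a) id))) ?T"
    by (simp add: idr)
  also have "\<dots> = vminus VV ?A (sw VV (\<lambda>a b. vscale VV (\<epsilon> b) (pure ?V ?V (rhoQ C a) id)) ?T)"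
    by (rule sw_vminus; (intro lin)?; simp)
  also have "sw VV (\<lambda>a b. vscale VV (\<epsilon> b) (pure ?V ?V (rhoQ C a) id)) ?T = pure ?V ?V (rhoQ C ?T) id"
    by (rule sw_counit_right; (intro lin)?; simp)
  \<comment> \<open>Expanding the remaining \<open>rhoQ0 C (p T)\<close> produces the summand in
    \<open>id \<otimes> id\<close>, with a positive sign after two subtractions.\<close>
  also have "vminus VV (vminus VV ?A (pure ?V ?V (rhoQ C ?T) id)) (pure ?V ?V id (rhoQ0 C (p ?T)))
    = vplus VV (vminus VV (vminus VV ?A (pure ?V ?V id (rhoQ C ?T))) (pure ?V ?V (rhoQ C ?T) id))
        (vscale VV (\<epsilon> ?T) (pure ?V ?V id id))"
  proof -
    have "?A \<in> carr VV" by (rule sw_carr; (intro lin)?; simp)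
    then show ?thesis by (simp add: idr vminus_def vscale_vplus vplus_ac)
  qed
  also have "\<dots> = eta C"
    by (simp add: eta_def Let_def tmap_def sweedler2_def VV_def)
  finally show ?thesis .
qed

section \<open>The calculus \<open>\<Omega>\<^sup>1\<close>\<close>

abbreviation "mult \<equiv> tlift H H H (*)"
abbreviation "can \<equiv> tlift H H (HH C) (\<lambda>h g. sw (HH C) (\<lambda>g1 g2. hpure C (h * g1) g2) g)"
abbreviation "Km \<equiv> vsub (HH C) (ker_mult C)"
abbreviation "O1 \<equiv> Omega1 C"

lemma bil_mult: "bil H (*)"
  by (intro multilinear; simp)

lemma bil_can: "bil (HH C) (\<lambda>h g. sw (HH C) (\<lambda>g1 g2. hpure C (h * g1) g2) g)"
  by (intro multilinear; simp)

lemma lin_mult: "vlinear (HH C) H mult" and lin_can: "vlinear (HH C) (HH C) can"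
  by (rule vlinear_tlift; simp add: bil_mult bil_can)+

lemma mult_hpure [simp]: "mult (hpure C a b) = a * b"
  by (simp add: tlift_pure bil_mult)

lemma vsubspace_ker_mult: "vsubspace (HH C) (ker_mult C)"
  using vsubspace_kernel[OF is_vspace_HH is_vspace_H lin_mult] by (simp add: ker_mult_def)

lemma is_vspace_Km: "is_vspace Km"
  by (intro is_vspace_vsub vsubspace_ker_mult) simp

lemma ker_mult_carr: "t \<in> ker_mult C \<Longrightarrow> t \<in> carr (HH C)"
  by (simp add: ker_mult_def)

lemma vsubspace_N1: "vsubspace Km (N1 C)"
proof -
  have s: "vsubspace (HH C) (vspan (HH C) {hpure C h q |h q. q \<in> QH C})"
    by (rule vsubspace_vspan) auto
  then show ?thesis
    using vsubspace_ker_mult vlinear_vplus[OF lin_can ker_mult_carr ker_mult_carr]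
      vlinear_vscale[OF lin_can ker_mult_carr] vlinear_vzero[OF _ _ lin_can]
    unfolding vsubspace_def N1_def by auto
qed

lemma is_vspace_O1 [simp]: "is_vspace O1"
  unfolding Omega1_def by (rule is_vspace_quot[OF is_vspace_Km vsubspace_N1])

text \<open>Pure tensors are not in the kernel of the product. The retraction
  \<open>t - mult(t) \<otimes> 1\<close> onto that kernel extends the class map to all of
  \<open>H \<otimes> H\<close>, where maps can be compared on pure tensors; on
  \<open>h \<otimes> g\<close> it gives \<open>h (1 \<otimes> g - g \<otimes> 1)\<close>.\<close>

definition tproj1 :: "('k, 'h, 'h) tens \<Rightarrow> ('k, 'h, 'h) tens set"
  where "tproj1 t = proj1 C (vminus (HH C) t (hpure C (mult t) 1))"

text \<open>\<open>D h g\<close> is \<open>h dg\<close>.\<close>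

definition D :: "'h \<Rightarrow> 'h \<Rightarrow> ('k, 'h, 'h) tens set"
  where "D h g = tproj1 (hpure C h g)"

lemma mult_carr_part: "t \<in> carr (HH C) \<Longrightarrow> vminus (HH C) t (hpure C (mult t) 1) \<in> carr Km"
  using vlinear_vminus[OF _ lin_mult, of t "hpure C (mult t) 1"] by (simp add: ker_mult_def)

lemma lin_tproj1: "vlinear (HH C) O1 tproj1"
proof -
  have "vlinear (HH C) (HH C) (\<lambda>t. vminus (HH C) t (hpure C (mult t) 1))"
    by (rule vlinear_minus; (intro multilinear lin_mult)?; simp add: lin_mult)
  then have "vlinear (HH C) Km (\<lambda>t. vminus (HH C) t (hpure C (mult t) 1))"
    using mult_carr_part by (simp add: vlinear_def Pi_iff)
  then show ?thesis
    unfolding tproj1_def[abs_def] proj1_def Omega1_def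
    by (rule vlinear_compose[OF vlinear_coset[OF is_vspace_Km vsubspace_N1]])
qed

lemma tproj1_carr [simp]: "t \<in> carr (HH C) \<Longrightarrow> tproj1 t \<in> carr O1"
  by (rule vlinear_carr[OF lin_tproj1])

lemma D_carr [simp]: "D h g \<in> carr O1"
  by (simp add: D_def)

lemma lin_D [multilinear]:
  "vlinear U H f \<Longrightarrow> vlinear U O1 (\<lambda>u. D (f u) g)" "vlinear U H f \<Longrightarrow> vlinear U O1 (\<lambda>u. D h (f u))"
  unfolding D_def by (rule vlinear_compose[OF lin_tproj1]; intro multilinear; simp)+

lemma zero_HH: "hpure C 0 b = vzero (HH C)"
  using vlinear_vzero[OF _ _ vlinear_pure_left[OF _ _ vlinear_ident], of H H b] by simp

lemma proj1_eq: "t \<in> ker_mult C \<Longrightarrow> proj1 C t = tproj1 t"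
  by (simp add: tproj1_def ker_mult_def zero_HH)

lemma tproj1_N1: "t \<in> N1 C \<Longrightarrow> tproj1 t = vzero O1"
  using coset_eq_vzero[OF is_vspace_Km vsubspace_N1, of t] proj1_eq[of t]
  by (simp add: N1_def proj1_def Omega1_def)

lemma tproj1_surj: assumes "\<omega> \<in> carr O1" obtains t where "t \<in> ker_mult C" "\<omega> = tproj1 t"
proof -
  obtain t where "t \<in> ker_mult C" "\<omega> = proj1 C t"
    using assms by (auto simp: Omega1_def carr_quot proj1_def)
  then show ?thesis using that[of t] by (simp add: proj1_eq)
qed

lemma O1_subset: assumes "\<omega> \<in> carr O1" shows "\<omega> \<subseteq> ker_mult C"
proof -
  obtain t where "t \<in> carr Km" "\<omega> = coset Km (N1 C) t"
    using assms by (auto simp: Omega1_def carr_quot)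
  then show ?thesis
    using vplus_carr[OF is_vspace_Km] vsubspace_carr[OF vsubspace_N1] by (auto simp: coset_def)
qed

lemma tproj1_tlift:
  assumes "t \<in> carr (HH C)" "bil (HH C) (\<lambda>a b. hpure C (f a b) (g a b))"
  shows "tproj1 (tlift H H (HH C) (\<lambda>a b. hpure C (f a b) (g a b)) t) = tlift H H O1 (\<lambda>a b. D (f a b) (g a b)) t"
  unfolding D_def by (rule tlift_compose[OF _ _ _ _ assms(2) lin_tproj1 assms(1)]) simp_all

lemma D_one [simp]: "D h 1 = vzero O1"
proof -
  have "D h 1 = proj1 C (vzero (HH C))" by (simp add: D_def tproj1_def)
  also have "\<dots> = vzero O1"
    using vsubspace_N1 coset_eq_vzero[OF is_vspace_Km vsubspace_N1, of "vzero (HH C)"]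
    by (auto simp: proj1_def Omega1_def vsubspace_def)
  finally show ?thesis .
qed

text \<open>The representative \<open>h S(q1) \<otimes> q2\<close> is mapped by \<open>can\<close>
  to \<open>h \<otimes> q\<close>, since \<open>S(q1) q2\<close> cancels, and its product is
  \<open>h \<epsilon>(q) = 0\<close>.\<close>

lemma D_QH:
  assumes q: "q \<in> QH C"
  shows "sw O1 (\<lambda>a b. D (h * S a) b) q = vzero O1"
proof -
  let ?t = "sw (HH C) (\<lambda>a b. hpure C (h * S a) b) q"
  have t: "?t \<in> carr (HH C)" by (rule sw_carr; (intro multilinear)?; simp)
  have "mult ?t = sw H (\<lambda>a b. mult (hpure C (h * S a) b)) q"
    by (rule sw_map[OF _ _ lin_mult]; (intro multilinear)?; simp)
  also have "\<dots> = sw H (\<lambda>a b. h * (S a * b)) q" by (simp add: mult.assoc)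
  also have "\<dots> = 0"
    using q by (subst sw_cancel[OF cancels_antip_left, where f = "\<lambda>u. h * u"]; (intro multilinear)?; simp add: counit_QH)
  finally have m: "?t \<in> ker_mult C" using t by (simp add: ker_mult_def)
  have "can ?t = sw (HH C) (\<lambda>a b. can (hpure C (h * S a) b)) q"
    by (rule sw_map[OF _ _ lin_can]; (intro multilinear)?; simp)
  also have "\<dots> = sw (HH C) (\<lambda>a x. sw (HH C) (\<lambda>b c. hpure C (h * (S a * b)) c) x) q"
    by (simp add: tlift_pure bil_can mult.assoc)
  also have "\<dots> = hpure C (h * 1) q"
    by (rule sw_cancel_left[OF cancels_antip_left, where F = "\<lambda>u c. hpure C (h * u) c"]; (intro multilinear)?; simp)
  finally have "?t \<in> N1 C"
    using m q unfolding N1_def by (auto intro!: vspan_superset)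
  then have "tproj1 ?t = vzero O1" by (rule tproj1_N1)
  moreover have "tproj1 ?t = sw O1 (\<lambda>a b. D (h * S a) b) q"
    unfolding D_def by (rule sw_map[OF _ _ lin_tproj1]; (intro multilinear)?; simp)
  ultimately show ?thesis by simp
qed

text \<open>A universal property: the conditions on \<open>F\<close> are the relations
  \<open>h d1 = 0\<close> and \<open>h S(q1) dq2 = 0\<close>. \<open>G\<close> is \<open>F\<close>
  composed with the inverse of \<open>can\<close>, so \<open>F\<close> factors as \<open>G\<close>
  after \<open>can\<close>. As \<open>can\<close> maps \<open>N1 C\<close> into the span of the
  \<open>h \<otimes> q\<close>, on which \<open>G\<close> vanishes, \<open>F\<close> kills
  \<open>N1 C\<close>.\<close>

lemma Omega1_lift:
  assumes X: "is_vspace X" and F: "bil X F" and F1: "\<And>h. F h 1 = vzero X"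
    and Fq: "\<And>h q. q \<in> QH C \<Longrightarrow> sw X (\<lambda>a b. F (h * S a) b) q = vzero X"
  shows "t \<in> carr (HH C) \<Longrightarrow> the_elem (tlift H H X F ` tproj1 t) = tlift H H X F t"
    and "vlinear O1 X (\<lambda>\<omega>. the_elem (tlift H H X F ` \<omega>))"
proof -
  note lin = multilinear bilD1[OF F] bilD2[OF F]
  note lF = vlinear_tlift[OF is_vspace_H is_vspace_H X F]
  define G where "G = (\<lambda>h g. sw X (\<lambda>a b. F (h * S a) b) g)"
  have bG: "bil X G" unfolding G_def by (intro lin; simp add: X)
  note lG = vlinear_tlift[OF is_vspace_H is_vspace_H X bG]
  have FG: "tlift H H X F t = tlift H H X G (can t)" if "t \<in> carr (HH C)" for t
  proof (rule tlift_eqI[OF _ _ X F _ _ that])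
    show "vlinear (HH C) X (\<lambda>t. tlift H H X G (can t))" by (rule vlinear_compose[OF lG lin_can])
    show "tlift H H X G (can (hpure C h g)) = F h g" for h g
    proof -
      have "tlift H H X G (can (hpure C h g)) = tlift H H X G (sw (HH C) (\<lambda>g1 g2. hpure C (h * g1) g2) g)"
        by (simp add: tlift_pure bil_can)
      also have "\<dots> = sw X (\<lambda>g1 g2. tlift H H X G (hpure C (h * g1) g2)) g"
        by (rule sw_map[OF _ X lG]; (intro lin)?; simp)
      also have "\<dots> = sw X (\<lambda>g1 x. sw X (\<lambda>a b. F (h * (g1 * S a)) b) x) g"
        using X bG by (simp add: tlift_pure) (simp add: G_def mult.assoc)
      also have "\<dots> = F (h * 1) g"
        by (rule sw_cancel_left[OF cancels_antip_right X, where F = "\<lambda>u b. F (h * u) b"]; (intro lin)?; simp)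
      finally show ?thesis by simp
    qed
  qed simp_all
  have z: "tlift H H X F n = vzero X" if n: "n \<in> N1 C" for n
  proof -
    have "tlift H H X G (can n) = vzero X"
    proof (rule vlinear_zero_on_vspan[OF is_vspace_HH X lG])
      show "can n \<in> vspan (HH C) {hpure C h q |h q. q \<in> QH C}" using n by (simp add: N1_def)
    qed (use X bG Fq in \<open>auto simp: tlift_pure G_def\<close>)
    then show ?thesis using FG[of n] n by (simp add: N1_def ker_mult_carr)
  qed
  note L = the_elem_coset[OF is_vspace_Km vsubspace_N1 X vlinear_vsub[OF vsubspace_ker_mult lF] z]
  show "vlinear O1 X (\<lambda>\<omega>. the_elem (tlift H H X F ` \<omega>))" unfolding Omega1_def
    by (rule vlinear_quot_map[OF is_vspace_Km vsubspace_N1 X vlinear_vsub[OF vsubspace_ker_mult lF] z])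
  assume t: "t \<in> carr (HH C)"
  have "the_elem (tlift H H X F ` tproj1 t) = tlift H H X F (vminus (HH C) t (hpure C (mult t) 1))"
    unfolding tproj1_def proj1_def by (rule L[OF _ mult_carr_part[OF t]])
  also have "\<dots> = tlift H H X F t"
    using vlinear_vminus[OF _ lF t, of "hpure C (mult t) 1"] X F vlinear_carr[OF lF t]
    by (simp add: tlift_pure F1)
  finally show "the_elem (tlift H H X F ` tproj1 t) = tlift H H X F t" .
qed

text \<open>A class in \<open>O1\<close> consists of elements of \<open>ker_mult C\<close>. So a
  formula that is meaningful only there may be replaced under the image by one that is linear on all
  of \<open>H \<otimes> H\<close>.\<close>

lemma Omega1_lift_image:
  assumes "\<omega> \<in> carr O1" "\<And>t. t \<in> ker_mult C \<Longrightarrow> f t = g t"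
  shows "the_elem (f ` \<omega>) = the_elem (g ` \<omega>)"
proof -
  have "f ` \<omega> = g ` \<omega>" using O1_subset[OF assms(1)] assms(2) by (intro image_cong) auto
  then show ?thesis by simp
qed

lemma O1_ext:
  assumes X: "is_vspace X" and f: "vlinear O1 X f" and g: "vlinear O1 X g"
    and eq: "\<And>a b. f (D a b) = g (D a b)" and \<omega>: "\<omega> \<in> carr O1"
  shows "f \<omega> = g \<omega>"
proof -
  obtain t where t: "t \<in> ker_mult C" "\<omega> = tproj1 t" using \<omega> by (rule tproj1_surj)
  have "f (tproj1 t) = g (tproj1 t)"
    by (rule tensor_ext[OF _ _ X vlinear_compose[OF f lin_tproj1] vlinear_compose[OF g lin_tproj1] _
      ker_mult_carr[OF t(1)]]) (simp_all add: eq flip: D_def)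
  then show ?thesis by (simp add: t)
qed

lemma lin_O1_cong:
  "(\<And>\<omega>. \<omega> \<in> carr O1 \<Longrightarrow> f \<omega> = g \<omega>) \<Longrightarrow> vlinear O1 X g \<Longrightarrow> vlinear O1 X f"
  using vlinear_cong[OF is_vspace_O1, of f g X] by simp

section \<open>The bimodule structure of \<open>\<Omega>^1\<close>\<close>

lemma bil_lact: "bil O1 (\<lambda>h g. D (a * h) g)"
  by (intro multilinear)

lemma lact1_tproj1: "t \<in> carr (HH C) \<Longrightarrow> lact1 C a (tproj1 t) = tlift H H O1 (\<lambda>h g. D (a * h) g) t"
  and lin_lact1: "vlinear O1 O1 (lact1 C a)"
proof -
  have e: "lact1 C a \<omega> = the_elem (tlift H H O1 (\<lambda>h g. D (a * h) g) ` \<omega>)" if "\<omega> \<in> carr O1" for \<omega>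
    unfolding lact1_def
  proof (rule Omega1_lift_image[OF that])
    fix t assume t: "t \<in> ker_mult C"
    note tc = ker_mult_carr[OF t]
    let ?t = "tlift H H (HH C) (\<lambda>h g. hpure C (a * h) g) t"
    have b: "bil (HH C) (\<lambda>h g. hpure C (a * h) g)" by (intro multilinear; simp)
    have "mult ?t = tlift H H H (\<lambda>h g. mult (hpure C (a * h) g)) t"
      by (rule tlift_compose[OF _ _ _ _ b lin_mult tc]) simp_all
    also have "\<dots> = a * mult t"
      by (rule tlift_eqI[OF _ _ _ _ vlinear_compose[OF _ lin_mult] _ tc]; (intro multilinear)?; simp add: mult.assoc)
    finally have "?t \<in> ker_mult C"
      using t vlinear_carr[OF vlinear_tlift[OF _ _ _ b] tc] by (simp add: ker_mult_def)
    then show "proj1 C ?t = tlift H H O1 (\<lambda>h g. D (a * h) g) t"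
      by (simp add: proj1_eq tproj1_tlift[OF tc b])
  qed
  have q: "sw O1 (\<lambda>x b. D (a * (h * S x)) b) q = vzero O1" if "q \<in> QH C" for h q
    using D_QH[OF that, of "a * h"] by (simp add: mult.assoc)
  note L = Omega1_lift[OF is_vspace_O1 bil_lact[of a] D_one q]
  show "t \<in> carr (HH C) \<Longrightarrow> lact1 C a (tproj1 t) = tlift H H O1 (\<lambda>h g. D (a * h) g) t"
    using L(1) by (simp add: e)
  show "vlinear O1 O1 (lact1 C a)" by (rule lin_O1_cong[OF e L(2)])
qed

lemma lact1_D [simp]: "lact1 C a (D h g) = D (a * h) g"
  unfolding D_def[of h g] using lact1_tproj1[of "hpure C h g" a] by (simp add: tlift_pure bil_lact)

lemma lin_lact1_left: "\<omega> \<in> carr O1 \<Longrightarrow> vlinear H O1 (\<lambda>a. lact1 C a \<omega>)"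
proof (elim tproj1_surj)
  fix t assume t: "t \<in> ker_mult C" "\<omega> = tproj1 t"
  have "vlinear H O1 (\<lambda>a. tlift H H O1 (\<lambda>h g. D (a * h) g) t)"
    by (rule vlinear_tlift_param[OF _ _ _ _ bil_lact _ ker_mult_carr[OF t(1)]]; (intro multilinear)?; simp)
  then show "vlinear H O1 (\<lambda>a. lact1 C a \<omega>)" by (simp add: t lact1_tproj1 ker_mult_carr)
qed

lemmas lin_lact1_comp [multilinear] = vlinear_compose[OF lin_lact1]

lemma lin_lact1_left_comp [multilinear]:
  "vlinear U H f \<Longrightarrow> \<omega> \<in> carr O1 \<Longrightarrow> vlinear U O1 (\<lambda>u. lact1 C (f u) \<omega>)"
  by (rule vlinear_compose[OF lin_lact1_left])

lemma lact1_carr [simp]: "\<omega> \<in> carr O1 \<Longrightarrow> lact1 C a \<omega> \<in> carr O1"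
  by (rule vlinear_carr[OF lin_lact1])

lemma bil_ract: "bil O1 (\<lambda>h g. vminus O1 (D h (g * a)) (D (h * g) a))"
  by (intro bilI vlinear_minus multilinear; simp)

text \<open>The summand is the Leibniz rule \<open>(h dg) a = h d(g a) - h g da\<close>. That the
  action descends to the quotient rests on \<open>QH C\<close> being a right ideal.\<close>

lemma ract1_tproj1: "t \<in> carr (HH C) \<Longrightarrow> ract1 C (tproj1 t) a
      = tlift H H O1 (\<lambda>h g. vminus O1 (D h (g * a)) (D (h * g) a)) t"
  and lin_ract1: "vlinear O1 O1 (\<lambda>\<omega>. ract1 C \<omega> a)"
proof -
  let ?F = "\<lambda>h g. vminus O1 (D h (g * a)) (D (h * g) a)"
  have e: "ract1 C \<omega> a = the_elem (tlift H H O1 ?F ` \<omega>)" if "\<omega> \<in> carr O1" for \<omega>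
    unfolding ract1_def
  proof (rule Omega1_lift_image[OF that])
    fix t assume t: "t \<in> ker_mult C"
    note tc = ker_mult_carr[OF t]
    let ?t = "tlift H H (HH C) (\<lambda>h g. hpure C h (g * a)) t"
    have b: "bil (HH C) (\<lambda>h g. hpure C h (g * a))" by (intro multilinear; simp)
    have b2: "bil O1 (\<lambda>h g. D h (g * a))" by (intro multilinear)
    have "mult ?t = tlift H H H (\<lambda>h g. mult (hpure C h (g * a))) t"
      by (rule tlift_compose[OF _ _ _ _ b lin_mult tc]) simp_all
    also have "\<dots> = mult t * a"
      by (rule tlift_eqI[OF _ _ _ _ vlinear_compose[OF _ lin_mult] _ tc]; (intro multilinear)?; simp add: mult.assoc)
    finally have "?t \<in> ker_mult C"
      using t vlinear_carr[OF vlinear_tlift[OF _ _ _ b] tc] by (simp add: ker_mult_def)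
    then have "proj1 C ?t = tlift H H O1 (\<lambda>h g. D h (g * a)) t"
      by (simp add: proj1_eq tproj1_tlift[OF tc b])
    \<comment> \<open>The second Leibniz term adds up to \<open>D (mult t) a\<close>, which is zero
      on \<open>ker_mult C\<close>; it is present so that the formula also holds for single
      \<open>D h g\<close>.\<close>
    moreover have "tlift H H O1 ?F t = vminus O1 (tlift H H O1 (\<lambda>h g. D h (g * a)) t) (D (mult t) a)"
      by (rule tlift_eqI[OF _ _ _ bil_ract _ _ tc])
         (simp_all add: tlift_pure b2 vlinear_minus[OF _ vlinear_tlift[OF _ _ _ b2]] lin_D lin_mult)
    moreover have "D 0 a = vzero O1"
      using vlinear_vzero[OF _ _ lin_D(1)[OF vlinear_ident], of a] by simp
    moreover have "mult t = 0" using t by (simp add: ker_mult_def)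
    moreover have "tlift H H O1 (\<lambda>h g. D h (g * a)) t \<in> carr O1"
      by (rule vlinear_carr[OF vlinear_tlift[OF _ _ _ b2] tc]) simp_all
    ultimately show "proj1 C ?t = tlift H H O1 ?F t" by simp
  qed
  have q: "sw O1 (\<lambda>x b. ?F (h * S x) b) q = vzero O1" if q: "q \<in> QH C" for h q
  proof -
    have "sw O1 (\<lambda>x b. ?F (h * S x) b) q
        = vminus O1 (sw O1 (\<lambda>x b. D (h * S x) (b * a)) q) (sw O1 (\<lambda>x b. D (h * S x * b) a) q)"
      by (rule sw_vminus; (intro multilinear)?; simp)
    also have "sw O1 (\<lambda>x b. D (h * S x * b) a) q = vzero O1"
      using q sw_cancel[OF cancels_antip_left, of O1 "\<lambda>u. D (h * u) a" q]
      by (simp add: mult.assoc multilinear counit_QH)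
    \<comment> \<open>Inserting \<open>a1 S(a2)\<close> combines \<open>S(a2) S(q1)\<close> into
      \<open>S(q1 a2)\<close>, so that only the product of \<open>q\<close> with legs of
      \<open>a\<close> occurs; it lies in \<open>QH C\<close>.\<close>
    also have "sw O1 (\<lambda>x b. D (h * S x) (b * a)) q
        = sw O1 (\<lambda>x b. sw O1 (\<lambda>a1 y. sw O1 (\<lambda>a2 a3. D (h * (a1 * S a2) * S x) (b * a3)) y) a) q"
    proof (rule sw_cong)
      fix x b
      have "sw O1 (\<lambda>a1 y. sw O1 (\<lambda>a2 a3. D (h * (a1 * S a2) * S x) (b * a3)) y) a = D (h * 1 * S x) (b * a)"
        by (rule sw_cancel_left[OF cancels_antip_right, where F = "\<lambda>u v. D (h * u * S x) (b * v)"];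
          (intro multilinear)?; simp)
      then show "D (h * S x) (b * a) = sw O1 (\<lambda>a1 y. sw O1 (\<lambda>a2 a3. D (h * (a1 * S a2) * S x) (b * a3)) y) a"
        by simp
    qed
    also have "\<dots> = sw O1 (\<lambda>a1 y. sw O1 (\<lambda>x b. sw O1 (\<lambda>a2 a3. D (h * (a1 * S a2) * S x) (b * a3)) y) q) a"
      by (rule sw_swap; (intro multilinear)?; simp)
    also have "\<dots> = sw O1 (\<lambda>a1 y. sw O1 (\<lambda>u v. D (h * a1 * S u) v) (q * y)) a"
    proof (rule sw_cong)
      fix a1 y
      have "sw O1 (\<lambda>u v. D (h * a1 * S u) v) (q * y)
          = sw O1 (\<lambda>x b. sw O1 (\<lambda>a2 a3. D (h * a1 * S (x * a2)) (b * a3)) y) q"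
        by (rule sw_mult; (intro multilinear)?; simp)
      then show "sw O1 (\<lambda>x b. sw O1 (\<lambda>a2 a3. D (h * (a1 * S a2) * S x) (b * a3)) y) q
          = sw O1 (\<lambda>u v. D (h * a1 * S u) v) (q * y)"
        by (simp add: antip_mult mult.assoc)
    qed
    also have "\<dots> = sw O1 (\<lambda>a1 y. vzero O1) a"
      by (rule sw_cong) (rule D_QH[OF QH_mult[OF q]])
    \<comment> \<open>A Sweedler sum of zeros is evaluated by pulling the scalar \<open>0\<close>
      out of it.\<close>
    also have "\<dots> = vscale O1 0 (sw O1 (\<lambda>a1 y. vzero O1) a)"
      using sw_map[of O1 O1 "vscale O1 0" "\<lambda>a1 y. vzero O1" a]
      by (simp add: vlinear_scale vlinear_ident bilI vlinear_zero)
    also have "\<dots> = vzero O1" by (simp add: bilI vlinear_zero)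
    finally show ?thesis by simp
  qed
  have F1: "?F h 1 = vzero O1" for h by simp
  note L = Omega1_lift[OF is_vspace_O1 bil_ract F1 q]
  show "t \<in> carr (HH C) \<Longrightarrow> ract1 C (tproj1 t) a = tlift H H O1 ?F t"
    using L(1) by (simp add: e)
  show "vlinear O1 O1 (\<lambda>\<omega>. ract1 C \<omega> a)" by (rule lin_O1_cong[OF e L(2)])
qed

lemma ract1_D: "ract1 C (D h g) a = vminus O1 (D h (g * a)) (D (h * g) a)"
  unfolding D_def[of h g] using ract1_tproj1[of "hpure C h g" a] by (simp add: tlift_pure bil_ract)

lemma lin_ract1_right: "\<omega> \<in> carr O1 \<Longrightarrow> vlinear H O1 (\<lambda>a. ract1 C \<omega> a)"
proof (elim tproj1_surj)
  fix t assume t: "t \<in> ker_mult C" "\<omega> = tproj1 t"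
  have "vlinear H O1 (\<lambda>a. tlift H H O1 (\<lambda>h g. vminus O1 (D h (g * a)) (D (h * g) a)) t)"
    by (rule vlinear_tlift_param[OF _ _ _ _ bil_ract _ ker_mult_carr[OF t(1)]];
      (intro vlinear_minus multilinear)?; simp)
  then show "vlinear H O1 (\<lambda>a. ract1 C \<omega> a)" by (simp add: t ract1_tproj1 ker_mult_carr)
qed

lemmas lin_ract1_comp [multilinear] = vlinear_compose[OF lin_ract1]

lemma lin_ract1_right_comp [multilinear]:
  "vlinear U H f \<Longrightarrow> \<omega> \<in> carr O1 \<Longrightarrow> vlinear U O1 (\<lambda>u. ract1 C \<omega> (f u))"
  by (rule vlinear_compose[OF lin_ract1_right])

lemma ract1_carr [simp]: "\<omega> \<in> carr O1 \<Longrightarrow> ract1 C \<omega> a \<in> carr O1"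
  by (rule vlinear_carr[OF lin_ract1])

lemma lact1_lact1: "\<omega> \<in> carr O1 \<Longrightarrow> lact1 C a (lact1 C b \<omega>) = lact1 C (a * b) \<omega>"
  by (rule O1_ext[where X = O1 and f = "\<lambda>\<omega>. lact1 C a (lact1 C b \<omega>)" and g = "\<lambda>\<omega>. lact1 C (a * b) \<omega>"]; (intro multilinear lin_lact1)?; simp add: mult.assoc)

lemma lact1_one [simp]: "\<omega> \<in> carr O1 \<Longrightarrow> lact1 C 1 \<omega> = \<omega>"
  by (rule O1_ext[where X = O1 and f = "\<lambda>\<omega>. lact1 C 1 \<omega>" and g = "\<lambda>\<omega>. \<omega>"]; (intro multilinear lin_lact1)?; simp)

lemma lact1_ract1: "\<omega> \<in> carr O1 \<Longrightarrow> lact1 C a (ract1 C \<omega> b) = ract1 C (lact1 C a \<omega>) b"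
  by (rule O1_ext[where X = O1 and f = "\<lambda>\<omega>. lact1 C a (ract1 C \<omega> b)" and g = "\<lambda>\<omega>. ract1 C (lact1 C a \<omega>) b"]; (intro multilinear lin_lact1 lin_ract1)?;
    simp add: ract1_D vlinear_vminus[OF _ lin_lact1] mult.assoc)

section \<open>The Maurer-Cartan form and freeness of the calculus\<close>

lemma eMC_p: "eMC C (p x) = sw O1 (\<lambda>a b. D (S a) b) x"
  and lin_eMC: "vlinear O0 O1 (eMC C)"
proof -
  let ?f = "\<lambda>x. proj1 C (sw (HH C) (\<lambda>x1 x2. hpure C (S x1) x2) x)"
  let ?g = "\<lambda>x. sw O1 (\<lambda>a b. D (S a) b) x"
  have fg: "?f x = ?g x" if "\<epsilon> x = 0" for x
  proof -
    let ?t = "sw (HH C) (\<lambda>x1 x2. hpure C (S x1) x2) x"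
    have t: "?t \<in> carr (HH C)" by (rule sw_carr; (intro multilinear)?; simp)
    have "mult ?t = sw H (\<lambda>a b. mult (hpure C (S a) b)) x"
      by (rule sw_map[OF _ _ lin_mult]; (intro multilinear)?; simp)
    also have "\<dots> = 0"
      using that cancels_antip_left by (simp add: cancels_def)
    finally have "proj1 C ?t = tproj1 ?t" using t by (simp add: proj1_eq ker_mult_def)
    also have "\<dots> = ?g x"
      unfolding D_def by (rule sw_map[OF _ _ lin_tproj1]; (intro multilinear)?; simp)
    finally show ?thesis .
  qed
  have lg: "vlinear H O1 ?g" by (intro multilinear; simp)
  have "?g 1 = vzero O1" by (subst sw_one; (intro multilinear)?; simp)
  moreover have gq: "?g q = vzero O1" if "q \<in> QH C" for q
    using D_QH[OF that, of 1] by simp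
  ultimately have L: "the_elem (?g ` p h) = ?g h" "vlinear O0 O1 (\<lambda>v. the_elem (?g ` v))" for h
    using Omega0_lift[OF is_vspace_O1 lg] by blast+
  \<comment> \<open>\<open>?f\<close> and \<open>?g\<close> agree on \<open>ker \<epsilon>\<close>,
    and the classes that make up \<open>\<Omega>_0\<close> are subsets of it.\<close>
  have e: "eMC C v = the_elem (?g ` v)" if "v \<in> carr O0" for v
  proof -
    have "v \<subseteq> ker_counit C"
      using that vplus_carr[OF is_vspace_Kv] vsubspace_carr[OF vsubspace_Kv_QH]
      by (auto simp: Omega0_def carr_quot coset_def)
    then have "?f ` v = ?g ` v" by (intro image_cong refl fg) (auto simp: ker_counit_def)
    then show ?thesis by (simp add: eMC_def)
  qed
  show "eMC C (p x) = ?g x" by (simp add: e L)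
  show "vlinear O0 O1 (eMC C)" using vlinear_cong[OF is_vspace_O0 e] L(2) by simp
qed

lemmas lin_eMC_comp [multilinear] = vlinear_compose[OF lin_eMC]

lemma eMC_carr [simp]: "v \<in> carr O0 \<Longrightarrow> eMC C v \<in> carr O1"
  by (rule vlinear_carr[OF lin_eMC])

lemma D_eq: "D h g = sw O1 (\<lambda>a b. lact1 C (h * a) (eMC C (p b))) g"
proof -
  have "lact1 C (h * a) (eMC C (p x)) = sw O1 (\<lambda>b c. D (h * (a * S b)) c) x" for a x
    unfolding eMC_p by (subst sw_map[OF _ _ lin_lact1]; (intro multilinear)?; simp add: mult.assoc)
  then have "sw O1 (\<lambda>a b. lact1 C (h * a) (eMC C (p b))) g = sw O1 (\<lambda>a x. sw O1 (\<lambda>b c. D (h * (a * S b)) c) x) g"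
    by simp
  also have "\<dots> = D (h * 1) g"
    by (rule sw_cancel_left[OF cancels_antip_right, where F = "\<lambda>u c. D (h * u) c"]; (intro multilinear)?; simp)
  finally show ?thesis by simp
qed

text \<open>The commutation relation \<open>e(v) a = a1 e(v a2)\<close>. For \<open>v\<close> the
  class of \<open>x\<close> in \<open>ker \<epsilon>\<close>, the left side is
  \<open>S(x1) d(x2 a)\<close>, because the other Leibniz term contains \<open>S(x1) x2 = 0\<close>.
  The right side is \<open>a1 S(a2) S(x1) d(x2 a3)\<close>, where \<open>a1 S(a2)\<close>
  cancels.\<close>

lemma eMC_ract1:
  assumes "v \<in> carr O0"
  shows "ract1 C (eMC C v) a = sw O1 (\<lambda>b c. lact1 C b (eMC C (ract0 C v c))) a"
proof -
  obtain x where x: "\<epsilon> x = 0" "v = p x" using assms by (rule p_surj)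
  have "ract1 C (eMC C v) a = sw O1 (\<lambda>x1 x2. ract1 C (D (S x1) x2) a) x"
    unfolding x eMC_p by (rule sw_map[OF _ _ lin_ract1]; (intro multilinear)?; simp)
  also have "\<dots> = vminus O1 (sw O1 (\<lambda>x1 x2. D (S x1) (x2 * a)) x) (sw O1 (\<lambda>x1 x2. D (S x1 * x2) a) x)"
    unfolding ract1_D by (rule sw_vminus; (intro multilinear)?; simp)
  also have "sw O1 (\<lambda>x1 x2. D (S x1 * x2) a) x = vzero O1"
    using sw_cancel[OF cancels_antip_left, of O1 "\<lambda>u. D u a" x]
    by (simp add: multilinear x)
  also have "vminus O1 (sw O1 (\<lambda>x1 x2. D (S x1) (x2 * a)) x) (vzero O1) = sw O1 (\<lambda>x1 x2. D (S x1) (x2 * a)) x"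
    by (rule vminus_vzero[OF is_vspace_O1 sw_carr]; (intro multilinear)?; simp)
  finally have 1: "ract1 C (eMC C v) a = sw O1 (\<lambda>x1 x2. D (S x1) (x2 * a)) x" .
  have "lact1 C b (eMC C (ract0 C v c)) = sw O1 (\<lambda>x1 x2. sw O1 (\<lambda>c1 c2. D (b * S c1 * S x1) (x2 * c2)) c) x" for b c
  proof -
    have "lact1 C b (eMC C (ract0 C v c)) = sw O1 (\<lambda>u w. D (b * S u) w) (x * c)"
      unfolding x ract0_p[OF x(1)] eMC_p
      by (subst sw_map[OF _ _ lin_lact1]; (intro multilinear)?; simp)
    also have "\<dots> = sw O1 (\<lambda>x1 x2. sw O1 (\<lambda>c1 c2. D (b * S (x1 * c1)) (x2 * c2)) c) x"
      by (rule sw_mult; (intro multilinear)?; simp)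
    finally show ?thesis by (simp add: antip_mult mult.assoc)
  qed
  then have "sw O1 (\<lambda>b c. lact1 C b (eMC C (ract0 C v c))) a
      = sw O1 (\<lambda>b c. sw O1 (\<lambda>x1 x2. sw O1 (\<lambda>c1 c2. D (b * S c1 * S x1) (x2 * c2)) c) x) a" by simp
  also have "\<dots> = sw O1 (\<lambda>x1 x2. sw O1 (\<lambda>b c. sw O1 (\<lambda>c1 c2. D (b * S c1 * S x1) (x2 * c2)) c) a) x"
    by (rule sw_swap; (intro multilinear)?; simp)
  also have "\<dots> = sw O1 (\<lambda>x1 x2. D (1 * S x1) (x2 * a)) x"
    by (rule sw_cong, rule sw_cancel_left[OF cancels_antip_right, where F = "\<lambda>u w. D (u * S _) (_ * w)"];
      (intro multilinear)?; simp)
  finally show ?thesis using 1 by simp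
qed

lemma O1_ext_eMC:
  assumes X: "is_vspace X" and f: "vlinear O1 X f" and g: "vlinear O1 X g"
    and eq: "\<And>h v. v \<in> carr O0 \<Longrightarrow> f (lact1 C h (eMC C v)) = g (lact1 C h (eMC C v))"
    and \<omega>: "\<omega> \<in> carr O1"
  shows "f \<omega> = g \<omega>"
proof (rule O1_ext[OF X f g _ \<omega>])
  fix a b
  have b: "bil O1 (\<lambda>b1 b2. lact1 C (a * b1) (eMC C (p b2)))" by (intro multilinear; simp)
  show "f (D a b) = g (D a b)"
    unfolding D_eq sw_map[OF is_vspace_O1 X f b] sw_map[OF is_vspace_O1 X g b] by (simp add: eq)
qed

text \<open>As a left module \<open>\<Omega>\<^sup>1\<close> is free on \<open>\<Omega>\<^sub>0\<close>: \<open>llift X J\<close> is the linear map with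
  \<open>h e(v) \<mapsto> J v h\<close>.\<close>

definition llift :: "('k, 'x) vspace \<Rightarrow> ('h set \<Rightarrow> 'h \<Rightarrow> 'x) \<Rightarrow> ('k, 'h, 'h) tens set \<Rightarrow> 'x"
  where "llift X J \<omega> = the_elem (tlift H H X (\<lambda>h g. sw X (\<lambda>g1 g2. J (p g2) (h * g1)) g) ` \<omega>)"

text \<open>\<open>Omega1_lift\<close> applies to \<open>h dg \<mapsto> J (p g2) (h g1)\<close>: on
  \<open>h S(q1) dq2\<close> the factors \<open>S(q1) q2\<close> cancel and leave
  \<open>J (p q) h\<close>, which is zero for \<open>q\<close> in \<open>QH C\<close>. The same
  cancellation computes the value on \<open>h e(v)\<close>.\<close>

lemma
  assumes X: "is_vspace X" and J: "vbilinear O0 H X J"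
  shows lin_llift: "vlinear O1 X (llift X J)"
    and llift_tproj1: "t \<in> carr (HH C) \<Longrightarrow>
      llift X J (tproj1 t) = tlift H H X (\<lambda>h g. sw X (\<lambda>g1 g2. J (p g2) (h * g1)) g) t"
    and bil_llift: "bil X (\<lambda>h g. sw X (\<lambda>g1 g2. J (p g2) (h * g1)) g)"
    and llift_lact1_eMC: "v \<in> carr O0 \<Longrightarrow> llift X J (lact1 C h (eMC C v)) = J v h"
proof -
  note lin = multilinear bil_p[OF J]
  let ?F = "\<lambda>h g. sw X (\<lambda>g1 g2. J (p g2) (h * g1)) g"
  have J0: "J (vzero O0) h = vzero X" for h
    by (rule vlinear_vzero[OF is_vspace_O0 X vbilinear_left[OF J]]) simp
  have F: "bil X ?F" by (intro lin; simp add: X)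
  have S: "sw X (\<lambda>a b. ?F (h * S a) b) q = J (p q) h" for h q
  proof -
    have "sw X (\<lambda>a b. ?F (h * S a) b) q = sw X (\<lambda>a b. sw X (\<lambda>g1 g2. J (p g2) (h * (S a * g1))) b) q"
      by (simp add: mult.assoc)
    also have "\<dots> = J (p q) (h * 1)"
      by (rule sw_cancel_left[OF cancels_antip_left X, where F = "\<lambda>u g. J (p g) (h * u)"]; (intro lin)?; simp)
    finally show ?thesis by simp
  qed
  have F1: "?F h 1 = vzero X" for h
    by (subst sw_one; (intro lin)?; simp add: X J0)
  have Fq: "sw X (\<lambda>a b. ?F (h * S a) b) q = vzero X" if "q \<in> QH C" for h q
    using that by (simp add: S p_QH J0)
  note L = Omega1_lift[OF X F F1 Fq]
  show l: "vlinear O1 X (llift X J)" using L(2) unfolding llift_def[abs_def] by simp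
  show t: "llift X J (tproj1 t) = tlift H H X ?F t" if "t \<in> carr (HH C)" for t
    unfolding llift_def by (rule L(1)[OF _ that])
  show "bil X ?F" by (rule F)
  show "llift X J (lact1 C h (eMC C v)) = J v h" if "v \<in> carr O0" for v
  proof -
    obtain x where x: "v = p x" using \<open>v \<in> carr O0\<close> by (elim p_surj)
    have "lact1 C h (eMC C v) = sw O1 (\<lambda>a b. D (h * S a) b) x"
      unfolding x eMC_p by (subst sw_map[OF _ _ lin_lact1]; (intro multilinear)?; simp)
    also have "llift X J \<dots> = sw X (\<lambda>a b. llift X J (D (h * S a) b)) x"
      by (rule sw_map[OF _ X l]; (intro multilinear)?; simp)
    also have "\<dots> = sw X (\<lambda>a b. ?F (h * S a) b) x"
      using X F by (simp add: D_def t tlift_pure)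
    finally show ?thesis by (simp add: S x)
  qed
qed

lemma lin_llift_param:
  assumes X: "is_vspace X" and U: "is_vspace U" and J: "\<And>u. u \<in> carr U \<Longrightarrow> vbilinear O0 H X (J u)"
    and l: "\<And>v h. v \<in> carr O0 \<Longrightarrow> vlinear U X (\<lambda>u. J u v h)" and \<omega>: "\<omega> \<in> carr O1"
  shows "vlinear U X (\<lambda>u. llift X (J u) \<omega>)"
proof -
  obtain t where t: "t \<in> ker_mult C" "\<omega> = tproj1 t" using \<omega> by (rule tproj1_surj)
  note tc = ker_mult_carr[OF t(1)]
  have "vlinear U X (\<lambda>u. tlift H H X (\<lambda>h g. sw X (\<lambda>g1 g2. J u (p g2) (h * g1)) g) t)"
    by (rule vlinear_tlift_param[OF _ _ X U bil_llift[OF X J] _ tc];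
      (intro lin_sw_param l multilinear bil_p[OF J])?; simp add: X U)
  then show ?thesis
    by (rule iffD1[OF vlinear_cong[OF U], rotated]) (simp add: t llift_tproj1[OF X J tc])
qed

section \<open>\<open>\<Omega>\<^sup>1 \<otimes>\<^sub>H \<Omega>\<^sup>1\<close>\<close>

abbreviation "O1O1 \<equiv> tensor O1 O1"
abbreviation "O11 \<equiv> Omega11 C"

lemma is_vspace_O1O1 [simp]: "is_vspace O1O1"
  by (rule is_vspace_tensor) simp_all

lemma pure11_carr [simp]: "\<omega> \<in> carr O1 \<Longrightarrow> \<zeta> \<in> carr O1 \<Longrightarrow> pure O1 O1 \<omega> \<zeta> \<in> carr O1O1"
  by (rule pure_carr) simp_all

lemma vsubspace_balanced: "vsubspace O1O1 (balanced_rels C)"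
  unfolding balanced_rels_def by (rule vsubspace_vspan) auto

lemma is_vspace_O11 [simp]: "is_vspace O11"
  unfolding Omega11_def by (rule is_vspace_quot[OF is_vspace_O1O1 vsubspace_balanced])

lemma lin_proj11: "vlinear O1O1 O11 (proj11 C)"
  unfolding Omega11_def proj11_def[abs_def] by (rule vlinear_coset[OF is_vspace_O1O1 vsubspace_balanced])

lemma proj11_surj: assumes "s \<in> carr O11" obtains t where "t \<in> carr O1O1" "s = proj11 C t"
  using assms by (auto simp: Omega11_def carr_quot proj11_def)

lemma lin_pureH [multilinear]:
  "vlinear U O1 f \<Longrightarrow> \<zeta> \<in> carr O1 \<Longrightarrow> vlinear U O11 (\<lambda>u. pureH C (f u) \<zeta>)"
  "vlinear U O1 f \<Longrightarrow> \<omega> \<in> carr O1 \<Longrightarrow> vlinear U O11 (\<lambda>u. pureH C \<omega> (f u))"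
  unfolding pureH_def by (rule vlinear_compose[OF lin_proj11]; intro multilinear; simp)+

lemma bil_pureH: "vbilinear O1 O1 O11 (pureH C)"
  by (intro vbilinearI multilinear)

lemma pureH_carr [simp]: "\<omega> \<in> carr O1 \<Longrightarrow> \<zeta> \<in> carr O1 \<Longrightarrow> pureH C \<omega> \<zeta> \<in> carr O11"
  by (rule vbilinear_carr[OF bil_pureH])

lemma pureH_balance:
  "\<omega> \<in> carr O1 \<Longrightarrow> \<zeta> \<in> carr O1 \<Longrightarrow> pureH C (ract1 C \<omega> a) \<zeta> = pureH C \<omega> (lact1 C a \<zeta>)"
  unfolding pureH_def proj11_def
  by (subst coset_eq_iff[OF is_vspace_O1O1 vsubspace_balanced])
     (auto simp: balanced_rels_def intro!: vspan_superset)

lemma O11_ext: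
  assumes X: "is_vspace X" and f: "vlinear O11 X f" and g: "vlinear O11 X g"
    and eq: "\<And>\<omega> \<zeta>. \<omega> \<in> carr O1 \<Longrightarrow> \<zeta> \<in> carr O1 \<Longrightarrow> f (pureH C \<omega> \<zeta>) = g (pureH C \<omega> \<zeta>)"
    and s: "s \<in> carr O11"
  shows "f s = g s"
proof -
  obtain t where t: "t \<in> carr O1O1" "s = proj11 C t" using s by (rule proj11_surj)
  have "f (proj11 C t) = g (proj11 C t)"
    by (rule tensor_ext[OF _ _ X vlinear_compose[OF f lin_proj11] vlinear_compose[OF g lin_proj11] _ t(1)])
       (simp_all add: eq flip: pureH_def)
  then show ?thesis by (simp add: t)
qed

text \<open>The universal property of the tensor product over \<open>H\<close>: a bilinear map
  compatible with the two inner actions kills the generators of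
  \<open>balanced_rels\<close>.\<close>

lemma
  assumes X: "is_vspace X" and F: "vbilinear O1 O1 X F"
    and bal: "\<And>\<omega> \<zeta> a. \<omega> \<in> carr O1 \<Longrightarrow> \<zeta> \<in> carr O1 \<Longrightarrow> F (ract1 C \<omega> a) \<zeta> = F \<omega> (lact1 C a \<zeta>)"
  shows O11_lift_proj11: "t \<in> carr O1O1 \<Longrightarrow> the_elem (tlift O1 O1 X F ` proj11 C t) = tlift O1 O1 X F t"
    and O11_lift_pureH: "\<omega> \<in> carr O1 \<Longrightarrow> \<zeta> \<in> carr O1 \<Longrightarrow>
      the_elem (tlift O1 O1 X F ` pureH C \<omega> \<zeta>) = F \<omega> \<zeta>"
    and lin_O11_lift: "vlinear O11 X (\<lambda>s. the_elem (tlift O1 O1 X F ` s))"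
proof -
  note lF = vlinear_tlift[OF is_vspace_O1 is_vspace_O1 X F]
  have z: "tlift O1 O1 X F n = vzero X" if n: "n \<in> balanced_rels C" for n
    using n unfolding balanced_rels_def
  proof (rule vlinear_zero_on_vspan[OF is_vspace_O1O1 X lF, rotated 2])
    fix r
    assume "r \<in> {vminus O1O1 (pure O1 O1 (ract1 C \<omega> a) \<zeta>) (pure O1 O1 \<omega> (lact1 C a \<zeta>)) |\<omega> a \<zeta>.
        \<omega> \<in> carr O1 \<and> \<zeta> \<in> carr O1}"
    then obtain \<omega> a \<zeta> where r: "\<omega> \<in> carr O1" "\<zeta> \<in> carr O1"
      "r = vminus O1O1 (pure O1 O1 (ract1 C \<omega> a) \<zeta>) (pure O1 O1 \<omega> (lact1 C a \<zeta>))" by auto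
    then show "tlift O1 O1 X F r = vzero X"
      using X vbilinear_carr[OF F] by (simp add: vlinear_vminus[OF _ lF] tlift_pure F bal)
  qed auto
  show e: "t \<in> carr O1O1 \<Longrightarrow> the_elem (tlift O1 O1 X F ` proj11 C t) = tlift O1 O1 X F t" for t
    unfolding proj11_def by (rule the_elem_coset[OF is_vspace_O1O1 vsubspace_balanced X lF z])
  show "\<omega> \<in> carr O1 \<Longrightarrow> \<zeta> \<in> carr O1 \<Longrightarrow> the_elem (tlift O1 O1 X F ` pureH C \<omega> \<zeta>) = F \<omega> \<zeta>"
    unfolding pureH_def using X F by (simp add: e tlift_pure)
  show "vlinear O11 X (\<lambda>s. the_elem (tlift O1 O1 X F ` s))"
    unfolding Omega11_def by (rule vlinear_quot_map[OF is_vspace_O1O1 vsubspace_balanced X lF z])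
qed

lemma bil_lact11: "vbilinear O1 O1 O11 (\<lambda>\<omega> \<zeta>. pureH C (lact1 C a \<omega>) \<zeta>)"
  by (intro vbilinearI multilinear lin_lact1; simp)

lemma lact11_proj11: "t \<in> carr O1O1 \<Longrightarrow>
      lact11 C a (proj11 C t) = tlift O1 O1 O11 (\<lambda>\<omega> \<zeta>. pureH C (lact1 C a \<omega>) \<zeta>) t"
  and lact11_pureH [simp]: "\<omega> \<in> carr O1 \<Longrightarrow> \<zeta> \<in> carr O1 \<Longrightarrow>
      lact11 C a (pureH C \<omega> \<zeta>) = pureH C (lact1 C a \<omega>) \<zeta>"
  and lin_lact11: "vlinear O11 O11 (lact11 C a)"
proof -
  have b: "pureH C (lact1 C a (ract1 C \<omega> b)) \<zeta> = pureH C (lact1 C a \<omega>) (lact1 C b \<zeta>)"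
    if "\<omega> \<in> carr O1" "\<zeta> \<in> carr O1" for \<omega> \<zeta> b
    using that by (simp add: lact1_ract1 pureH_balance)
  show "t \<in> carr O1O1 \<Longrightarrow>
      lact11 C a (proj11 C t) = tlift O1 O1 O11 (\<lambda>\<omega> \<zeta>. pureH C (lact1 C a \<omega>) \<zeta>) t"
    unfolding lact11_def by (rule O11_lift_proj11[OF is_vspace_O11 bil_lact11 b])
  show "\<omega> \<in> carr O1 \<Longrightarrow> \<zeta> \<in> carr O1 \<Longrightarrow> lact11 C a (pureH C \<omega> \<zeta>) = pureH C (lact1 C a \<omega>) \<zeta>"
    unfolding lact11_def by (rule O11_lift_pureH[OF is_vspace_O11 bil_lact11 b])
  show "vlinear O11 O11 (lact11 C a)"
    unfolding lact11_def[abs_def] by (rule lin_O11_lift[OF is_vspace_O11 bil_lact11 b])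
qed

lemma bil_ract11: "vbilinear O1 O1 O11 (\<lambda>\<omega> \<zeta>. pureH C \<omega> (ract1 C \<zeta> a))"
  by (intro vbilinearI multilinear lin_ract1; simp)

lemma ract11_pureH [simp]: "\<omega> \<in> carr O1 \<Longrightarrow> \<zeta> \<in> carr O1 \<Longrightarrow>
      ract11 C (pureH C \<omega> \<zeta>) a = pureH C \<omega> (ract1 C \<zeta> a)"
  and lin_ract11: "vlinear O11 O11 (\<lambda>s. ract11 C s a)"
proof -
  have b: "pureH C (ract1 C \<omega> b) (ract1 C \<zeta> a) = pureH C \<omega> (ract1 C (lact1 C b \<zeta>) a)"
    if "\<omega> \<in> carr O1" "\<zeta> \<in> carr O1" for \<omega> \<zeta> b
    using that by (simp add: pureH_balance flip: lact1_ract1)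
  show "\<omega> \<in> carr O1 \<Longrightarrow> \<zeta> \<in> carr O1 \<Longrightarrow> ract11 C (pureH C \<omega> \<zeta>) a = pureH C \<omega> (ract1 C \<zeta> a)"
    unfolding ract11_def by (rule O11_lift_pureH[OF is_vspace_O11 bil_ract11 b])
  show "vlinear O11 O11 (\<lambda>s. ract11 C s a)"
    unfolding ract11_def by (rule lin_O11_lift[OF is_vspace_O11 bil_ract11 b])
qed

lemmas lin_act11_comp [multilinear] = vlinear_compose[OF lin_lact11] vlinear_compose[OF lin_ract11]

lemma lact11_carr [simp]: "s \<in> carr O11 \<Longrightarrow> lact11 C a s \<in> carr O11"
  and ract11_carr [simp]: "s \<in> carr O11 \<Longrightarrow> ract11 C s a \<in> carr O11"
  by (auto intro: vlinear_carr[OF lin_lact11] vlinear_carr[OF lin_ract11])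

lemma lin_lact11_left: "s \<in> carr O11 \<Longrightarrow> vlinear H O11 (\<lambda>a. lact11 C a s)"
proof (elim proj11_surj)
  fix t assume t: "t \<in> carr O1O1" "s = proj11 C t"
  have "vlinear H O11 (\<lambda>a. tlift O1 O1 O11 (\<lambda>\<omega> \<zeta>. pureH C (lact1 C a \<omega>) \<zeta>) t)"
    by (rule vlinear_tlift_param[OF _ _ _ _ bil_lact11 _ t(1)]; (intro multilinear)?; simp)
  then show "vlinear H O11 (\<lambda>a. lact11 C a s)" by (simp add: t lact11_proj11)
qed

lemma lin_lact11_left_comp [multilinear]:
  "vlinear U H f \<Longrightarrow> s \<in> carr O11 \<Longrightarrow> vlinear U O11 (\<lambda>u. lact11 C (f u) s)"
  by (rule vlinear_compose[OF lin_lact11_left])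

lemma lact11_lact11: "s \<in> carr O11 \<Longrightarrow> lact11 C a (lact11 C b s) = lact11 C (a * b) s"
  by (rule O11_ext[where X = O11 and f = "\<lambda>s. lact11 C a (lact11 C b s)" and g = "\<lambda>s. lact11 C (a * b) s"];
    (intro multilinear lin_lact11)?; simp add: lact1_lact1)

lemma lact11_one [simp]: "s \<in> carr O11 \<Longrightarrow> lact11 C 1 s = s"
  by (rule O11_ext[where X = O11 and f = "\<lambda>s. lact11 C 1 s" and g = "\<lambda>s. s"];
    (intro multilinear lin_lact11)?; simp)

lemma lact11_ract11: "s \<in> carr O11 \<Longrightarrow> lact11 C a (ract11 C s b) = ract11 C (lact11 C a s) b"
  by (rule O11_ext[where X = O11 and f = "\<lambda>s. lact11 C a (ract11 C s b)" and g = "\<lambda>s. ract11 C (lact11 C a s) b"];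
    (intro multilinear lin_lact11 lin_ract11)?; simp)

section \<open>The Maurer-Cartan form on both tensor factors\<close>

lemma bil_eMC2: "vbilinear O0 O0 O11 (\<lambda>v w. pureH C (eMC C v) (eMC C w))"
  by (intro vbilinearI multilinear lin_eMC; simp)

lemma lin_eMC2: "vlinear O00 O11 (eMC2 C)"
  and eMC2_pure: "v \<in> carr O0 \<Longrightarrow> w \<in> carr O0 \<Longrightarrow> eMC2 C (pure O0 O0 v w) = pureH C (eMC C v) (eMC C w)"
  unfolding eMC2_def using bil_eMC2 by (auto intro: vlinear_tlift simp: tlift_pure)

lemma eMC2_carr [simp]: "t \<in> carr O00 \<Longrightarrow> eMC2 C t \<in> carr O11"
  by (rule vlinear_carr[OF lin_eMC2])

lemma pureH_zero_left: "\<zeta> \<in> carr O1 \<Longrightarrow> pureH C (vzero O1) \<zeta> = vzero O11"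
  using vlinear_vzero[OF _ _ vbilinear_left[OF bil_pureH]] by simp

section \<open>Existence and uniqueness of the braiding on \<open>\<Omega>\<^sup>1 \<otimes>\<^sub>H \<Omega>\<^sup>1\<close>\<close>

text \<open>\<open>braid_e v \<zeta>\<close> is the braiding of \<open>e(v) \<otimes> \<zeta>\<close>: moving \<open>e(v)\<close> past
  \<open>h dg\<close> gives \<open>h\<^sub>(\<^sub>1\<^sub>) dg\<^sub>(\<^sub>1\<^sub>) \<otimes> e(v h\<^sub>(\<^sub>2\<^sub>) g\<^sub>(\<^sub>2\<^sub>))\<close>.\<close>

definition braid_hdg :: "'h set \<Rightarrow> 'h \<Rightarrow> 'h \<Rightarrow> ('k, 'h) tens11"
  where "braid_hdg v h g = sw O11 (\<lambda>h1 h2. sw O11 (\<lambda>g1 g2.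
    pureH C (D h1 g1) (eMC C (ract0 C v (h2 * g2)))) g) h"

definition braid_e :: "'h set \<Rightarrow> ('k, 'h, 'h) tens set \<Rightarrow> ('k, 'h) tens11"
  where "braid_e v \<zeta> = the_elem (tlift H H O11 (braid_hdg v) ` \<zeta>)"

lemma bil_braid_hdg: "v \<in> carr O0 \<Longrightarrow> bil O11 (braid_hdg v)"
  unfolding braid_hdg_def by (intro multilinear; simp)

lemma lin_braid_hdg: "vlinear O0 O11 (\<lambda>v. braid_hdg v h g)"
  unfolding braid_hdg_def by (intro multilinear; simp)

text \<open>\<open>S\<close> reverses the coproduct of the first leg of \<open>q\<close>, so
  \<open>S(q2) dq3\<close> comes together in the left factor, where it is \<open>e(p x)\<close> for
  the middle leg \<open>x\<close>, and \<open>S(q1) q4\<close> in the right one. Thus the braiding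
  of \<open>e(v)\<close> with \<open>h S(q1) dq2\<close> sees \<open>q\<close> only through
  \<open>Ad(q)\<close>. This gives both that the braiding descends to the calculus and that it
  restricts to \<open>Psi0\<close>.\<close>

lemma braid_hdg_antip:
  assumes v: "v \<in> carr O0"
  shows "sw O11 (\<lambda>a b. braid_hdg v (h * S a) b) q = sw O11 (\<lambda>h1 h2. sw O11 (\<lambda>a y. sw O11 (\<lambda>x c.
    pureH C (lact1 C h1 (eMC C (p x))) (eMC C (ract0 C v (h2 * (S a * c))))) y) q) h"
proof -
  let ?E = "\<lambda>h1 h2 a1 a2 g1 g2. pureH C (D (h1 * S a2) g1) (eMC C (ract0 C v (h2 * (S a1 * g2))))"
  note [simp] = v
  have "braid_hdg v (h * S a) b = sw O11 (\<lambda>h1 h2. sw O11 (\<lambda>a1 a2. sw O11 (\<lambda>g1 g2. ?E h1 h2 a1 a2 g1 g2) b) a) h" for a b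
  proof -
    have "braid_hdg v (h * S a) b = sw O11 (\<lambda>h1 h2. sw O11 (\<lambda>u1 u2. sw O11 (\<lambda>g1 g2.
        pureH C (D (h1 * u1) g1) (eMC C (ract0 C v (h2 * u2 * g2)))) b) (S a)) h"
      unfolding braid_hdg_def by (rule sw_mult; (intro multilinear)?; simp)
    also have "\<dots> = sw O11 (\<lambda>h1 h2. sw O11 (\<lambda>a1 a2. sw O11 (\<lambda>g1 g2.
        pureH C (D (h1 * S a2) g1) (eMC C (ract0 C v (h2 * S a1 * g2)))) b) a) h"
      by (rule sw_cong, rule sw_antip; (intro multilinear)?; simp)
    finally show ?thesis by (simp add: mult.assoc)
  qed
  then have "sw O11 (\<lambda>a b. braid_hdg v (h * S a) b) q
      = sw O11 (\<lambda>a b. sw O11 (\<lambda>h1 h2. sw O11 (\<lambda>a1 a2. sw O11 (\<lambda>g1 g2. ?E h1 h2 a1 a2 g1 g2) b) a) h) q" by simp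
  also have "\<dots> = sw O11 (\<lambda>h1 h2. sw O11 (\<lambda>a b. sw O11 (\<lambda>a1 a2. sw O11 (\<lambda>g1 g2. ?E h1 h2 a1 a2 g1 g2) b) a) q) h"
    by (rule sw_swap; (intro multilinear)?; simp)
  also have "\<dots> = sw O11 (\<lambda>h1 h2. sw O11 (\<lambda>a1 z. sw O11 (\<lambda>a2 b. sw O11 (\<lambda>g1 g2. ?E h1 h2 a1 a2 g1 g2) b) z) q) h"
    by (rule sw_cong, rule sw_assoc; (intro multilinear)?; simp)
  also have "\<dots> = sw O11 (\<lambda>h1 h2. sw O11 (\<lambda>a1 z. sw O11 (\<lambda>x g2. sw O11 (\<lambda>a2 g1. ?E h1 h2 a1 a2 g1 g2) x) z) q) h"
    by (rule sw_cong, rule sw_cong, rule sw_assoc[symmetric]; (intro multilinear)?; simp)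
  also have "\<dots> = sw O11 (\<lambda>h1 h2. sw O11 (\<lambda>a1 z. sw O11 (\<lambda>x g2.
      pureH C (lact1 C h1 (eMC C (p x))) (eMC C (ract0 C v (h2 * (S a1 * g2))))) z) q) h"
  proof -
    have "sw O11 (\<lambda>a2 g1. pureH C (D (h1 * S a2) g1) \<zeta>) x = pureH C (lact1 C h1 (eMC C (p x))) \<zeta>"
      if "\<zeta> \<in> carr O1" for h1 x \<zeta>
    proof -
      have "lact1 C h1 (eMC C (p x)) = sw O1 (\<lambda>a b. D (h1 * S a) b) x"
        unfolding eMC_p by (subst sw_map[OF _ _ lin_lact1]; (intro multilinear)?; simp)
      moreover have "pureH C (sw O1 (\<lambda>a b. D (h1 * S a) b) x) \<zeta> = sw O11 (\<lambda>a b. pureH C (D (h1 * S a) b) \<zeta>) x"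
        by (rule sw_map[where f = "\<lambda>\<omega>. pureH C \<omega> \<zeta>", OF _ _ vbilinear_left[OF bil_pureH that]];
          (intro multilinear)?; simp)
      ultimately show ?thesis by simp
    qed
    then show ?thesis by simp
  qed
  finally show ?thesis .
qed

text \<open>By \<open>braid_hdg_antip\<close> the relation for \<open>q\<close> in
  \<open>QH C\<close> becomes a test map on \<open>Ad(q)\<close>, which \<open>Ad_QH\<close>
  annihilates.\<close>

lemma braid_e_tproj1: "v \<in> carr O0 \<Longrightarrow> t \<in> carr (HH C) \<Longrightarrow> braid_e v (tproj1 t) = tlift H H O11 (braid_hdg v) t"
  and lin_braid_e_right: "v \<in> carr O0 \<Longrightarrow> vlinear O1 O11 (braid_e v)"
proof -
  assume v: "v \<in> carr O0"
  note [simp] = v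
  have F1: "braid_hdg v h 1 = vzero O11" for h
  proof -
    \<comment> \<open>The zero summand is written with a factor \<open>\<epsilon> h1\<close> so that
      \<open>sw_counit_left\<close> applies, with the constant zero map as \<open>f\<close>.\<close>
    have "braid_hdg v h 1 = sw O11 (\<lambda>h1 h2. vscale O11 (\<epsilon> h1) (vzero O11)) h"
      unfolding braid_hdg_def by (rule sw_cong, subst sw_one; (intro multilinear)?; simp add: pureH_zero_left)
    also have "\<dots> = vzero O11"
      by (rule sw_counit_left[where f = "\<lambda>h. vzero O11"]) (simp_all add: vlinear_zero)
    finally show ?thesis .
  qed
  have Fq: "sw O11 (\<lambda>a b. braid_hdg v (h * S a) b) q = vzero O11" if q: "q \<in> QH C" for h q
  proof -
    have "sw O11 (\<lambda>a y. sw O11 (\<lambda>x c.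
        pureH C (lact1 C h1 (eMC C (p x))) (eMC C (ract0 C v (h2 * (S a * c))))) y) q = vzero O11" for h1 h2
      by (rule Ad_QH[where F = "\<lambda>x z. pureH C (lact1 C h1 (eMC C (p x))) (eMC C (ract0 C v (h2 * z)))", OF _ _ _ _ q];
        (intro multilinear)?; simp add: p_QH vlinear_vzero[OF _ _ lin_eMC] vlinear_vzero[OF _ _ lin_lact1] pureH_zero_left)
    then have "sw O11 (\<lambda>a b. braid_hdg v (h * S a) b) q = sw O11 (\<lambda>h1 h2. vscale O11 (\<epsilon> h1) (vzero O11)) h"
      by (simp add: braid_hdg_antip)
    also have "\<dots> = vzero O11"
      by (rule sw_counit_left[where f = "\<lambda>h. vzero O11"]) (simp_all add: vlinear_zero)
    finally show ?thesis .
  qed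
  note L = Omega1_lift[OF is_vspace_O11 bil_braid_hdg[OF v] F1 Fq]
  show "t \<in> carr (HH C) \<Longrightarrow> braid_e v (tproj1 t) = tlift H H O11 (braid_hdg v) t"
    unfolding braid_e_def by (rule L(1))
  show "vlinear O1 O11 (braid_e v)" unfolding braid_e_def[abs_def] by (rule L(2))
qed

lemma lin_braid_e_left: "\<zeta> \<in> carr O1 \<Longrightarrow> vlinear O0 O11 (\<lambda>v. braid_e v \<zeta>)"
proof (elim tproj1_surj)
  fix t assume t: "t \<in> ker_mult C" "\<zeta> = tproj1 t"
  have "vlinear O0 O11 (\<lambda>v. tlift H H O11 (braid_hdg v) t)"
    by (rule vlinear_tlift_param[OF _ _ _ _ bil_braid_hdg lin_braid_hdg ker_mult_carr[OF t(1)]]) simp_all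
  then show "vlinear O0 O11 (\<lambda>v. braid_e v \<zeta>)"
    by (rule iffD1[OF vlinear_cong[OF is_vspace_O0], rotated]) (simp add: t braid_e_tproj1 ker_mult_carr)
qed

lemma lin_braid_e_comp [multilinear]:
  "vlinear U O0 f \<Longrightarrow> \<zeta> \<in> carr O1 \<Longrightarrow> vlinear U O11 (\<lambda>u. braid_e (f u) \<zeta>)"
  "vlinear U O1 g \<Longrightarrow> v \<in> carr O0 \<Longrightarrow> vlinear U O11 (\<lambda>u. braid_e v (g u))"
  by (rule vlinear_compose[OF lin_braid_e_left], assumption+)
     (rule vlinear_compose[OF lin_braid_e_right], assumption+)

lemma braid_e_carr [simp]: "v \<in> carr O0 \<Longrightarrow> \<zeta> \<in> carr O1 \<Longrightarrow> braid_e v \<zeta> \<in> carr O11"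
  by (rule vlinear_carr[OF lin_braid_e_right])

lemma braid_e_D: "v \<in> carr O0 \<Longrightarrow> braid_e v (D h g) = braid_hdg v h g"
  by (simp add: D_def braid_e_tproj1 tlift_pure bil_braid_hdg)

text \<open>Since \<open>e(v) a = a1 e(v a2)\<close>, this is what a left-linear map compatible with
  balancing must satisfy; it follows from the multiplicativity of the coproduct.\<close>

lemma braid_e_lact1:
  assumes v: "v \<in> carr O0" and \<zeta>: "\<zeta> \<in> carr O1"
  shows "braid_e v (lact1 C a \<zeta>) = sw O11 (\<lambda>a1 a2. lact11 C a1 (braid_e (ract0 C v a2) \<zeta>)) a"
proof (rule O1_ext[where X = O11 and f = "\<lambda>\<zeta>. braid_e v (lact1 C a \<zeta>)" and
      g = "\<lambda>\<zeta>. sw O11 (\<lambda>a1 a2. lact11 C a1 (braid_e (ract0 C v a2) \<zeta>)) a", OF _ _ _ _ \<zeta>])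
  note [simp] = v
  fix h g
  have "braid_e v (lact1 C a (D h g)) = sw O11 (\<lambda>a1 a2. sw O11 (\<lambda>h1 h2. sw O11 (\<lambda>g1 g2.
      pureH C (D (a1 * h1) g1) (eMC C (ract0 C v (a2 * h2 * g2)))) g) h) a"
    unfolding lact1_D braid_e_D[OF v] unfolding braid_hdg_def by (rule sw_mult; (intro multilinear)?; simp)
  also have "\<dots> = sw O11 (\<lambda>a1 a2. lact11 C a1 (braid_hdg (ract0 C v a2) h g)) a"
  proof (rule sw_cong)
    fix a1 a2
    have "lact11 C a1 (braid_hdg (ract0 C v a2) h g) = sw O11 (\<lambda>h1 h2. lact11 C a1 (sw O11 (\<lambda>g1 g2.
        pureH C (D h1 g1) (eMC C (ract0 C (ract0 C v a2) (h2 * g2)))) g)) h"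
      unfolding braid_hdg_def by (rule sw_map[OF _ _ lin_lact11]; (intro multilinear)?; simp)
    also have "\<dots> = sw O11 (\<lambda>h1 h2. sw O11 (\<lambda>g1 g2. lact11 C a1 (
        pureH C (D h1 g1) (eMC C (ract0 C (ract0 C v a2) (h2 * g2))))) g) h"
      by (rule sw_cong, rule sw_map[OF _ _ lin_lact11]; (intro multilinear)?; simp)
    finally show "sw O11 (\<lambda>h1 h2. sw O11 (\<lambda>g1 g2. pureH C (D (a1 * h1) g1) (eMC C (ract0 C v (a2 * h2 * g2)))) g) h
        = lact11 C a1 (braid_hdg (ract0 C v a2) h g)"
      by (simp add: ract0_mult mult.assoc)
  qed
  finally show "braid_e v (lact1 C a (D h g)) = sw O11 (\<lambda>a1 a2. lact11 C a1 (braid_e (ract0 C v a2) (D h g))) a"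
    by (simp add: braid_e_D)
qed (use v in \<open>((intro multilinear lin_lact1 lin_braid_e_right)?; simp)\<close>)+

text \<open>The Leibniz terms combine to \<open>(h1 dg1) a1 \<otimes> e(v h2 g2 a2)\<close>.
  Balancing moves \<open>a1\<close> to the right factor, where
  \<open>a1 e(v h2 g2 a2) = e(v h2 g2) a\<close> by \<open>eMC_ract1\<close>.\<close>

lemma braid_e_ract1:
  assumes v: "v \<in> carr O0" and \<zeta>: "\<zeta> \<in> carr O1"
  shows "braid_e v (ract1 C \<zeta> a) = ract11 C (braid_e v \<zeta>) a"
proof (rule O1_ext[where X = O11 and f = "\<lambda>\<zeta>. braid_e v (ract1 C \<zeta> a)" and
      g = "\<lambda>\<zeta>. ract11 C (braid_e v \<zeta>) a", OF _ _ _ _ \<zeta>])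
  note [simp] = v
  fix h g
  let ?e = "\<lambda>h2 g2 a2. eMC C (ract0 C v (h2 * (g2 * a2)))"
  have 1: "braid_hdg v h (g * a) = sw O11 (\<lambda>h1 h2. sw O11 (\<lambda>g1 g2. sw O11 (\<lambda>a1 a2.
      pureH C (D h1 (g1 * a1)) (?e h2 g2 a2)) a) g) h"
    unfolding braid_hdg_def by (rule sw_cong, rule sw_mult; (intro multilinear)?; simp)
  have "braid_hdg v (h * g) a = sw O11 (\<lambda>h1 h2. sw O11 (\<lambda>g1 g2. sw O11 (\<lambda>a1 a2.
      pureH C (D (h1 * g1) a1) (eMC C (ract0 C v (h2 * g2 * a2)))) a) g) h"
    unfolding braid_hdg_def by (rule sw_mult; (intro multilinear)?; simp)
  then have 2: "braid_hdg v (h * g) a = sw O11 (\<lambda>h1 h2. sw O11 (\<lambda>g1 g2. sw O11 (\<lambda>a1 a2.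
      pureH C (D (h1 * g1) a1) (?e h2 g2 a2)) a) g) h" by (simp add: mult.assoc)
  have "braid_e v (ract1 C (D h g) a) = vminus O11 (braid_hdg v h (g * a)) (braid_hdg v (h * g) a)"
    by (simp add: ract1_D vlinear_vminus[OF _ lin_braid_e_right] braid_e_D)
  also have "\<dots> = sw O11 (\<lambda>h1 h2. vminus O11 (sw O11 (\<lambda>g1 g2. sw O11 (\<lambda>a1 a2.
      pureH C (D h1 (g1 * a1)) (?e h2 g2 a2)) a) g) (sw O11 (\<lambda>g1 g2. sw O11 (\<lambda>a1 a2.
      pureH C (D (h1 * g1) a1) (?e h2 g2 a2)) a) g)) h"
    unfolding 1 2 by (rule sw_vminus[symmetric]; (intro multilinear)?; simp)
  also have "\<dots> = sw O11 (\<lambda>h1 h2. sw O11 (\<lambda>g1 g2. vminus O11 (sw O11 (\<lambda>a1 a2.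
      pureH C (D h1 (g1 * a1)) (?e h2 g2 a2)) a) (sw O11 (\<lambda>a1 a2.
      pureH C (D (h1 * g1) a1) (?e h2 g2 a2)) a)) g) h"
    by (rule sw_cong, rule sw_vminus[symmetric]; (intro multilinear)?; simp)
  also have "\<dots> = sw O11 (\<lambda>h1 h2. sw O11 (\<lambda>g1 g2. sw O11 (\<lambda>a1 a2. vminus O11 (
      pureH C (D h1 (g1 * a1)) (?e h2 g2 a2)) (pureH C (D (h1 * g1) a1) (?e h2 g2 a2))) a) g) h"
    by (rule sw_cong, rule sw_cong, rule sw_vminus[symmetric]; (intro multilinear)?; simp)
  also have "\<dots> = sw O11 (\<lambda>h1 h2. sw O11 (\<lambda>g1 g2. sw O11 (\<lambda>a1 a2.
      pureH C (ract1 C (D h1 g1) a1) (?e h2 g2 a2)) a) g) h"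
    by (simp add: ract1_D vlinear_vminus[OF _ vbilinear_left[OF bil_pureH]])
  also have "\<dots> = sw O11 (\<lambda>h1 h2. sw O11 (\<lambda>g1 g2.
      pureH C (D h1 g1) (ract1 C (eMC C (ract0 C v (h2 * g2))) a)) g) h"
  proof (rule sw_cong, rule sw_cong)
    fix h1 h2 g1 g2
    have "pureH C (D h1 g1) (ract1 C (eMC C (ract0 C v (h2 * g2))) a)
        = sw O11 (\<lambda>b c. pureH C (D h1 g1) (lact1 C b (eMC C (ract0 C (ract0 C v (h2 * g2)) c)))) a"
      by (subst eMC_ract1, simp, rule sw_map[where f = "\<lambda>\<omega>. pureH C (D h1 g1) \<omega>"]; (intro multilinear)?; simp)
    then show "sw O11 (\<lambda>a1 a2. pureH C (ract1 C (D h1 g1) a1) (?e h2 g2 a2)) a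
        = pureH C (D h1 g1) (ract1 C (eMC C (ract0 C v (h2 * g2))) a)"
      by (simp add: pureH_balance ract0_mult mult.assoc)
  qed
  also have "\<dots> = sw O11 (\<lambda>h1 h2. sw O11 (\<lambda>g1 g2.
      ract11 C (pureH C (D h1 g1) (eMC C (ract0 C v (h2 * g2)))) a) g) h" by simp
  also have "\<dots> = sw O11 (\<lambda>h1 h2. ract11 C (sw O11 (\<lambda>g1 g2.
      pureH C (D h1 g1) (eMC C (ract0 C v (h2 * g2)))) g) a) h"
    by (rule sw_cong, rule sw_map[OF _ _ lin_ract11, symmetric]; (intro multilinear)?; simp)
  also have "\<dots> = ract11 C (braid_hdg v h g) a"
    unfolding braid_hdg_def by (rule sw_map[OF _ _ lin_ract11, symmetric]; (intro multilinear)?; simp)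
  finally show "braid_e v (ract1 C (D h g) a) = ract11 C (braid_e v (D h g)) a" by (simp add: braid_e_D)
qed (use v in \<open>((intro multilinear lin_ract1 lin_braid_e_right)?; simp)\<close>)+

text \<open>With \<open>e(w) = S(y1) dy2\<close>, the claim is \<open>braid_hdg_antip\<close> at
  \<open>h = 1\<close>, whose right-hand side is the formula for \<open>Psi0\<close> under
  \<open>e \<otimes> e\<close>.\<close>

lemma braid_e_eMC:
  assumes v: "v \<in> carr O0" and w: "w \<in> carr O0"
  shows "braid_e v (eMC C w) = eMC2 C (Psi0 C (pure O0 O0 v w))"
proof -
  note [simp] = v
  obtain y where y: "w = p y" using w by (elim p_surj)
  have b: "vbilinear O0 H O11 (\<lambda>u x. pureH C (eMC C u) (eMC C (ract0 C v x)))"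
    by (intro vbilinearI multilinear lin_eMC; simp)
  have "braid_e v (eMC C w) = sw O11 (\<lambda>a b. braid_e v (D (S a) b)) y"
    unfolding y eMC_p by (rule sw_map[OF _ _ lin_braid_e_right]; (intro multilinear)?; simp)
  also have "\<dots> = sw O11 (\<lambda>a b. braid_hdg v (1 * S a) b) y" by (simp add: braid_e_D)
  also have "\<dots> = sw O11 (\<lambda>a y. sw O11 (\<lambda>x c.
      pureH C (lact1 C 1 (eMC C (p x))) (eMC C (ract0 C v (1 * (S a * c))))) y) y"
    unfolding braid_hdg_antip[OF v] by (rule sw_one; (intro multilinear)?; simp)
  also have "\<dots> = Ad_apply O11 (\<lambda>u x. pureH C (eMC C u) (eMC C (ract0 C v x))) w"
    by (simp add: y Ad_apply_p[OF _ b])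
  also have "\<dots> = Ad_apply O11 (\<lambda>u x. eMC2 C (pure O0 O0 u (ract0 C v x))) w"
    unfolding y Ad_apply_p[OF is_vspace_O11 b] Ad_apply_p[OF is_vspace_O11 vbilinear_compose[OF lin_eMC2 bil_Psi[OF v]]]
    by (simp add: eMC2_pure)
  also have "\<dots> = eMC2 C (Psi0 C (pure O0 O0 v w))"
    unfolding Psi0_pure[OF v w] by (rule Ad_apply_map[OF _ _ bil_Psi[OF v] lin_eMC2 w, symmetric]) simp_all
  finally show ?thesis .
qed

section \<open>The braiding on all one-forms, by left linearity\<close>

definition braid :: "('k, 'h, 'h) tens set \<Rightarrow> ('k, 'h, 'h) tens set \<Rightarrow> ('k, 'h) tens11"
  where "braid \<omega> \<zeta> = llift O11 (\<lambda>v h. lact11 C h (braid_e v \<zeta>)) \<omega>"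

lemma bil_brJ: "\<zeta> \<in> carr O1 \<Longrightarrow> vbilinear O0 H O11 (\<lambda>v h. lact11 C h (braid_e v \<zeta>))"
  by (intro vbilinearI multilinear; simp)

lemma lin_braid_left: "\<zeta> \<in> carr O1 \<Longrightarrow> vlinear O1 O11 (\<lambda>\<omega>. braid \<omega> \<zeta>)"
  unfolding braid_def by (rule lin_llift[OF is_vspace_O11 bil_brJ])

lemma lin_braid_right: "\<omega> \<in> carr O1 \<Longrightarrow> vlinear O1 O11 (\<lambda>\<zeta>. braid \<omega> \<zeta>)"
  unfolding braid_def by (rule lin_llift_param[OF is_vspace_O11 is_vspace_O1 bil_brJ]; (intro multilinear)?; simp)

lemma braid_eMC: "v \<in> carr O0 \<Longrightarrow> \<zeta> \<in> carr O1 \<Longrightarrow> braid (lact1 C h (eMC C v)) \<zeta> = lact11 C h (braid_e v \<zeta>)"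
  unfolding braid_def by (rule llift_lact1_eMC[OF is_vspace_O11 bil_brJ])

lemma bil_braid: "vbilinear O1 O1 O11 braid"
  by (intro vbilinearI lin_braid_left lin_braid_right)

text \<open>On \<open>\<omega> = h e(v)\<close> both sides are \<open>h a1\<close> times the
  braiding of \<open>e(v a2)\<close> with \<open>\<zeta>\<close>: on the left by moving
  \<open>a\<close> through \<open>e(v)\<close>, on the right by
  \<open>braid_e_lact1\<close>.\<close>

lemma braid_balance:
  assumes \<omega>: "\<omega> \<in> carr O1" and \<zeta>: "\<zeta> \<in> carr O1"
  shows "braid (ract1 C \<omega> a) \<zeta> = braid \<omega> (lact1 C a \<zeta>)"
proof (rule O1_ext_eMC[where X = O11 and f = "\<lambda>\<omega>. braid (ract1 C \<omega> a) \<zeta>" and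
      g = "\<lambda>\<omega>. braid \<omega> (lact1 C a \<zeta>)", OF _ _ _ _ \<omega>])
  note [simp] = \<zeta>
  show "vlinear O1 O11 (\<lambda>\<omega>. braid (ract1 C \<omega> a) \<zeta>)"
    by (rule vlinear_compose[OF lin_braid_left lin_ract1]) simp
  show "vlinear O1 O11 (\<lambda>\<omega>. braid \<omega> (lact1 C a \<zeta>))" by (rule lin_braid_left) simp
  fix h v assume v [simp]: "v \<in> carr O0"
  have "ract1 C (lact1 C h (eMC C v)) a = lact1 C h (sw O1 (\<lambda>b c. lact1 C b (eMC C (ract0 C v c))) a)"
    by (simp add: eMC_ract1 flip: lact1_ract1)
  also have "\<dots> = sw O1 (\<lambda>b c. lact1 C h (lact1 C b (eMC C (ract0 C v c)))) a"
    by (rule sw_map[OF _ _ lin_lact1]; (intro multilinear)?; simp)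
  finally have "braid (ract1 C (lact1 C h (eMC C v)) a) \<zeta>
      = braid (sw O1 (\<lambda>b c. lact1 C (h * b) (eMC C (ract0 C v c))) a) \<zeta>"
    by (simp add: lact1_lact1)
  also have "\<dots> = sw O11 (\<lambda>b c. braid (lact1 C (h * b) (eMC C (ract0 C v c))) \<zeta>) a"
    by (rule sw_map[OF _ _ lin_braid_left[OF \<zeta>]]; (intro multilinear)?; simp)
  also have "\<dots> = sw O11 (\<lambda>b c. lact11 C h (lact11 C b (braid_e (ract0 C v c) \<zeta>))) a"
    by (simp add: braid_eMC lact11_lact11)
  also have "\<dots> = lact11 C h (braid_e v (lact1 C a \<zeta>))"
    unfolding braid_e_lact1[OF v \<zeta>] by (rule sw_map[OF _ _ lin_lact11, symmetric]; (intro multilinear)?; simp)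
  finally show "braid (ract1 C (lact1 C h (eMC C v)) a) \<zeta> = braid (lact1 C h (eMC C v)) (lact1 C a \<zeta>)"
    by (simp add: braid_eMC)
qed simp_all

lemma braid_lact1: "\<omega> \<in> carr O1 \<Longrightarrow> \<zeta> \<in> carr O1 \<Longrightarrow> braid (lact1 C a \<omega>) \<zeta> = lact11 C a (braid \<omega> \<zeta>)"
  by (rule O1_ext_eMC[where X = O11 and f = "\<lambda>\<omega>. braid (lact1 C a \<omega>) \<zeta>" and g = "\<lambda>\<omega>. lact11 C a (braid \<omega> \<zeta>)"];
    (intro vlinear_compose[OF lin_braid_left lin_lact1] vlinear_compose[OF lin_lact11 lin_braid_left])?;
    simp add: lact1_lact1 braid_eMC lact11_lact11)

lemma braid_ract1: "\<omega> \<in> carr O1 \<Longrightarrow> \<zeta> \<in> carr O1 \<Longrightarrow> braid \<omega> (ract1 C \<zeta> a) = ract11 C (braid \<omega> \<zeta>) a"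
  by (rule O1_ext_eMC[where X = O11 and f = "\<lambda>\<omega>. braid \<omega> (ract1 C \<zeta> a)" and g = "\<lambda>\<omega>. ract11 C (braid \<omega> \<zeta>) a"];
    (intro lin_braid_left vlinear_compose[OF lin_ract11 lin_braid_left])?;
    simp add: braid_eMC braid_e_ract1 lact11_ract11)

lemma Psi1_ex: "\<exists>f. f \<in> extensional (carr O11) \<and> vlinear O11 O11 f \<and>
    (\<forall>a. \<forall>s\<in>carr O11. f (lact11 C a s) = lact11 C a (f s)) \<and>
    (\<forall>a. \<forall>s\<in>carr O11. f (ract11 C s a) = ract11 C (f s) a) \<and>
    (\<forall>t\<in>carr O00. f (eMC2 C t) = eMC2 C (Psi0 C t))"
proof -
  define f where "f = (\<lambda>s. the_elem (tlift O1 O1 O11 braid ` s))"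
  note lf = lin_O11_lift[OF is_vspace_O11 bil_braid braid_balance, folded f_def]
  have fp: "f (pureH C \<omega> \<zeta>) = braid \<omega> \<zeta>" if "\<omega> \<in> carr O1" "\<zeta> \<in> carr O1" for \<omega> \<zeta>
    unfolding f_def using O11_lift_pureH[OF is_vspace_O11 bil_braid braid_balance that] .
  have l: "f (lact11 C a s) = lact11 C a (f s)" if "s \<in> carr O11" for a s
  proof (rule O11_ext[OF is_vspace_O11 vlinear_compose[OF lf lin_lact11] vlinear_compose[OF lin_lact11 lf] _ that])
    fix \<omega> \<zeta> assume c: "\<omega> \<in> carr O1" "\<zeta> \<in> carr O1"
    have "f (lact11 C a (pureH C \<omega> \<zeta>)) = braid (lact1 C a \<omega>) \<zeta>" using c by (simp only: lact11_pureH fp lact1_carr)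
    also have "\<dots> = lact11 C a (f (pureH C \<omega> \<zeta>))" using c by (simp only: braid_lact1 fp)
    finally show "f (lact11 C a (pureH C \<omega> \<zeta>)) = lact11 C a (f (pureH C \<omega> \<zeta>))" .
  qed
  have r: "f (ract11 C s a) = ract11 C (f s) a" if "s \<in> carr O11" for a s
  proof (rule O11_ext[OF is_vspace_O11 vlinear_compose[OF lf lin_ract11] vlinear_compose[OF lin_ract11 lf] _ that])
    fix \<omega> \<zeta> assume c: "\<omega> \<in> carr O1" "\<zeta> \<in> carr O1"
    have "f (ract11 C (pureH C \<omega> \<zeta>) a) = braid \<omega> (ract1 C \<zeta> a)" using c by (simp only: ract11_pureH fp ract1_carr)
    also have "\<dots> = ract11 C (f (pureH C \<omega> \<zeta>)) a" using c by (simp only: braid_ract1 fp)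
    finally show "f (ract11 C (pureH C \<omega> \<zeta>) a) = ract11 C (f (pureH C \<omega> \<zeta>)) a" .
  qed
  have "f (eMC2 C t) = eMC2 C (Psi0 C t)" if t: "t \<in> carr O00" for t
  proof (rule tensor_ext[OF _ _ is_vspace_O11 vlinear_compose[OF lf lin_eMC2] vlinear_compose[OF lin_eMC2 lin_Psi0] _ t])
    fix v w assume v: "v \<in> carr O0" "w \<in> carr O0"
    have "f (eMC2 C (pure O0 O0 v w)) = braid (lact1 C 1 (eMC C v)) (eMC C w)"
      using v by (simp add: eMC2_pure fp)
    also have "\<dots> = braid_e v (eMC C w)" using v by (subst braid_eMC) simp_all
    finally show "f (eMC2 C (pure O0 O0 v w)) = eMC2 C (Psi0 C (pure O0 O0 v w))"
      using v by (simp add: braid_e_eMC)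
  qed simp_all
  then show ?thesis
    using lf l r vlinear_carr[OF lf]
    by (intro exI[of _ "restrict f (carr O11)"]) (simp add: vlinear_restrict)
qed

text \<open>Left multiples of the image of \<open>eMC2 C\<close> span the space: \<open>e(v)
  \<otimes> h e(w) = e(v) h \<otimes> e(w) = h1 e(v h2) \<otimes> e(w)\<close>, and one-forms are
  sums of elements \<open>h e(v)\<close>.\<close>

lemma Psi1_unique:
  assumes f: "vlinear O11 O11 f" "\<And>a s. s \<in> carr O11 \<Longrightarrow> f (lact11 C a s) = lact11 C a (f s)"
    and g: "vlinear O11 O11 g" "\<And>a s. s \<in> carr O11 \<Longrightarrow> g (lact11 C a s) = lact11 C a (g s)"
    and eq: "\<And>t. t \<in> carr O00 \<Longrightarrow> f (eMC2 C t) = g (eMC2 C t)" and s: "s \<in> carr O11"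
  shows "f s = g s"
proof (rule O11_ext[OF is_vspace_O11 f(1) g(1) _ s])
  have lin: "vlinear O1 O11 (\<lambda>\<omega>. k (pureH C \<omega> \<zeta>))" "vlinear O1 O11 (\<lambda>\<omega>. k (pureH C \<zeta> \<omega>))"
    if "vlinear O11 O11 k" "\<zeta> \<in> carr O1" for k \<zeta>
    by (rule vlinear_compose[OF that(1)]; intro multilinear that)+
  have 1: "f (pureH C (eMC C v) \<zeta>) = g (pureH C (eMC C v) \<zeta>)" if v: "v \<in> carr O0" and \<zeta>: "\<zeta> \<in> carr O1" for v \<zeta>
  proof (rule O1_ext_eMC[OF is_vspace_O11 lin(2)[OF f(1)] lin(2)[OF g(1)] _ \<zeta>])
    note [simp] = v
    fix h w assume w [simp]: "w \<in> carr O0"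
    have "pureH C (eMC C v) (lact1 C h (eMC C w)) = pureH C (sw O1 (\<lambda>b c. lact1 C b (eMC C (ract0 C v c))) h) (eMC C w)"
      by (simp add: eMC_ract1 flip: pureH_balance)
    also have "\<dots> = sw O11 (\<lambda>b c. pureH C (lact1 C b (eMC C (ract0 C v c))) (eMC C w)) h"
      by (rule sw_map[where f = "\<lambda>\<omega>. pureH C \<omega> (eMC C w)"]; (intro multilinear)?; simp)
    finally have e: "pureH C (eMC C v) (lact1 C h (eMC C w))
        = sw O11 (\<lambda>b c. lact11 C b (eMC2 C (pure O0 O0 (ract0 C v c) w))) h"
      by (simp add: eMC2_pure)
    have k: "k (pureH C (eMC C v) (lact1 C h (eMC C w)))
        = sw O11 (\<lambda>b c. k (lact11 C b (eMC2 C (pure O0 O0 (ract0 C v c) w)))) h" if "vlinear O11 O11 k" for k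
      unfolding e by (rule sw_map[OF _ _ that]; (intro multilinear vlinear_compose[OF lin_eMC2])?; simp)
    show "f (pureH C (eMC C v) (lact1 C h (eMC C w))) = g (pureH C (eMC C v) (lact1 C h (eMC C w)))"
      unfolding k[OF f(1)] k[OF g(1)] by (simp add: f(2) g(2) eq)
  qed (simp_all add: v)
  fix \<omega> \<zeta> assume \<omega>: "\<omega> \<in> carr O1" and \<zeta>: "\<zeta> \<in> carr O1"
  show "f (pureH C \<omega> \<zeta>) = g (pureH C \<omega> \<zeta>)"
  proof (rule O1_ext_eMC[OF is_vspace_O11 lin(1)[OF f(1)] lin(1)[OF g(1)] _ \<omega>])
    fix h v assume v: "v \<in> carr O0"
    show "f (pureH C (lact1 C h (eMC C v)) \<zeta>) = g (pureH C (lact1 C h (eMC C v)) \<zeta>)"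
      using f(2)[of "pureH C (eMC C v) \<zeta>" h] g(2)[of "pureH C (eMC C v) \<zeta>" h] v \<zeta> by (simp add: 1)
  qed (rule \<zeta>)+
qed

lemma Psi1_eMC2: "t \<in> carr O00 \<Longrightarrow> Psi1 C (eMC2 C t) = eMC2 C (Psi0 C t)"
  and lin_Psi1: "vlinear O11 O11 (Psi1 C)"
proof -
  let ?P = "\<lambda>f. f \<in> extensional (carr O11) \<and> vlinear O11 O11 f \<and>
    (\<forall>a. \<forall>s\<in>carr O11. f (lact11 C a s) = lact11 C a (f s)) \<and>
    (\<forall>a. \<forall>s\<in>carr O11. f (ract11 C s a) = ract11 C (f s) a) \<and>
    (\<forall>t\<in>carr O00. f (eMC2 C t) = eMC2 C (Psi0 C t))"
  obtain f where f: "?P f" using Psi1_ex by blast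
  have "Psi1 C = f" unfolding Psi1_def
  proof (rule the_equality, rule f)
    fix g assume g: "?P g"
    show "g = f"
    proof (rule extensionalityI[where A = "carr O11"])
      show "g s = f s" if "s \<in> carr O11" for s
        by (rule Psi1_unique[OF _ _ _ _ _ that]) (use f g in simp_all)
    qed (use f g in simp_all)
  qed
  with f show "t \<in> carr O00 \<Longrightarrow> Psi1 C (eMC2 C t) = eMC2 C (Psi0 C t)" "vlinear O11 O11 (Psi1 C)"
    by simp_all
qed

section \<open>The metric\<close>

abbreviation "Si \<equiv> inv (antip C)"

lemma S_Si [simp]: "S (Si h) = h"
  using bij_antip by (simp add: bij_is_surj surj_f_inv_f)

lemma lin_Si [multilinear]: "vlinear U H g \<Longrightarrow> vlinear U H (\<lambda>u. Si (g u))"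
proof -
  have "viso H H S" using lin_antip bij_antip by (simp add: viso_def)
  then have "vlinear H H Si" using vlinear_viso_inv[OF is_vspace_H, of H S] by simp
  then show "vlinear U H g \<Longrightarrow> vlinear U H (\<lambda>u. Si (g u))" by (rule vlinear_compose)
qed

text \<open>Applying the injective map \<open>S\<close> turns a contraction with the inverse
  antipode into one with \<open>S\<close>, because \<open>S\<close> reverses products.\<close>

lemma cancels_if_antip:
  assumes K: "bil H K" and e: "\<And>h. sw H (\<lambda>a b. S (K a b)) h = hscale C (\<epsilon> h) 1"
  shows "cancels K"
proof -
  have "S (sw H K h) = S (hscale C (\<epsilon> h) 1)" for h
    using e[of h] sw_map[OF _ _ lin_antip K, of h] vlinear_vscale[OF lin_antip, of 1 "\<epsilon> h"] by simp
  then have "sw H K h = hscale C (\<epsilon> h) 1" for h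
    using bij_antip by (meson bij_is_inj injD)
  with K show ?thesis by (simp add: cancels_def)
qed

lemma cancels_Si_left: "cancels (\<lambda>a b. Si b * a)"
proof (rule cancels_if_antip)
  show "sw H (\<lambda>a b. S (Si b * a)) h = hscale C (\<epsilon> h) 1" for h
    using cancels_antip_left by (simp add: antip_mult cancels_def)
qed (intro multilinear)

lemma cancels_Si_right: "cancels (\<lambda>a b. b * Si a)"
proof (rule cancels_if_antip)
  show "sw H (\<lambda>a b. S (b * Si a)) h = hscale C (\<epsilon> h) 1" for h
    using cancels_antip_right by (simp add: antip_mult cancels_def)
qed (intro multilinear)

section \<open>Transport of the Killing form from \<open>\<Omega>_0\<close> to
  \<open>V\<close>\<close>

abbreviation "V \<equiv> EndW C"
abbreviation "VV \<equiv> tensor V V"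
abbreviation "inv0 \<equiv> inv_into (carr O0) (rhoQ0 C)"

lemma lin_inv0: "vlinear V O0 inv0"
  by (rule vlinear_viso_inv[OF is_vspace_O0 viso_rhoQ0])

lemma eV_rhoQ0: "v \<in> carr O0 \<Longrightarrow> eV C (rhoQ0 C v) = eMC C v"
  by (simp add: eV_def viso_inv_left[OF viso_rhoQ0])

lemma lin_eV: "vlinear V O1 (eV C)"
  unfolding eV_def[abs_def] by (rule vlinear_compose[OF lin_eMC lin_inv0])

lemmas lin_eV_comp [multilinear] = vlinear_compose[OF lin_eV]

lemma eV_carr [simp]: "m \<in> carr V \<Longrightarrow> eV C m \<in> carr O1"
  by (rule vlinear_carr[OF lin_eV])

lemma rhoQ0_carr [simp]: "v \<in> carr O0 \<Longrightarrow> rhoQ0 C v \<in> carr V"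
  by (rule vlinear_carr[OF lin_rhoQ0])

lemma is_vspace_VV [simp]: "is_vspace VV"
  by (rule is_vspace_tensor) simp_all

lemma bil_eVeV: "vbilinear V V O11 (\<lambda>x y. pureH C (eV C x) (eV C y))"
  by (intro vbilinearI multilinear lin_eV; simp)

lemma bil_rhoQ0: "vbilinear O0 O0 VV (\<lambda>v w. pure V V (rhoQ0 C v) (rhoQ0 C w))"
  by (intro vbilinearI multilinear lin_rhoQ0; simp)

lemma eta_carr: "eta C \<in> carr VV"
  using vlinear_carr[OF vlinear_tlift[OF _ _ _ bil_rhoQ0] eta0_carr]
  by (simp add: tmap_rhoQ0_eta0[unfolded tmap_def, symmetric])

text \<open>\<open>eta\<close> is the image of \<open>eta0\<close> under \<open>rhoQ0 C\<close> on
  both legs, and \<open>eV C\<close> inverts \<open>rhoQ0 C\<close> before applying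
  \<open>eMC C\<close>. Symmetry of \<open>g\<close> thereby reduces to that of
  \<open>eta0\<close>.\<close>

lemma gmetric_eq: "gmetric C = eMC2 C (eta0 C)"
proof -
  note l1 = vlinear_tlift[OF is_vspace_EndW is_vspace_EndW is_vspace_O11 bil_eVeV]
  note l2 = vlinear_tlift[OF is_vspace_O0 is_vspace_O0 is_vspace_VV bil_rhoQ0]
  have "tlift V V O11 (\<lambda>x y. pureH C (eV C x) (eV C y))
      (tlift O0 O0 VV (\<lambda>v w. pure V V (rhoQ0 C v) (rhoQ0 C w)) (eta0 C)) = eMC2 C (eta0 C)"
    by (rule tensor_ext[OF _ _ is_vspace_O11 vlinear_compose[OF l1 l2] lin_eMC2 _ eta0_carr])
       (simp_all add: tlift_pure bil_eVeV bil_rhoQ0 eMC2_pure eV_rhoQ0)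
  then show ?thesis
    by (simp add: gmetric_def tmap_rhoQ0_eta0[unfolded tmap_def, symmetric])
qed

lemma Psi1_gmetric: "Psi1 C (gmetric C) = gmetric C"
  by (simp add: gmetric_eq Psi1_eMC2 eta0_carr Psi0_eta0)

text \<open>\<open>Omega2\<close> divides out the kernel of \<open>id - Psi\<close>, so that an
  element fixed by \<open>Psi1\<close> has class zero.\<close>

lemma wedge_gmetric: "wedge C (gmetric C) = vzero (Omega2 C)"
proof -
  have l: "vlinear O11 O11 (\<lambda>s. vminus O11 s (Psi1 C s))"
    by (rule vlinear_minus[OF _ vlinear_ident lin_Psi1]) simp
  have sub: "vsubspace O11 (ker_id_minus_Psi C)"
    using vsubspace_kernel[OF _ _ l] by (simp add: ker_id_minus_Psi_def)
  have g: "gmetric C \<in> carr O11" by (simp add: gmetric_eq eta0_carr)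
  then have "gmetric C \<in> ker_id_minus_Psi C"
    by (simp add: ker_id_minus_Psi_def Psi1_gmetric)
  then show ?thesis
    unfolding wedge_def Omega2_def using coset_eq_vzero[OF _ sub g] by simp
qed

section \<open>Dual bases of \<open>End(W)\<close>\<close>

lemma is_vspace_vdual [simp]: "is_vspace (vdual V)"
  by (simp add: vdual_def is_vspace_vhom)

lemma vdual_lin: "x \<in> carr (vdual V) \<Longrightarrow> vlinear V ground x"
  by (simp add: vdual_def vhom_simps)

lemma coord_munit:
  assumes "\<alpha> \<in> B" "\<beta> \<in> B" "\<gamma> \<in> B" "\<delta> \<in> B"
  shows "coord \<alpha> (munit \<gamma> \<delta> \<beta>) = (if \<gamma> = \<alpha> \<and> \<delta> = \<beta> then 1 else 0)"
  using assms vlinear_vscale[OF lin_coord] by (auto simp: munit_def coord_basis)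

lemma EndW_expand:
  assumes m: "m \<in> carr V"
  shows "m = vsum V (\<lambda>i. vscale V (coord (fst i) (m (snd i))) (munit (fst i) (snd i))) (B \<times> B)"
proof
  fix w
  have lm: "vlinear W W m" using m by (simp add: EndW_carr)
  have "vsum V (\<lambda>i. vscale V (coord (fst i) (m (snd i))) (munit (fst i) (snd i))) (B \<times> B) w
      = (\<Sum>i\<in>B \<times> B. vscale V (coord (fst i) (m (snd i))) (munit (fst i) (snd i)) w)"
    by (rule vsum_EndW) simp_all
  also have "\<dots> = (\<Sum>\<alpha>\<in>B. \<Sum>\<beta>\<in>B. wscale C (coord \<beta> w) (wscale C (coord \<alpha> (m \<beta>)) \<alpha>))"
    using vscale_vscale[OF is_vspace_W]
    by (simp add: sum.cartesian_product case_prod_beta EndW_simps munit_def mult.commute)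
  also have "\<dots> = (\<Sum>\<beta>\<in>B. \<Sum>\<alpha>\<in>B. wscale C (coord \<beta> w) (wscale C (coord \<alpha> (m \<beta>)) \<alpha>))"
    by (rule sum.swap)
  also have "\<dots> = (\<Sum>\<beta>\<in>B. wscale C (coord \<beta> w) (m \<beta>))"
  proof (rule sum.cong)
    fix \<beta> assume "\<beta> \<in> B"
    have "wscale C (coord \<beta> w) (vsum W (\<lambda>\<alpha>. wscale C (coord \<alpha> (m \<beta>)) \<alpha>) B)
        = vsum W (\<lambda>\<alpha>. wscale C (coord \<beta> w) (wscale C (coord \<alpha> (m \<beta>)) \<alpha>)) B"
      using vlinear_vsum_apply[OF is_vspace_W is_vspace_W vlinear_scale[OF is_vspace_W vlinear_ident],
        of B "\<lambda>\<alpha>. wscale C (coord \<alpha> (m \<beta>)) \<alpha>" "coord \<beta> w"] by simp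
    then show "(\<Sum>\<alpha>\<in>B. wscale C (coord \<beta> w) (wscale C (coord \<alpha> (m \<beta>)) \<alpha>)) = wscale C (coord \<beta> w) (m \<beta>)"
      by (simp add: sum_coord flip: sum_W)
  qed simp
  also have "\<dots> = vsum W (\<lambda>\<beta>. m (wscale C (coord \<beta> w) \<beta>)) B"
    using vlinear_vscale[OF lm] by (simp add: sum_W)
  also have "\<dots> = m (vsum W (\<lambda>\<beta>. wscale C (coord \<beta> w) \<beta>) B)"
    by (rule vlinear_vsum_apply[OF is_vspace_W is_vspace_W lm, symmetric]) simp
  also have "\<dots> = m w" by (simp add: sum_coord flip: sum_W)
  finally show "m w = vsum V (\<lambda>i. vscale V (coord (fst i) (m (snd i))) (munit (fst i) (snd i))) (B \<times> B) w"
    by simp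
qed

text \<open>The matrix units serve as the basis. Since \<open>dual_bases\<close> indexes functionals
  by the basis vectors themselves, the index pair is recovered from a matrix unit by
  \<open>ix\<close>, which needs the matrix units to be distinct.\<close>

lemma dual_bases_exist: obtains A f where "dual_bases V A f"
proof -
  define u where "u = (\<lambda>i. munit (fst i) (snd i))"
  define ix where "ix = inv_into (B \<times> B) u"
  define f where "f = (\<lambda>a. restrict (\<lambda>m. coord (fst (ix a)) (m (snd (ix a)))) (carr V))"
  have cu: "coord (fst i) (u j (snd i)) = (if i = j then 1 else 0)" if "i \<in> B \<times> B" "j \<in> B \<times> B" for i j
  proof -
    have "coord (fst i) (u j (snd i)) = (if fst j = fst i \<and> snd j = snd i then 1 else 0)"
      unfolding u_def by (rule coord_munit) (use that in auto)
    then show ?thesis by (auto simp: prod_eq_iff)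
  qed
  have inj: "inj_on u (B \<times> B)"
  proof (rule inj_onI)
    fix i j assume ij: "i \<in> B \<times> B" "j \<in> B \<times> B" "u i = u j"
    have "coord (fst i) (u i (snd i)) = coord (fst i) (u j (snd i))" by (simp only: ij(3))
    then show "i = j" unfolding cu[OF ij(1,2)] cu[OF ij(1,1)] by (simp split: if_splits)
  qed
  have ix: "ix (u i) = i" if "i \<in> B \<times> B" for i
    unfolding ix_def by (rule inv_into_f_f[OF inj that])
  have uc: "u i \<in> carr V" for i by (simp add: u_def)
  have fu: "f (u i) m = coord (fst i) (m (snd i))" if "i \<in> B \<times> B" "m \<in> carr V" for i m
    using that by (simp add: f_def ix)
  have "f a \<in> carr (vdual V)" for a
  proof -
    have "vlinear V W (\<lambda>m. m w)" for w unfolding EndW_def by (rule vlinear_eval) simp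
    then have "vlinear V ground (\<lambda>m. coord (fst (ix a)) (m (snd (ix a))))"
      by (rule vlinear_compose[OF lin_coord])
    then show ?thesis by (simp add: vdual_def vhom_simps f_def vlinear_restrict)
  qed
  moreover have "m = vsum V (\<lambda>a. vscale V (f a m) a) (u ` (B \<times> B))" if m: "m \<in> carr V" for m
  proof -
    have "vsum V (\<lambda>a. vscale V (f a m) a) (u ` (B \<times> B)) = vsum V (\<lambda>i. vscale V (f (u i) m) (u i)) (B \<times> B)"
      by (rule vsum_reindex[OF is_vspace_EndW _ inj]) (simp_all add: uc)
    also have "\<dots> = vsum V (\<lambda>i. vscale V (coord (fst i) (m (snd i))) (u i)) (B \<times> B)"
      by (rule vsum_cong) (simp add: fu m)
    finally show ?thesis using EndW_expand[OF m] by (simp add: u_def)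
  qed
  moreover have "f a b = (if a = b then 1 else 0)" if ab: "a \<in> u ` (B \<times> B)" "b \<in> u ` (B \<times> B)" for a b
  proof -
    obtain i j where ij: "i \<in> B \<times> B" "a = u i" "j \<in> B \<times> B" "b = u j" using ab by blast
    have "f a b = (if i = j then 1 else 0)"
      using ij uc by (simp add: fu cu)
    moreover have "a = b \<longleftrightarrow> i = j" using ij inj by (auto dest: inj_onD)
    ultimately show ?thesis by simp
  qed
  ultimately have "dual_bases V (u ` (B \<times> B)) f"
    unfolding dual_bases_def using uc by auto
  then show ?thesis by (rule that)
qed

section \<open>The metric of a nondegenerate Killing form\<close>

context
  assumes nondeg: "nondegenerate V (eta C)"
begin

definition killing_map :: "(('w \<Rightarrow> 'w) \<Rightarrow> 'k) \<Rightarrow> 'w \<Rightarrow> 'w"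
  where "killing_map x = tlift V V V (\<lambda>v w. vscale V (x w) v) (eta C)"

lemma viso_killing_map: "viso (vdual V) V killing_map"
  using nondeg unfolding nondegenerate_def killing_map_def[abs_def] .

text \<open>The resulting identification of the dual of \<open>V\<close> with
  \<open>\<Omega>_0\<close>; the map \<open>estar\<close> of the metric is \<open>eMC C\<close>
  after \<open>theta\<close>.\<close>

abbreviation "theta x \<equiv> inv0 (killing_map x)"

definition theta_inv :: "'h set \<Rightarrow> ('w \<Rightarrow> 'w) \<Rightarrow> 'k"
  where "theta_inv v = inv_into (carr (vdual V)) killing_map (rhoQ0 C v)"

lemma lin_theta: "vlinear (vdual V) O0 (\<lambda>x. theta x)"
  by (rule vlinear_compose[OF lin_inv0 vlinear_viso[OF viso_killing_map]])

lemma lin_theta_inv: "vlinear O0 (vdual V) theta_inv"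
  unfolding theta_inv_def[abs_def]
  by (rule vlinear_compose[OF vlinear_viso_inv[OF is_vspace_vdual viso_killing_map] lin_rhoQ0])

lemma killing_map_carr [simp]: "x \<in> carr (vdual V) \<Longrightarrow> killing_map x \<in> carr V"
  by (rule vlinear_carr[OF vlinear_viso[OF viso_killing_map]])

lemma theta_carr [simp]: "x \<in> carr (vdual V) \<Longrightarrow> theta x \<in> carr O0"
  and theta_inv_carr [simp]: "v \<in> carr O0 \<Longrightarrow> theta_inv v \<in> carr (vdual V)"
  by (auto intro: vlinear_carr[OF lin_theta] vlinear_carr[OF lin_theta_inv])

lemma theta_inv_theta [simp]: "x \<in> carr (vdual V) \<Longrightarrow> theta_inv (theta x) = x"
  by (simp add: theta_inv_def viso_inv_right[OF viso_rhoQ0] viso_inv_left[OF viso_killing_map])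

lemma theta_theta_inv [simp]: "v \<in> carr O0 \<Longrightarrow> theta (theta_inv v) = v"
  by (simp add: theta_inv_def viso_inv_right[OF viso_killing_map] viso_inv_left[OF viso_rhoQ0])

abbreviation "Y \<equiv> tensor (vdual V) H"

lemma is_vspace_Y [simp]: "is_vspace Y"
  by (rule is_vspace_tensor) simp_all

definition estar_inv :: "'h set \<Rightarrow> 'h \<Rightarrow> ('k, ('w \<Rightarrow> 'w) \<Rightarrow> 'k, 'h) tens"
  where "estar_inv v h = sw Y (\<lambda>a b. pure (vdual V) H (theta_inv (ract0 C v (Si b))) a) h"

lemma bil_estar_inv: "vbilinear O0 H Y estar_inv"
  unfolding estar_inv_def by (intro vbilinearI multilinear vlinear_compose[OF lin_theta_inv]; simp)

text \<open>The inverse of \<open>w \<otimes> h \<mapsto> e\<^sup>*(w) h\<close> comes from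
  \<open>h e(v) = e(v S\<^sup>-\<^sup>1(h\<^sub>(\<^sub>2\<^sub>))) h\<^sub>(\<^sub>1\<^sub>)\<close>.\<close>

lemma viso_estar: "viso Y O1 (tlift (vdual V) H O1 (\<lambda>x h. ract1 C (eV C (killing_map x)) h))"
proof (rule visoI[where g = "llift Y estar_inv"])
  let ?M = "tlift (vdual V) H O1 (\<lambda>x h. ract1 C (eV C (killing_map x)) h)"
  have bM: "vbilinear (vdual V) H O1 (\<lambda>x h. ract1 C (eV C (killing_map x)) h)"
    by (intro vbilinearI multilinear vlinear_viso[OF viso_killing_map]; simp)
  show lM: "vlinear Y O1 ?M" by (rule vlinear_tlift[OF _ _ _ bM]) simp_all
  note lN = lin_llift[OF is_vspace_Y bil_estar_inv]
  show "vlinear O1 Y (llift Y estar_inv)" by (rule lN)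
  have Mp: "?M (pure (vdual V) H x h) = ract1 C (eMC C (theta x)) h" if "x \<in> carr (vdual V)" for x h
    using that by (simp add: tlift_pure bM) (simp add: eV_def)
  show "llift Y estar_inv (?M t) = t" if t: "t \<in> carr Y" for t
  proof (rule tensor_ext[OF _ _ is_vspace_Y vlinear_compose[OF lN lM] vlinear_ident _ t])
    fix x h assume x: "x \<in> carr (vdual V)"
    let ?v = "theta x"
    have v [simp]: "?v \<in> carr O0" using x by simp
    have "llift Y estar_inv (?M (pure (vdual V) H x h))
        = llift Y estar_inv (sw O1 (\<lambda>b c. lact1 C b (eMC C (ract0 C ?v c))) h)"
      by (simp add: Mp x eMC_ract1)
    also have "\<dots> = sw Y (\<lambda>b c. llift Y estar_inv (lact1 C b (eMC C (ract0 C ?v c)))) h"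
      by (rule sw_map[OF _ _ lN]; (intro multilinear)?; simp)
    also have "\<dots> = sw Y (\<lambda>b c. estar_inv (ract0 C ?v c) b) h"
      by (simp add: llift_lact1_eMC[OF is_vspace_Y bil_estar_inv])
    also have "\<dots> = sw Y (\<lambda>y c. sw Y (\<lambda>a b. pure (vdual V) H (theta_inv (ract0 C ?v (c * Si b))) a) y) h"
      by (simp add: estar_inv_def ract0_mult)
    also have "\<dots> = sw Y (\<lambda>a z. sw Y (\<lambda>b c. pure (vdual V) H (theta_inv (ract0 C ?v (c * Si b))) a) z) h"
      by (rule sw_assoc; (intro multilinear vlinear_compose[OF lin_theta_inv])?; simp)
    also have "\<dots> = pure (vdual V) H (theta_inv (ract0 C ?v 1)) h"
      by (rule sw_cancel_right[OF cancels_Si_right, where F = "\<lambda>a u. pure (vdual V) H (theta_inv (ract0 C ?v u)) a"];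
        (intro multilinear vlinear_compose[OF lin_theta_inv])?; simp)
    finally show "llift Y estar_inv (?M (pure (vdual V) H x h)) = pure (vdual V) H x h" using x by simp
  qed simp_all
  show "?M (llift Y estar_inv \<omega>) = \<omega>" if \<omega>: "\<omega> \<in> carr O1" for \<omega>
  proof (rule O1_ext_eMC[OF is_vspace_O1 vlinear_compose[OF lM lN] vlinear_ident _ \<omega>])
    fix h v assume v [simp]: "v \<in> carr O0"
    have "?M (llift Y estar_inv (lact1 C h (eMC C v))) = ?M (estar_inv v h)"
      by (simp add: llift_lact1_eMC[OF is_vspace_Y bil_estar_inv])
    also have "\<dots> = sw O1 (\<lambda>y b. ?M (pure (vdual V) H (theta_inv (ract0 C v (Si b))) y)) h"
      unfolding estar_inv_def by (rule sw_map[OF _ _ lM]; (intro multilinear vlinear_compose[OF lin_theta_inv])?; simp)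
    also have "\<dots> = sw O1 (\<lambda>y b. ract1 C (eMC C (ract0 C v (Si b))) y) h"
      by (simp add: Mp)
    also have "\<dots> = sw O1 (\<lambda>y b. sw O1 (\<lambda>a c. lact1 C a (eMC C (ract0 C v (Si b * c)))) y) h"
      by (simp add: eMC_ract1 ract0_mult)
    also have "\<dots> = sw O1 (\<lambda>a z. sw O1 (\<lambda>c b. lact1 C a (eMC C (ract0 C v (Si b * c)))) z) h"
      by (rule sw_assoc; (intro multilinear)?; simp)
    also have "\<dots> = lact1 C h (eMC C (ract0 C v 1))"
      by (rule sw_cancel_right[OF cancels_Si_left, where F = "\<lambda>a u. lact1 C a (eMC C (ract0 C v u))"];
        (intro multilinear)?; simp)
    finally show "?M (llift Y estar_inv (lact1 C h (eMC C v))) = lact1 C h (eMC C v)" by simp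
  qed
qed

text \<open>The witness for \<open>estar\<close> is \<open>eV C\<close> after
  \<open>killing_map\<close>. Expanding the second leg of \<open>eta\<close> in a basis of
  \<open>V\<close> pairs it with the dual basis, and that pairing is
  \<open>killing_map (f a)\<close>.\<close>

lemma is_metric_gmetric: "is_metric C (gmetric C)"
proof -
  obtain A f where A: "dual_bases V A f" by (rule dual_bases_exist)
  have fin: "finite A" and Ac: "\<And>a. a \<in> A \<Longrightarrow> a \<in> carr V" and fc: "\<And>a. a \<in> A \<Longrightarrow> f a \<in> carr (vdual V)"
    and ex: "\<And>v. v \<in> carr V \<Longrightarrow> vsum V (\<lambda>a. vscale V (f a v) a) A = v"
    using A by (auto simp: dual_bases_def)
  let ?G = "\<lambda>x y. pureH C (eV C x) (eV C y)"
  let ?k = "\<lambda>a. tlift V V V (\<lambda>v w. vscale V (f a w) v)"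
  have bk: "vbilinear V V V (\<lambda>v w. vscale V (f a w) v)" if "a \<in> A" for a
    using vdual_lin[OF fc[OF that]] by (intro vbilinearI multilinear) simp_all
  have lk: "vlinear VV V (?k a)" if "a \<in> A" for a
    by (rule vlinear_tlift[OF _ _ _ bk[OF that]]) simp_all
  \<comment> \<open>Stated for an arbitrary tensor \<open>t\<close>, so that it can be checked on
    pure tensors, where the scalar \<open>f a w\<close> moves from the left factor to the right and
    reassembles \<open>w\<close>.\<close>
  have "tlift V V O11 ?G t = vsum O11 (\<lambda>a. ?G (?k a t) a) A" if t: "t \<in> carr VV" for t
  proof (rule tlift_eqI[OF _ _ _ bil_eVeV _ _ t])
    show "vlinear VV O11 (\<lambda>t. vsum O11 (\<lambda>a. ?G (?k a t) a) A)"
      by (rule vlinear_sum[OF is_vspace_VV is_vspace_O11]) (intro multilinear lk; simp add: Ac)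
    fix v w assume v: "v \<in> carr V" and w: "w \<in> carr V"
    have l: "vlinear V O11 (\<lambda>y. ?G v y)" by (rule vbilinear_right[OF bil_eVeV v])
    have "vsum O11 (\<lambda>a. ?G (?k a (pure V V v w)) a) A = vsum O11 (\<lambda>a. ?G v (vscale V (f a w) a)) A"
    proof (rule vsum_cong)
      fix a assume a: "a \<in> A"
      have "?G (vscale V c v) a = ?G v (vscale V c a)" for c
        using vlinear_vscale[OF l Ac[OF a], of c] vlinear_vscale[OF vbilinear_left[OF bil_eVeV Ac[OF a]] v, of c]
        by simp
      then show "?G (?k a (pure V V v w)) a = ?G v (vscale V (f a w) a)"
        using v w a by (simp add: tlift_pure bk)
    qed
    also have "\<dots> = ?G v (vsum V (\<lambda>a. vscale V (f a w) a) A)"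
      by (rule vlinear_vsum_apply[OF _ _ l, symmetric]) (simp_all add: Ac)
    finally show "vsum O11 (\<lambda>a. ?G (?k a (pure V V v w)) a) A = ?G v w" by (simp add: ex w)
  qed simp_all
  then have "gmetric C = vsum O11 (\<lambda>a. pureH C (eV C (killing_map (f a))) (eV C a)) A"
    using eta_carr by (simp add: gmetric_def killing_map_def)
  moreover have "vlinear (vdual V) O1 (\<lambda>x. eV C (killing_map x))"
    by (rule vlinear_compose[OF lin_eV vlinear_viso[OF viso_killing_map]])
  ultimately show ?thesis
    unfolding is_metric_def using viso_estar A
    by (intro exI[of _ "\<lambda>x. eV C (killing_map x)"] exI[of _ A] exI[of _ f]) simp
qed

end

end

theorem theorem4p7:
  fixes C :: "('k::field, 'h::ring_1, 'w::ab_group_add) calc_data"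
  assumes "hopf_algebra C"
    and "bij (antip C)"
    and "dual_quasitriangular C"
    and "fd_right_comodule C"
    and "rhoQ C ` ker_counit C = carr (EndW C)"
  shows "eta0 C \<in> carr (tensor (Omega0 C) (Omega0 C))
    \<and> Psi0 C (eta0 C) = eta0 C
    \<and> Ad_invariant C (eta0 C)
    \<and> viso (Omega0 C) (EndW C) (rhoQ0 C)
    \<and> tmap (Omega0 C) (Omega0 C) (EndW C) (EndW C) (rhoQ0 C) (rhoQ0 C) (eta0 C) = eta C
    \<and> (nondegenerate (EndW C) (eta C) \<longrightarrow>
        is_metric C (gmetric C)
        \<and> Psi1 C (gmetric C) = gmetric C
        \<and> wedge C (gmetric C) = vzero (Omega2 C))"
proof -
  interpret calc C by unfold_locales (use assms in auto)
  show ?thesis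
    using eta0_carr Psi0_eta0 Ad_invariant_eta0 viso_rhoQ0 tmap_rhoQ0_eta0
      is_metric_gmetric Psi1_gmetric wedge_gmetric by blast
qed

end
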